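(* Let $(A,B)$ be a random pair with values in $\mathbb{R}^+\times\mathbb{R}$ and law $\mu$, and let $(A_n,B_n)$, $n\ge1$, be i.i.d. copies of it. Consider the recursion $$\widetilde X_n=\max\{A_n\widetilde X_{n-1}+B_n,\ 0\},\quad n\ge1$$ (the Letac recursion with $AC+B=0$). Assume $\mathbb{E}\log A<0$, $\mathbb{E}A^\alpha=1$ for some $\alpha>0$, $\mathbb{E}[|B|^\alpha + A^\alpha\log^+A]<\infty$ and the law of $\log A$ is non-arithmetic. Then the stationary solution $\widetilde X$ satisfies $\mathbb{P}[\widetilde X>t]\sim C_M t^{-\alpha}$ as $t\to\infty$ for some constant $C_M\ge0$. For $(a,b)$ with $a\ne1$ let $x(a,b)=\frac{b}{1-a}$, and define $$N_2=\sup\{x(a,b):(a,b)\in\mathrm{supp}\,\mu,\ a<1\},\qquad N_3=\inf\{x(a,b):(a,b)\in\mathrm{supp}\,\mu,\ a>1\}.$$ Assume $\mathbb{P}[A=1,B>0]=0$. Then $C_M>0$ if and only if $N_3<N_2$ or $\mathbb{P}[A>1,B>0]>0$.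
   Context: Special case of the Letac model; the result gives an optimal condition for positivity of the tail constant, improving the known sufficient condition $\mathbb{P}[A>1,B>0]>0$. *)

theory Defs
  imports "HOL-Probability.Probability"
begin

definition measure_support :: "'a::topological_space measure \<Rightarrow> 'a set" where
  "measure_support M = {x \<in> space M. \<forall>U. open U \<longrightarrow> x \<in> U \<longrightarrow> emeasure M U > 0}"

text \<open>The fixed point of the affine map x \<mapsto> a x + b (for a \<noteq> 1).\<close>
definition xfix :: "real \<Rightarrow> real \<Rightarrow> real" where
  "xfix a b = b / (1 - a)"

definition N2 :: "(real \<times> real) measure \<Rightarrow> ereal" where
  "N2 \<mu> = Sup ((\<lambda>(a,b). ereal (xfix a b)) ` {(a,b) \<in> measure_support \<mu>. a < 1})"

definition N3 :: "(real \<times> real) measure \<Rightarrow> ereal" where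
  "N3 \<mu> = Inf ((\<lambda>(a,b). ereal (xfix a b)) ` {(a,b) \<in> measure_support \<mu>. a > 1})"

definition log_nonarithmetic :: "(real \<times> real) measure \<Rightarrow> bool" where
  "log_nonarithmetic \<mu> \<longleftrightarrow>
     \<not> (\<exists>c>0. AE z in \<mu>. \<exists>k::int. ln (fst z) = c * of_int k)"

definition letac_stationary :: "(real \<times> real) measure \<Rightarrow> real measure \<Rightarrow> bool" where
  "letac_stationary \<mu> \<nu> \<longleftrightarrow> prob_space \<nu> \<and> sets \<nu> = sets borel \<and>
     \<nu> = distr (\<mu> \<Otimes>\<^sub>M \<nu>) borel (\<lambda>((a,b),x). max (a * x + b) 0)"

end

(*
  Tilting the law of log A by A^alpha gives a random walk with positive mean, and
  u |-> e^(alpha u) P[X > e^u] solves a renewal equation for it with an integrable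
  forcing term. The limit is obtained without the renewal measure: a supersolution bounds
  the solution; an asymptotic Choquet-Deny argument shows that its smoothed version is
  asymptotically invariant under all translations; a conservation law then identifies the
  constant as E[X'^alpha - (A X)^alpha] / (alpha m), where X' = max(A X + B, 0) and m is
  the mean of the walk.

  The constant is positive as soon as X is unbounded. For small eps the recursion
  Q = max(A Q - eps |B|, 1) has a positive tail constant, because the gain from the cap is
  bounded below uniformly in eps while the loss from -eps |B| vanishes with eps. For
  L = 1/eps, comparing the tails gives P[X > t] >= P[X > L] P[L Q > t].

  X is bounded exactly when some M >= 0 satisfies A M + B <= M almost surely, which in
  terms of the fixed points b / (1 - a) is the failure of the stated condition.
*)
theory Submission
  imports Defs
begin

section \<open>Random walks with positive drift\<close>

text \<open>The forcing term of the renewal equation is merely integrable, and the weight u |->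
  e^(alpha u) P[X > e^u] may jump, so neither direct Riemann integrability nor uniform continuity is
  at hand. Integrating over windows of length h repairs both; as e^(-alpha u) times the weight is a
  tail, hence decreasing, the windows determine the weight when h tends to 0. The a priori input is
  weak: Markov's inequality with a moment of order s < alpha bounds the weight by a multiple of
  e^((alpha - s) u). Contraction comes from E exp(-theta xi) < 1 for 0 < theta < alpha, xi being the
  tilted step. In the original scale this reads E A^s < 1, the one estimate that also yields the
  moments of X, the tightness of the capped law and the comparison of tails. The obstacle to
  positivity is that E[X'^alpha - (A X)^alpha] has no visible sign when B takes negative values. The
  cap produces a pointwise gain instead. It is measured with exponent alpha/2, because 1 - E A^alpha
  = 0 and moments of order alpha may be infinite.\<close>

lemma exp_greater_add_one:
  fixes x :: real
  assumes "x \<noteq> 0"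
  shows "1 + x < exp x"
proof -
  have "1 + x/2 \<le> exp (x/2)" by (rule exp_ge_add_one_self)
  show ?thesis
  proof (cases "1 + x/2 \<ge> 0")
    case True
    have "1 + x < (1 + x/2)^2" using assms by (simp add: power2_eq_square field_simps flip: not_square_less_zero) (metis not_real_square_gt_zero)
    also have "\<dots> \<le> exp (x/2) ^ 2" using True by (intro power_mono exp_ge_add_one_self)
    also have "\<dots> = exp x" by (simp add: power2_eq_square flip: exp_add)
    finally show ?thesis .
  next
    case False
    then have "1 + x < 0" by simp
    then show ?thesis by (smt (verit) exp_gt_zero)
  qed
qed

text \<open>Tangent bounds for exp taken at the intermediate point \<open>p * y\<close>, evaluated
  at \<open>y\<close> and at 0 and averaged with weights \<open>p\<close> and \<open>1 - p\<close>:
  the linear terms cancel.\<close>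

lemma exp_less_chord:
  fixes p y :: real
  assumes "0 < p" "p < 1" "y \<noteq> 0"
  shows "exp (p * y) < p * exp y + (1 - p)"
proof -
  have "1 + (1-p)*y < exp ((1-p)*y)" "1 + (-p*y) < exp (-p*y)"
    using assms by (intro exp_greater_add_one; simp)+
  then have "p * (1 + (1-p)*y) + (1-p) * (1 + (-p*y)) < p * exp ((1-p)*y) + (1-p) * exp (-p*y)"
    using assms by (intro add_strict_mono mult_strict_left_mono) auto
  then have "1 < p * exp ((1-p)*y) + (1-p) * exp (-p*y)"
    by (simp add: algebra_simps)
  then have "exp (p*y) * 1 < exp (p*y) * (p * exp ((1-p)*y) + (1-p) * exp (-p*y))"
    by (intro mult_strict_left_mono) auto
  also have "\<dots> = p * exp y + (1 - p)"
    by (simp add: algebra_simps flip: exp_add)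
  finally show ?thesis by simp
qed

text \<open>Two kernels occur. \<open>{0..h}\<close> integrates over a window, which makes a bounded
  function Lipschitz even if it jumps; \<open>{..0}\<close> gives the primitive from minus
  infinity.\<close>

definition smooth :: "real set \<Rightarrow> (real \<Rightarrow> real) \<Rightarrow> real \<Rightarrow> real" where
  "smooth S f t = (\<integral>v. indicator S v * f (t + v) \<partial>lborel)"

lemma smooth_measurable [measurable]:
  assumes [measurable]: "f \<in> borel_measurable borel" "S \<in> sets borel"
  shows "smooth S f \<in> borel_measurable borel"
  unfolding smooth_def by measurable

text \<open>Modelled on the law of log A weighted by A^alpha. The factor
  \<open>exp (- \<alpha> * x)\<close> undoes the weight, so its integral is a total mass; this is
  the source of the bound by 1.\<close>

locale renewal_walk = real_distribution \<eta> for \<eta> :: "real measure" +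
  fixes \<alpha> :: real
  assumes alpha_pos: "\<alpha> > 0"
    and exp_alpha_integrable: "integrable \<eta> (\<lambda>x. exp (- \<alpha> * x))"
    and exp_alpha_le: "(\<integral>x. exp (- \<alpha> * x) \<partial>\<eta>) \<le> 1"
    and mean_integrable: "integrable \<eta> (\<lambda>x. x)"
    and nonlattice: "\<not> (\<exists>c>0. AE x in \<eta>. \<exists>k::int. x = c * of_int k)"
begin

definition kap :: "real \<Rightarrow> real" where
  "kap \<theta> = (\<integral>x. exp (- \<theta> * x) \<partial>\<eta>)"

definition mean :: real where
  "mean = (\<integral>x. x \<partial>\<eta>)"

lemma exp_integrable:
  assumes "0 \<le> \<theta>" "\<theta> \<le> \<alpha>"
  shows "integrable \<eta> (\<lambda>x. exp (- \<theta> * x))"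
proof (rule Bochner_Integration.integrable_bound)
  show "integrable \<eta> (\<lambda>x. 1 + exp (- \<alpha> * x))"
    using exp_alpha_integrable by simp
  have "exp (- \<theta> * x) \<le> 1 + exp (- \<alpha> * x)" for x
  proof (cases "x \<ge> 0")
    case True
    then have "exp (- \<theta> * x) \<le> exp 0" using assms by (subst exp_le_cancel_iff) auto
    then show ?thesis by (smt (verit) exp_zero exp_gt_zero)
  next
    case False
    then have "exp (- \<theta> * x) \<le> exp (- \<alpha> * x)" using assms by (simp add: mult_right_mono_neg)
    then show ?thesis by (simp add: add_increasing)
  qed
  then show "AE x in \<eta>. norm (exp (- \<theta> * x)) \<le> norm (1 + exp (- \<alpha> * x))"
    by (intro always_eventually) (smt (verit) exp_gt_zero real_norm_def)
qed simp

text \<open>Strict convexity between the values 1 at 0 and at most 1 at \<open>\<alpha>\<close>.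
  Equality would force all mass to sit at 0, and a point mass at 0 is a lattice law of any
  span.\<close>

lemma kap_less_1:
  assumes "0 < \<theta>" "\<theta> < \<alpha>"
  shows "kap \<theta> < 1"
proof (rule ccontr)
  assume ge: "\<not> kap \<theta> < 1"
  define p where "p = \<theta> / \<alpha>"
  have p: "0 < p" "p < 1" "p * \<alpha> = \<theta>" using assms by (auto simp: p_def)
  define d where "d = (\<lambda>x. p * exp (- \<alpha> * x) + (1 - p) - exp (- \<theta> * x))"
  have d0: "d x > 0" if "x \<noteq> 0" for x
    using exp_less_chord[of p "- \<alpha> * x"] p that alpha_pos by (simp add: d_def mult.assoc flip: p(3))
  have dnn: "d x \<ge> 0" for x
    using d0[of x] by (cases "x = 0") (auto simp: d_def)
  have int: "integrable \<eta> d"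
    unfolding d_def using exp_alpha_integrable exp_integrable[of \<theta>] assms by simp
  have "integral\<^sup>L \<eta> d = p * (\<integral>x. exp (- \<alpha> * x) \<partial>\<eta>) + (1 - p) - kap \<theta>"
    unfolding d_def kap_def using exp_alpha_integrable exp_integrable[of \<theta>] assms
    using prob_space by simp
  also have "\<dots> \<le> p * 1 + (1 - p) - 1"
    using ge exp_alpha_le p by (intro diff_mono add_mono mult_left_mono) auto
  finally have "integral\<^sup>L \<eta> d = 0"
    using dnn by (simp add: order.antisym)
  then have "AE x in \<eta>. d x = 0"
    using integral_nonneg_eq_0_iff_AE[OF int] dnn by auto
  then have "AE x in \<eta>. \<exists>k::int. x = 1 * of_int k"
    by eventually_elim (metis d0 less_irrefl mult_1 of_int_0)
  then show False using nonlattice by (metis zero_less_one)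
qed

lemma kap_nonneg:
  assumes "0 \<le> \<theta>" "\<theta> \<le> \<alpha>"
  shows "kap \<theta> \<ge> 0"
  unfolding kap_def by (intro integral_nonneg_AE) auto

text \<open>The tangent bound for exp at 0 integrates to
  \<open>1 - \<theta> * mean \<le> kap \<theta>\<close>, and the right-hand side is below 1.\<close>

lemma mean_pos: "mean > 0"
proof -
  define \<theta> where "\<theta> = \<alpha> / 2"
  have th: "0 < \<theta>" "\<theta> < \<alpha>" using alpha_pos by (auto simp: \<theta>_def)
  have "1 - \<theta> * mean = (\<integral>x. 1 - \<theta> * x \<partial>\<eta>)"
    using mean_integrable prob_space by (simp add: mean_def)
  also have "\<dots> \<le> kap \<theta>"
    unfolding kap_def
  proof (intro integral_mono)
    show "integrable \<eta> (\<lambda>x. 1 - \<theta> * x)" using mean_integrable by simp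
    show "integrable \<eta> (\<lambda>x. exp (- \<theta> * x))" using exp_integrable[of \<theta>] th by simp
    show "1 - \<theta> * x \<le> exp (- \<theta> * x)" for x
      using exp_ge_add_one_self[of "-\<theta> * x"] by simp
  qed
  also have "\<dots> < 1" using kap_less_1 th by simp
  finally show ?thesis using th by (simp add: zero_less_mult_iff)
qed

text \<open>Convolution with the increment law. The renewal equation with forcing term g reads
  \<open>f t - step f t = g t\<close>; the left-hand side is called the defect of f below.\<close>

definition step :: "(real \<Rightarrow> real) \<Rightarrow> real \<Rightarrow> real" where
  "step f t = (\<integral>x. f (t - x) \<partial>\<eta>)"

lemma step_measurable [measurable]:
  assumes [measurable]: "f \<in> borel_measurable borel"
  shows "step f \<in> borel_measurable borel"
  unfolding step_def by measurable

lemma exp_step: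
  assumes "0 \<le> \<theta>" "\<theta> \<le> \<alpha>"
  shows "integrable \<eta> (\<lambda>x. exp (\<theta> * (t - x)))" "step (\<lambda>t. exp (\<theta> * t)) t = exp (\<theta> * t) * kap \<theta>"
proof -
  have eq: "exp (\<theta> * (t - x)) = exp (\<theta> * t) * exp (- \<theta> * x)" for x
    by (simp add: algebra_simps flip: exp_add)
  show "integrable \<eta> (\<lambda>x. exp (\<theta> * (t - x)))"
    unfolding eq using exp_integrable[OF assms] by simp
  show "step (\<lambda>t. exp (\<theta> * t)) t = exp (\<theta> * t) * kap \<theta>"
    unfolding step_def eq kap_def using exp_integrable[OF assms] by simp
qed

text \<open>The class on which iterating \<open>step\<close> is a contraction: each application
  multiplies K by \<open>kap \<theta>\<close>. The decay at minus infinity matters as much as the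
  growth bound, since it excludes nonzero constants, which \<open>step\<close> preserves.\<close>

definition exp_bdd :: "real \<Rightarrow> real \<Rightarrow> (real \<Rightarrow> real) \<Rightarrow> bool" where
  "exp_bdd \<theta> K f \<longleftrightarrow> f \<in> borel_measurable borel \<and> (\<forall>t. 0 \<le> f t \<and> f t \<le> K * exp (\<theta> * t))"

lemma exp_bdd_D:
  assumes "exp_bdd \<theta> K f"
  shows "f \<in> borel_measurable borel" "0 \<le> f t" "f t \<le> K * exp (\<theta> * t)"
  using assms by (auto simp: exp_bdd_def)

lemma exp_bdd_integrable:
  assumes "0 \<le> \<theta>" "\<theta> \<le> \<alpha>" "exp_bdd \<theta> K f"
  shows "integrable \<eta> (\<lambda>x. f (t - x))"
proof (rule Bochner_Integration.integrable_bound)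
  note [measurable] = exp_bdd_D(1)[OF assms(3)]
  show "(\<lambda>x. f (t - x)) \<in> borel_measurable \<eta>" by measurable
  show "integrable \<eta> (\<lambda>x. K * exp (\<theta> * (t - x)))"
    using exp_step(1)[OF assms(1,2)] by simp
  show "AE x in \<eta>. norm (f (t - x)) \<le> norm (K * exp (\<theta> * (t - x)))"
    using exp_bdd_D[OF assms(3)] by (intro always_eventually allI) (smt (verit) real_norm_def)
qed

lemma exp_bdd_step:
  assumes "0 \<le> \<theta>" "\<theta> \<le> \<alpha>" "exp_bdd \<theta> K f"
  shows "0 \<le> step f t" "step f t \<le> K * kap \<theta> * exp (\<theta> * t)"
proof -
  show "0 \<le> step f t"
    unfolding step_def using exp_bdd_D[OF assms(3)] by (intro integral_nonneg_AE) auto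
  have "step f t \<le> (\<integral>x. K * exp (\<theta> * (t - x)) \<partial>\<eta>)"
    unfolding step_def using exp_bdd_D[OF assms(3)] exp_step(1)[OF assms(1,2)]
    by (intro integral_mono exp_bdd_integrable[OF assms]) auto
  also have "\<dots> = K * kap \<theta> * exp (\<theta> * t)"
    using exp_step[OF assms(1,2), of t] by (simp add: step_def)
  finally show "step f t \<le> K * kap \<theta> * exp (\<theta> * t)" .
qed

context
  fixes S :: "real set" and \<theta> K :: real and f :: "real \<Rightarrow> real"
  assumes S [measurable]: "S \<in> sets borel"
    and S_int: "integrable lborel (\<lambda>v. indicator S v * exp (\<theta> * v))"
    and th: "0 \<le> \<theta>" "\<theta> \<le> \<alpha>" and bdd: "exp_bdd \<theta> K f"
begin

lemma smooth_integrable: "integrable lborel (\<lambda>v. indicator S v * f (t + v))"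
proof (rule Bochner_Integration.integrable_bound)
  note [measurable] = exp_bdd_D(1)[OF bdd]
  show "integrable lborel (\<lambda>v. K * exp (\<theta> * t) * (indicator S v * exp (\<theta> * v)))"
    using S_int by simp
  show "(\<lambda>v. indicator S v * f (t + v)) \<in> borel_measurable lborel" by measurable
  show "AE v in lborel. norm (indicator S v * f (t + v)) \<le> norm (K * exp (\<theta> * t) * (indicator S v * exp (\<theta> * v)))"
  proof (intro always_eventually allI)
    fix v
    show "norm (indicator S v * f (t + v)) \<le> norm (K * exp (\<theta> * t) * (indicator S v * exp (\<theta> * v)))"
      using exp_bdd_D(2,3)[OF bdd, of "t+v"]
      by (auto simp: indicator_def algebra_simps exp_add intro: order_trans[OF _ abs_ge_self])
  qed
qed

lemma smooth_bdd: "exp_bdd \<theta> (K * (\<integral>v. indicator S v * exp (\<theta> * v) \<partial>lborel)) (smooth S f)"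
  unfolding exp_bdd_def
proof (intro conjI allI)
  note [measurable] = exp_bdd_D(1)[OF bdd]
  show "smooth S f \<in> borel_measurable borel" by measurable
  fix t
  show "0 \<le> smooth S f t"
    unfolding smooth_def using exp_bdd_D[OF bdd] by (intro integral_nonneg_AE) auto
  have "smooth S f t \<le> (\<integral>v. K * exp (\<theta> * t) * (indicator S v * exp (\<theta> * v)) \<partial>lborel)"
    unfolding smooth_def
  proof (intro integral_mono smooth_integrable)
    show "integrable lborel (\<lambda>v. K * exp (\<theta> * t) * (indicator S v * exp (\<theta> * v)))"
      using S_int by simp
    show "indicator S v * f (t + v) \<le> K * exp (\<theta> * t) * (indicator S v * exp (\<theta> * v))" for v
      using exp_bdd_D(2,3)[OF bdd, of "t+v"]
      by (simp add: indicator_def algebra_simps exp_add)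
  qed
  also have "\<dots> = K * exp (\<theta> * t) * (\<integral>v. indicator S v * exp (\<theta> * v) \<partial>lborel)"
    by (rule integral_mult_right_zero)
  finally show "smooth S f t \<le> K * (\<integral>v. indicator S v * exp (\<theta> * v) \<partial>lborel) * exp (\<theta> * t)"
    by (simp only: mult_ac)
qed

lemma step_smooth:
  shows "integrable lborel (\<lambda>v. indicator S v * step f (t + v))"
    and "step (smooth S f) t = smooth S (step f) t"
proof -
  note [measurable] = exp_bdd_D(1)[OF bdd]
  interpret pair_sigma_finite \<eta> lborel ..
  have int: "integrable (\<eta> \<Otimes>\<^sub>M lborel) (\<lambda>(x, v). indicator S v * f (t - x + v))"
  proof (rule Fubini_integrable)
    show "(\<lambda>(x, v). indicator S v * f (t - x + v)) \<in> borel_measurable (\<eta> \<Otimes>\<^sub>M lborel)"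
      by measurable
    have "(\<integral>v. norm (indicator S v * f (t - x + v)) \<partial>lborel) = smooth S f (t - x)" for x
      unfolding smooth_def using exp_bdd_D(2)[OF bdd] by (intro Bochner_Integration.integral_cong) auto
    then show "integrable \<eta> (\<lambda>x. \<integral>v. norm (case (x, v) of (x, v) \<Rightarrow> indicator S v * f (t - x + v)) \<partial>lborel)"
      using exp_bdd_integrable[OF th smooth_bdd] by simp
    show "AE x in \<eta>. integrable lborel (\<lambda>v. case (x, v) of (x, v) \<Rightarrow> indicator S v * f (t - x + v))"
      using smooth_integrable by simp
  qed
  have eq: "(\<integral>x. indicator S v * f (t - x + v) \<partial>\<eta>) = indicator S v * step f (t + v)" for v
    unfolding step_def by (simp add: algebra_simps)
  show "integrable lborel (\<lambda>v. indicator S v * step f (t + v))"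
    using integrable_snd[OF int] by (simp only: eq prod.case)
  have "step (smooth S f) t = (\<integral>x. (\<integral>v. indicator S v * f (t - x + v) \<partial>lborel) \<partial>\<eta>)"
    by (simp add: step_def smooth_def)
  also have "\<dots> = (\<integral>v. (\<integral>x. indicator S v * f (t - x + v) \<partial>\<eta>) \<partial>lborel)"
    using Fubini_integral[OF int] by simp
  finally show "step (smooth S f) t = smooth S (step f) t"
    by (simp only: eq smooth_def)
qed

lemma smooth_defect:
  shows "integrable lborel (\<lambda>v. indicator S v * (f (t + v) - step f (t + v)))"
    and "smooth S f t - step (smooth S f) t = smooth S (\<lambda>t. f t - step f t) t"
proof -
  show "integrable lborel (\<lambda>v. indicator S v * (f (t + v) - step f (t + v)))"
    using Bochner_Integration.integrable_diff[OF smooth_integrable[of t] step_smooth(1)[of t]] by (simp add: algebra_simps)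
  show "smooth S f t - step (smooth S f) t = smooth S (\<lambda>t. f t - step f t) t"
    unfolding step_smooth(2) unfolding smooth_def
    by (subst Bochner_Integration.integral_diff[OF smooth_integrable step_smooth(1), symmetric])
       (simp add: algebra_simps)
qed

end

end

section \<open>Supports of measures, subgroups of the line, and limits superior\<close>

lemma AE_measure_support:
  fixes M :: "'a::second_countable_topology measure"
  assumes "sets M = sets borel"
  shows "AE x in M. x \<in> measure_support M"
proof -
  obtain B :: "'a set set" where B: "countable B" "topological_basis B"
    using ex_countable_basis by blast
  define N where "N = {U \<in> B. emeasure M U = 0}"
  have "AE x in M. \<forall>U\<in>N. x \<notin> U"
  proof (subst AE_ball_countable)
    show "countable N" using B by (auto simp: N_def)
    show "\<forall>U\<in>N. AE x in M. x \<notin> U"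
    proof
      fix U assume U: "U \<in> N"
      then have "open U" using B topological_basis_open by (auto simp: N_def)
      then have "U \<in> null_sets M" using U assms by (auto simp: N_def null_sets_def)
      then show "AE x in M. x \<notin> U" by (rule AE_not_in)
    qed
  qed
  moreover have "x \<in> measure_support M" if x: "x \<in> space M" "\<forall>U\<in>N. x \<notin> U" for x
    unfolding measure_support_def
  proof (clarsimp simp: x)
    fix U assume "open U" "x \<in> U"
    then obtain V where V: "V \<in> B" "x \<in> V" "V \<subseteq> U"
      using topological_basisE[OF B(2)] by metis
    then have "emeasure M V \<noteq> 0" using x by (auto simp: N_def)
    moreover have "emeasure M V \<le> emeasure M U"
      using V \<open>open U\<close> assms by (intro emeasure_mono) auto
    ultimately show "0 < emeasure M U" by (simp add: zero_less_iff_neq_zero) (metis le_zero_eq)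
  qed
  ultimately show ?thesis by (elim AE_mp) (auto intro!: AE_I2)
qed

text \<open>If the positive elements stay away from 0, their infimum is attained, since two elements
  close to it would have a small positive difference, and division with remainder shows that it
  generates the group. Otherwise multiples of a small element come close to every point.\<close>

lemma additive_subgroup_real:
  fixes G :: "real set"
  assumes zero: "0 \<in> G" and diff: "\<And>x y. x \<in> G \<Longrightarrow> y \<in> G \<Longrightarrow> x - y \<in> G"
    and nd: "\<not> (\<exists>c>0. \<forall>x\<in>G. \<exists>k::int. x = c * of_int k)" and "e > 0"
  shows "\<exists>x\<in>G. \<bar>x - y\<bar> < e"
proof -
  have neg: "- x \<in> G" if "x \<in> G" for x using diff[OF zero that] by simp
  have add: "x + z \<in> G" if "x \<in> G" "z \<in> G" for x z using diff[OF that(1) neg[OF that(2)]] by simp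
  have nat: "of_nat n * x \<in> G" if "x \<in> G" for n x
    using that by (induction n) (auto simp: zero algebra_simps intro: add)
  have int: "of_int k * x \<in> G" if "x \<in> G" for k x
  proof (cases "k \<ge> 0")
    case True then show ?thesis using nat[OF that, of "nat k"] by simp
  next
    case False then show ?thesis using neg[OF nat[OF that, of "nat (-k)"]] by simp
  qed
  have rem: "x - of_int \<lfloor>x / c\<rfloor> * c \<in> G" "0 \<le> x - of_int \<lfloor>x / c\<rfloor> * c" "x - of_int \<lfloor>x / c\<rfloor> * c < c"
    if "c > 0" "c \<in> G" "x \<in> G" for x c
    using that int diff floor_divide_lower[of c x] floor_divide_upper[of c x]
    by (auto simp: algebra_simps)
  have "\<exists>x\<in>G. 0 < x \<and> x < e"
  proof (rule ccontr)
    assume "\<not> (\<exists>x\<in>G. 0 < x \<and> x < e)"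
    then have ge: "x \<ge> e" if "x \<in> G" "x > 0" for x using that by force
    define P where "P = {x\<in>G. x > 0}"
    have "P \<noteq> {}"
    proof
      assume "P = {}"
      have "x = 1 * of_int 0" if "x \<in> G" for x
        using \<open>P = {}\<close> that neg[OF that] by (simp add: P_def) (smt (verit))
      then show False using nd by (metis zero_less_one)
    qed
    define c where "c = Inf P"
    have bdd: "bdd_below P" by (intro bdd_belowI[of _ 0]) (auto simp: P_def)
    have low: "c \<le> x" if "x \<in> P" for x
      unfolding c_def using bdd that by (rule cInf_lower[rotated])
    have "c \<ge> e" unfolding c_def using \<open>P \<noteq> {}\<close> ge by (intro cInf_greatest) (auto simp: P_def)
    then have "c > 0" using \<open>e > 0\<close> by simp
    have "c \<in> P"
    proof (rule ccontr)
      assume n: "c \<notin> P"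
      obtain x where x: "x \<in> P" "x < c + e"
        using cInf_lessD[OF \<open>P \<noteq> {}\<close>, of "c + e"] \<open>e > 0\<close> by (auto simp: c_def)
      have "c < x" using low[OF x(1)] n x(1) by (cases "c = x") auto
      then obtain z where z: "z \<in> P" "z < x"
        using cInf_lessD[OF \<open>P \<noteq> {}\<close>, of x] by (auto simp: c_def)
      have "x - z \<in> G" "x - z > 0" "x - z < e"
        using x z low[OF z(1)] diff by (auto simp: P_def)
      then show False using ge by force
    qed
    then have cG: "c \<in> G" by (simp add: P_def)
    have "x = c * of_int \<lfloor>x / c\<rfloor>" if "x \<in> G" for x
    proof (rule ccontr)
      assume "x \<noteq> c * of_int \<lfloor>x / c\<rfloor>"
      then have "x - of_int \<lfloor>x / c\<rfloor> * c \<in> P"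
        using rem[OF \<open>c > 0\<close> cG that] by (auto simp: P_def mult.commute)
      from low[OF this] rem(3)[OF \<open>c > 0\<close> cG that] show False by simp
    qed
    then show False using nd \<open>c > 0\<close> by metis
  qed
  then obtain x where x: "x \<in> G" "0 < x" "x < e" by auto
  show ?thesis
  proof
    show "of_int \<lfloor>y / x\<rfloor> * x \<in> G" using int x by simp
    show "\<bar>of_int \<lfloor>y / x\<rfloor> * x - y\<bar> < e"
      using x floor_divide_lower[of x y] floor_divide_upper[of x y] by (auto simp: algebra_simps)
  qed
qed

text \<open>\<open>L\<close> is the limit superior. A sequence along which it is attained, together
  with the eventual upper bound \<open>L + e\<close>, replaces a maximum point in the maximum
  principle below.\<close>

lemma bounded_limsup_at_top:
  fixes u :: "real \<Rightarrow> real"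
  assumes "\<And>t. \<bar>u t\<bar> \<le> M"
  obtains L X where "filterlim X at_top sequentially" "(\<lambda>n. u (X n)) \<longlonglongrightarrow> L"
    "\<And>e. e > 0 \<Longrightarrow> eventually (\<lambda>t. u t < L + e) at_top"
proof -
  define S where "S = {l. eventually (\<lambda>t. u t \<le> l) at_top}"
  define L where "L = Inf S"
  have "M \<in> S" using assms by (auto simp: S_def intro!: always_eventually) (smt (verit))
  have "-M \<le> l" if "l \<in> S" for l
  proof -
    have "eventually (\<lambda>t. u t \<le> l) at_top" using that by (simp add: S_def)
    then obtain t where "u t \<le> l" by (meson eventually_happens trivial_limit_at_top_linorder)
    then show ?thesis using assms[of t] by simp
  qed
  then have bdd: "bdd_below S" by (auto intro!: bdd_belowI)
  have up: "eventually (\<lambda>t. u t < L + e) at_top" if "e > 0" for e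
  proof -
    obtain l where "l \<in> S" "l < L + e"
      using cInf_lessD[of S "L + e"] \<open>M \<in> S\<close> \<open>e > 0\<close> unfolding L_def by (metis empty_iff less_add_same_cancel1)
    then show ?thesis by (auto simp: S_def elim!: eventually_mono)
  qed
  have "\<exists>t\<ge>real n. u t > L - 1 / Suc n" for n
  proof (rule ccontr)
    assume "\<not> (\<exists>t\<ge>real n. u t > L - 1 / Suc n)"
    then have "L - 1 / Suc n \<in> S"
      unfolding S_def by (auto simp: eventually_at_top_linorder not_less)
    then have "L \<le> L - 1 / Suc n" unfolding L_def using bdd by (intro cInf_lower)
    then show False by simp
  qed
  then obtain X where X: "\<And>n. X n \<ge> real n" "\<And>n. u (X n) > L - 1 / Suc n" by metis
  have top: "filterlim X at_top sequentially"
    by (rule filterlim_at_top_mono[OF filterlim_real_sequentially]) (simp add: X)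
  have "(\<lambda>n. u (X n)) \<longlonglongrightarrow> L"
  proof (rule order_tendstoI)
    fix a assume "a < L"
    have "(\<lambda>n. L - 1 / Suc n) \<longlonglongrightarrow> L - 0"
      by (intro tendsto_diff tendsto_const LIMSEQ_inverse_real_of_nat[unfolded inverse_eq_divide])
    then have "eventually (\<lambda>n. a < L - 1 / Suc n) sequentially"
      using \<open>a < L\<close> by (simp add: order_tendstoD(1))
    then show "eventually (\<lambda>n. a < u (X n)) sequentially"
      by eventually_elim (use X(2) in \<open>meson less_trans\<close>)
  next
    fix a assume "L < a"
    then show "eventually (\<lambda>n. u (X n) < a) sequentially"
      using eventually_compose_filterlim[OF up[of "a - L"] top] by simp
  qed
  with top up show ?thesis using that by blast
qed

section \<open>A priori bound, asymptotic Choquet-Deny argument and conservation law\<close>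

context renewal_walk
begin

lemma bdd_integrable:
  fixes f :: "real \<Rightarrow> real"
  assumes [measurable]: "f \<in> borel_measurable borel" and "\<And>t. \<bar>f t\<bar> \<le> K"
  shows "integrable \<eta> f"
proof (rule integrable_const_bound[of _ K])
  show "AE x in \<eta>. norm (f x) \<le> K" using assms(2) by (intro always_eventually) simp
qed measurable

text \<open>The truncated exponential is a supersolution of the renewal equation with forcing term the
  indicator of \<open>{-h..0}\<close>; it plays the role of the renewal measure of an interval.\<close>

lemma renewal_bound:
  assumes th: "0 < \<theta>" "\<theta> < \<alpha>" and f: "exp_bdd \<theta> K f"
    and g: "integrable lborel g" and h: "h \<ge> 0"
    and le: "\<And>t. f t - step f t \<le> smooth {0..h} (\<lambda>u. \<bar>g u\<bar>) t"
  shows "f t \<le> exp (\<theta> * h) / (1 - kap \<theta>) * (\<integral>u. \<bar>g u\<bar> \<partial>lborel)"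
proof -
  have kap: "kap \<theta> < 1" "0 \<le> kap \<theta>" using kap_less_1 kap_nonneg th by auto
  \<comment> \<open>The size is dictated by \<open>t \<in> {-h..0}\<close>, where V exceeds its step
    by at least \<open>c * (1 - kap \<theta>) * exp (\<theta> * t)\<close>, and this must be at
    least 1 down to \<open>t = -h\<close>.\<close>
  define c where "c = exp (\<theta> * h) / (1 - kap \<theta>)"
  have c: "c > 0" "c * (1 - kap \<theta>) = exp (\<theta> * h)" using kap by (auto simp: c_def)
  define V where "V t = c * min 1 (exp (\<theta> * t))" for t
  have [measurable]: "V \<in> borel_measurable borel" unfolding V_def[abs_def] by measurable
  have [measurable]: "g \<in> borel_measurable borel" using borel_measurable_integrable[OF g] by simp
  have [measurable]: "f \<in> borel_measurable borel" using exp_bdd_D(1)[OF f] .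
  have V: "0 \<le> V t" "V t \<le> c" for t using c by (auto simp: V_def)
  have Vb: "exp_bdd \<theta> c V"
    unfolding exp_bdd_def using V c by (auto simp: V_def)
  have stepV: "step V t \<le> c" "0 \<le> step V t" for t
  proof -
    have "step V t \<le> (\<integral>x. c \<partial>\<eta>)" unfolding step_def
      using V exp_bdd_integrable[OF _ _ Vb] th by (intro integral_mono) auto
    then show "step V t \<le> c" using prob_space by simp
    show "0 \<le> step V t" using exp_bdd_step[OF _ _ Vb] th by simp
  qed
  have super: "indicator {-h..0} t + step V t \<le> V t" for t
  proof -
    have s: "step V t \<le> c * kap \<theta> * exp (\<theta> * t)" using exp_bdd_step[OF _ _ Vb] th by simp
    consider "t > 0" | "t < -h" "t \<le> 0" | "-h \<le> t" "t \<le> 0" using h by linarith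
    then show ?thesis
    proof cases
      case 1
      then show ?thesis using stepV th by (simp add: V_def)
    next
      case 2
      then have "V t = c * exp (\<theta> * t)" using th by (auto simp: V_def min_def mult_nonneg_nonpos not_le zero_le_mult_iff)
      moreover have "c * kap \<theta> * exp (\<theta> * t) \<le> c * 1 * exp (\<theta> * t)"
        using kap c by (intro mult_right_mono mult_left_mono) auto
      ultimately show ?thesis using 2 s by simp
    next
      case 3
      then have "V t = c * exp (\<theta> * t)" using th by (auto simp: V_def min_def mult_nonneg_nonpos not_le zero_le_mult_iff)
      moreover have "c * (1 - kap \<theta>) * exp (\<theta> * t) \<ge> 1"
        unfolding c(2) using 3 th by (simp flip: exp_add ring_distribs)
      ultimately show ?thesis using 3 s by (simp add: algebra_simps)
    qed
  qed
  \<comment> \<open>Superposing translates of V with weight \<open>\<bar>g u\<bar>\<close> gives a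
    supersolution for the windowed forcing term, bounded by c times the L1 norm of g.\<close>
  define D where "D t = (\<integral>u. \<bar>g u\<bar> * V (t - u) \<partial>lborel)" for t
  have gV: "integrable lborel (\<lambda>u. \<bar>g u\<bar> * W (t - u))"
    if [measurable]: "W \<in> borel_measurable borel" and "\<And>t. 0 \<le> W t \<and> W t \<le> c" for t W
    using that(2) c
    by (intro Bochner_Integration.integrable_bound[OF integrable_mult_right[OF integrable_abs[OF g], of c]])
       (auto intro!: always_eventually simp: abs_mult mult.commute[of c] mult_left_mono)
  have D: "0 \<le> D t" "D t \<le> c * (\<integral>u. \<bar>g u\<bar> \<partial>lborel)" for t
  proof -
    show "0 \<le> D t" unfolding D_def using V by (intro integral_nonneg_AE) auto
    have "D t \<le> (\<integral>u. c * \<bar>g u\<bar> \<partial>lborel)"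
      unfolding D_def using V g gV[of V]
      by (intro integral_mono) (auto simp: mult.commute[of c] mult_left_mono)
    then show "D t \<le> c * (\<integral>u. \<bar>g u\<bar> \<partial>lborel)" by simp
  qed
  have [measurable]: "D \<in> borel_measurable borel" unfolding D_def[abs_def] by measurable
  have Dint: "integrable \<eta> (\<lambda>x. D (t - x))" for t
  proof (rule bdd_integrable)
    show "(\<lambda>x. D (t - x)) \<in> borel_measurable borel" by measurable
    show "\<bar>D (t - x)\<bar> \<le> c * (\<integral>u. \<bar>g u\<bar> \<partial>lborel)" for x using D by simp
  qed
  have stepD: "step D t = (\<integral>u. \<bar>g u\<bar> * step V (t - u) \<partial>lborel)" for t
  proof -
    interpret pair_sigma_finite \<eta> lborel ..
    have int: "integrable (\<eta> \<Otimes>\<^sub>M lborel) (\<lambda>(x, u). \<bar>g u\<bar> * V (t - x - u))"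
    proof (rule Fubini_integrable)
      have "(\<integral>u. norm (\<bar>g u\<bar> * V (t - x - u)) \<partial>lborel) = D (t - x)" for x
        unfolding D_def using V by (intro Bochner_Integration.integral_cong) auto
      moreover have "integrable \<eta> (\<lambda>x. D (t - x))"
        by (rule Dint)
      ultimately show "integrable \<eta> (\<lambda>x. \<integral>u. norm (case (x, u) of (x, u) \<Rightarrow> \<bar>g u\<bar> * V (t - x - u)) \<partial>lborel)"
        by simp
      show "AE x in \<eta>. integrable lborel (\<lambda>u. case (x, u) of (x, u) \<Rightarrow> \<bar>g u\<bar> * V (t - x - u))"
        using gV[of V] V by simp
    qed measurable
    have "step D t = (\<integral>x. (\<integral>u. \<bar>g u\<bar> * V (t - x - u) \<partial>lborel) \<partial>\<eta>)" by (simp add: step_def D_def)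
    also have "\<dots> = (\<integral>u. (\<integral>x. \<bar>g u\<bar> * V (t - x - u) \<partial>\<eta>) \<partial>lborel)"
      using Fubini_integral[OF int] by simp
    also have "\<dots> = (\<integral>u. \<bar>g u\<bar> * step V (t - u) \<partial>lborel)"
      by (simp add: step_def diff_diff_eq add.commute)
    finally show ?thesis .
  qed
  have a: "smooth {0..h} (\<lambda>u. \<bar>g u\<bar>) t = (\<integral>u. \<bar>g u\<bar> * indicator {-h..0} (t - u) \<partial>lborel)" for t
    unfolding smooth_def
    by (subst lborel_integral_real_affine[of 1 _ t])
       (auto intro!: Bochner_Integration.integral_cong simp: indicator_def)
  have ind: "integrable lborel (\<lambda>u. \<bar>g u\<bar> * indicator {-h..0} (t - u))" for t
    using g by (intro Bochner_Integration.integrable_bound[OF integrable_abs[OF g]])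
      (auto intro!: always_eventually simp: indicator_def)
  have Dsuper: "smooth {0..h} (\<lambda>u. \<bar>g u\<bar>) t + step D t \<le> D t" for t
  proof -
    have "smooth {0..h} (\<lambda>u. \<bar>g u\<bar>) t + step D t
        = (\<integral>u. \<bar>g u\<bar> * indicator {-h..0} (t - u) + \<bar>g u\<bar> * step V (t - u) \<partial>lborel)"
      unfolding a stepD by (rule Bochner_Integration.integral_add[symmetric]) (use ind gV stepV in auto)
    also have "\<dots> \<le> D t"
      unfolding D_def
    proof (intro integral_mono Bochner_Integration.integrable_add ind gV conjI stepV V)
      fix u
      show "\<bar>g u\<bar> * indicator {-h..0} (t - u) + \<bar>g u\<bar> * step V (t - u) \<le> \<bar>g u\<bar> * V (t - u)"
        using super[of "t - u"] by (simp add: mult_left_mono flip: ring_distribs)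
    qed auto
    finally show ?thesis .
  qed
  \<comment> \<open>The difference \<open>f - D\<close> is a subsolution of the homogeneous equation
    and lies below an exponential, so each iteration gains the factor \<open>kap \<theta>\<close>;
    in the limit \<open>f \<le> D\<close>.\<close>
  have le: "f t - D t \<le> K * kap \<theta> ^ n * exp (\<theta> * t)" for n t
  proof (induction n arbitrary: t)
    case 0
    show ?case using exp_bdd_D(3)[OF f, of t] D(1)[of t] by simp
  next
    case (Suc n)
    have i1: "integrable \<eta> (\<lambda>x. f (t - x))" using exp_bdd_integrable[OF _ _ f] th by simp
    have i2: "integrable \<eta> (\<lambda>x. D (t - x))"
      by (rule Dint)
    have "f t - D t \<le> step f t - step D t" using le[of t] Dsuper[of t] by simp
    also have "\<dots> = (\<integral>x. f (t - x) - D (t - x) \<partial>\<eta>)"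
      unfolding step_def using i1 i2 by simp
    also have "\<dots> \<le> (\<integral>x. K * kap \<theta> ^ n * exp (\<theta> * (t - x)) \<partial>\<eta>)"
      using Suc exp_step(1)[of \<theta>] th i1 i2 by (intro integral_mono) auto
    also have "\<dots> = K * kap \<theta> ^ n * step (\<lambda>t. exp (\<theta> * t)) t" by (simp add: step_def)
    also have "\<dots> = K * kap \<theta> ^ Suc n * exp (\<theta> * t)"
      using th by (subst exp_step(2)) auto
    finally show ?case .
  qed
  have "(\<lambda>n. K * kap \<theta> ^ n * exp (\<theta> * t)) \<longlonglongrightarrow> K * 0 * exp (\<theta> * t)"
    using kap by (intro tendsto_intros LIMSEQ_realpow_zero) auto
  then have "f t - D t \<le> K * 0 * exp (\<theta> * t)"
    using le by (rule LIMSEQ_le_const[OF _ exI, OF _ allI, OF _ impI])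
  then show ?thesis using D(2)[of t] by (simp add: c_def)
qed


text \<open>A maximum principle at infinity. Along \<open>X\<close> the value of u tends to its
  limit superior and is asymptotically the mean of the values \<open>u (X n - x)\<close>, none of
  which can stay above L. So almost no mass can see values below L, and by uniform continuity a
  point y of the support cannot either.\<close>

lemma asymptotic_shift_step:
  assumes [measurable]: "u \<in> borel_measurable borel" and bdd: "\<And>t. \<bar>u t\<bar> \<le> M"
    and uc: "uniformly_continuous_on UNIV u"
    and harm: "((\<lambda>t. u t - step u t) \<longlongrightarrow> 0) at_top"
    and y: "\<And>d. d > 0 \<Longrightarrow> measure \<eta> (ball y d) > 0"
    and up: "\<And>e. e > 0 \<Longrightarrow> eventually (\<lambda>t. u t < L + e) at_top"
    and X: "filterlim X at_top sequentially" and L: "(\<lambda>n. u (X n)) \<longlonglongrightarrow> L"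
  shows "(\<lambda>n. u (X n - y)) \<longlonglongrightarrow> L"
proof -
  have Xs: "filterlim (\<lambda>n. X n - x) at_top sequentially" for x
    using filterlim_tendsto_add_at_top[OF tendsto_const X, of "-x"] by simp
  have int: "integrable \<eta> (\<lambda>x. u (s - x))" for s
    using bdd by (intro bdd_integrable[of _ M]) auto
  define w where "w n x = max 0 (u (X n - x) - L)" for n x
  have [measurable]: "w n \<in> borel_measurable borel" for n unfolding w_def[abs_def] by measurable
  have w0: "(\<lambda>n. w n x) \<longlonglongrightarrow> 0" for x
  proof (rule order_tendstoI)
    fix a :: real assume "a < 0"
    then show "eventually (\<lambda>n. a < w n x) sequentially"
      by (intro always_eventually) (auto simp: w_def less_max_iff_disj)
  next
    fix a :: real assume "0 < a"
    then have "eventually (\<lambda>n. u (X n - x) < L + a) sequentially"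
      using eventually_compose_filterlim[OF up[of a] Xs[of x]] by simp
    then show "eventually (\<lambda>n. w n x < a) sequentially"
      by eventually_elim (use \<open>0 < a\<close> in \<open>auto simp: w_def\<close>)
  qed
  have wb: "norm (w n x) \<le> M + \<bar>L\<bar>" for n x
    using bdd[of "X n - x"] by (auto simp: w_def)
  have wint: "integrable \<eta> (w n)" for n
    using wb by (intro bdd_integrable[of _ "M + \<bar>L\<bar>"]) auto
  have "(\<lambda>n. \<integral>x. w n x \<partial>\<eta>) \<longlonglongrightarrow> (\<integral>x. 0 \<partial>\<eta>)"
    by (rule integral_dominated_convergence[where w = "\<lambda>_. M + \<bar>L\<bar>"]) (use w0 wb in auto)
  then have W: "(\<lambda>n. \<integral>x. w n x \<partial>\<eta>) \<longlonglongrightarrow> 0" by simp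
  have "(\<lambda>n. u (X n) - (u (X n) - step u (X n))) \<longlonglongrightarrow> L - 0"
    using harm X by (intro tendsto_diff L) (rule filterlim_compose)
  then have st: "(\<lambda>n. step u (X n)) \<longlonglongrightarrow> L" by simp
  \<comment> \<open>The mean distance to L equals the deficit of the mean below L plus twice the
    mean excess above L; both tend to 0.\<close>
  define I where "I n = (\<integral>x. \<bar>L - u (X n - x)\<bar> \<partial>\<eta>)" for n
  have "I n = L - step u (X n) + 2 * (\<integral>x. w n x \<partial>\<eta>)" for n
  proof -
    have "\<bar>L - u (X n - x)\<bar> = L - u (X n - x) + 2 * w n x" for x by (simp add: w_def max_def abs_if)
    then show ?thesis
      using int wint prob_space by (simp add: I_def step_def)
  qed
  moreover have "(\<lambda>n. L - step u (X n) + 2 * (\<integral>x. w n x \<partial>\<eta>)) \<longlonglongrightarrow> L - L + 2 * 0"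
    using st W by (intro tendsto_intros)
  ultimately have I: "I \<longlonglongrightarrow> 0" by (simp add: LIMSEQ_def)
  show ?thesis
  proof (rule tendstoI)
    fix e :: real assume "e > 0"
    obtain d where d: "d > 0" "\<And>a b. dist a b < d \<Longrightarrow> dist (u a) (u b) < e/2"
      using uc \<open>e > 0\<close> unfolding uniformly_continuous_on_def
      by (metis UNIV_I half_gt_zero)
    define p where "p = measure \<eta> (ball y d)"
    have "p > 0" using y d by (simp add: p_def)
    have "eventually (\<lambda>n. I n < p * (e/2)) sequentially"
      using I \<open>p > 0\<close> \<open>e > 0\<close> by (intro order_tendstoD(2)) auto
    then show "eventually (\<lambda>n. dist (u (X n - y)) L < e) sequentially"
    proof eventually_elim
      case (elim n)
      have "p * (\<bar>L - u (X n - y)\<bar> - e/2) = (\<integral>x. indicator (ball y d) x * (\<bar>L - u (X n - y)\<bar> - e/2) \<partial>\<eta>)"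
        by (simp add: p_def)
      also have "\<dots> \<le> I n"
        unfolding I_def
      proof (rule integral_mono)
        show "integrable \<eta> (\<lambda>x. \<bar>L - u (X n - x)\<bar>)" using int by simp
        show "integrable \<eta> (\<lambda>x. indicator (ball y d) x * (\<bar>L - u (X n - y)\<bar> - e/2))"
          by (auto simp: less_top[symmetric])
        fix x
        have "\<bar>L - u (X n - y)\<bar> - e/2 \<le> \<bar>L - u (X n - x)\<bar>" if "x \<in> ball y d"
        proof -
          have "dist (u (X n - x)) (u (X n - y)) < e/2" using that by (intro d(2)) (auto simp: dist_real_def)
          then show ?thesis unfolding dist_real_def by linarith
        qed
        then show "indicator (ball y d) x * (\<bar>L - u (X n - y)\<bar> - e/2) \<le> \<bar>L - u (X n - x)\<bar>"
          by (auto simp: indicator_def)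
      qed
      also have "\<dots> < p * (e/2)" using elim .
      finally show ?case using \<open>p > 0\<close> by (simp add: dist_real_def abs_minus_commute)
    qed
  qed
qed

text \<open>The maximum principle is applied to the increment \<open>f t - f (t - y)\<close>. If its
  limit superior L were positive, the increments along \<open>X n\<close>, \<open>X n - y\<close>,
  \<open>X n - 2 y\<close> and so on would all be close to L, and f could not stay bounded.\<close>

lemma asymptotic_shift_upper:
  assumes f [measurable]: "f \<in> borel_measurable borel" and bdd: "\<And>t. \<bar>f t\<bar> \<le> M"
    and uc: "uniformly_continuous_on UNIV f"
    and harm: "((\<lambda>t. f t - step f t) \<longlongrightarrow> 0) at_top"
    and y: "\<And>d. d > 0 \<Longrightarrow> measure \<eta> (ball y d) > 0" and "e > 0"
  shows "eventually (\<lambda>t. f t - f (t - y) < e) at_top"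
proof -
  define u where "u t = f t - f (t - y)" for t
  have um [measurable]: "u \<in> borel_measurable borel" unfolding u_def[abs_def] by measurable
  have ub: "\<bar>u t\<bar> \<le> 2 * M" for t using bdd[of t] bdd[of "t - y"] by (simp add: u_def)
  have uu: "uniformly_continuous_on UNIV u"
    unfolding u_def[abs_def]
  proof (intro uniformly_continuous_on_diff uc)
    show "uniformly_continuous_on UNIV (\<lambda>t. f (t - y))"
      unfolding uniformly_continuous_on_def
    proof (intro allI impI)
      fix e :: real assume "e > 0"
      then obtain d where "d > 0" "\<And>a b. dist a b < d \<Longrightarrow> dist (f a) (f b) < e"
        using uc unfolding uniformly_continuous_on_def by (metis UNIV_I)
      then show "\<exists>d>0. \<forall>a\<in>UNIV. \<forall>b\<in>UNIV. dist b a < d \<longrightarrow> dist (f (b - y)) (f (a - y)) < e"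
        by (intro exI[of _ d]) (auto simp: dist_real_def)
    qed
  qed
  have int: "integrable \<eta> (\<lambda>x. f (s - x))" for s
    using bdd by (intro bdd_integrable[of _ M]) auto
  have su: "step u t = step f t - step f (t - y)" for t
  proof -
    have "u (t - x) = f (t - x) - f ((t - y) - x)" for x by (simp add: u_def algebra_simps)
    then show ?thesis unfolding step_def using int by simp
  qed
  have shift: "filterlim (\<lambda>t. t - y) at_top at_top"
    using filterlim_tendsto_add_at_top[OF tendsto_const filterlim_ident, of "-y"] by simp
  have "((\<lambda>t. (f t - step f t) - (f (t - y) - step f (t - y))) \<longlongrightarrow> 0 - 0) at_top"
    by (intro tendsto_diff harm filterlim_compose[OF harm shift])
  then have uh: "((\<lambda>t. u t - step u t) \<longlongrightarrow> 0) at_top"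
    by (simp add: su u_def algebra_simps)
  obtain L X where X: "filterlim X at_top sequentially" "(\<lambda>n. u (X n)) \<longlonglongrightarrow> L"
    and up: "\<And>e. e > 0 \<Longrightarrow> eventually (\<lambda>t. u t < L + e) at_top"
    using bounded_limsup_at_top[of u, OF ub] by blast
  have Xs: "filterlim (\<lambda>n. X n - x) at_top sequentially" for x
    using filterlim_tendsto_add_at_top[OF tendsto_const X(1), of "-x"] by simp
  have k: "(\<lambda>n. u (X n - of_nat k * y)) \<longlonglongrightarrow> L" for k
  proof (induction k)
    case 0
    show ?case using X by simp
  next
    case (Suc k)
    from asymptotic_shift_step[OF um ub uu uh y up Xs Suc]
    show ?case by (simp add: algebra_simps)
  qed
  \<comment> \<open>N consecutive increments telescope to a difference of two values of f, whatever
    N is.\<close>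
  have "of_nat N * L \<le> 2 * M" for N
  proof -
    have tel: "(\<Sum>k<N. u (s - of_nat k * y)) = f s - f (s - of_nat N * y)" for s
      by (induction N) (auto simp: u_def algebra_simps)
    have "(\<lambda>n. \<Sum>k<N. u (X n - of_nat k * y)) \<longlonglongrightarrow> (\<Sum>k<N. L)"
      by (intro tendsto_sum k)
    then have "(\<lambda>n. f (X n) - f (X n - of_nat N * y)) \<longlonglongrightarrow> of_nat N * L" by (simp add: tel)
    moreover have "f s - f (s - of_nat N * y) \<le> 2 * M" for s
      using bdd[of s] bdd[of "s - of_nat N * y"] by linarith
    ultimately show ?thesis by (intro LIMSEQ_le_const2) auto
  qed
  then have "L \<le> 0" by (metis not_le reals_Archimedean3)
  show ?thesis
    using up[OF \<open>e > 0\<close>] by eventually_elim (use \<open>L \<le> 0\<close> in \<open>simp add: u_def\<close>)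
qed

lemma step_uminus: "step (\<lambda>t. - f t) t = - step f t"
  by (simp add: step_def)

text \<open>The asymptotic periods form a subgroup \<open>G\<close>. It contains the support of
  \<open>\<eta>\<close>, by the one-sided bound for f and for \<open>- f\<close>, so nonlatticeness
  makes it dense, and uniform continuity of f passes from a dense set of periods to all real
  y.\<close>

lemma asymptotic_shift:
  assumes f [measurable]: "f \<in> borel_measurable borel" and bdd: "\<And>t. \<bar>f t\<bar> \<le> M"
    and uc: "uniformly_continuous_on UNIV f"
    and harm: "((\<lambda>t. f t - step f t) \<longlongrightarrow> 0) at_top"
  shows "((\<lambda>t. f t - f (t - y)) \<longlongrightarrow> 0) at_top"
proof -
  define G where "G = {y. ((\<lambda>t. f t - f (t - y)) \<longlongrightarrow> 0) at_top}"
  have shift: "filterlim (\<lambda>t. t - z) at_top at_top" for z :: real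
    using filterlim_tendsto_add_at_top[OF tendsto_const filterlim_ident, of "-z"] by simp
  have supp: "z \<in> G" if z: "\<And>d. d > 0 \<Longrightarrow> measure \<eta> (ball z d) > 0" for z
  proof -
    have "eventually (\<lambda>t. \<bar>f t - f (t - z)\<bar> < e) at_top" if "e > 0" for e
    proof -
      have "eventually (\<lambda>t. f t - f (t - z) < e) at_top"
        by (rule asymptotic_shift_upper[OF f bdd uc harm z that])
      moreover have "eventually (\<lambda>t. - f t - (- f (t - z)) < e) at_top"
      proof (rule asymptotic_shift_upper[OF _ _ _ _ z that])
        show "uniformly_continuous_on UNIV (\<lambda>t. - f t)" using uc by (rule uniformly_continuous_on_minus)
        show "((\<lambda>t. - f t - step (\<lambda>t. - f t) t) \<longlongrightarrow> 0) at_top"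
          using tendsto_minus[OF harm] by (simp add: step_uminus)
      qed (use bdd in auto)
      ultimately show ?thesis by eventually_elim auto
    qed
    then show ?thesis by (auto simp: G_def tendsto_iff dist_real_def)
  qed
  have z0: "0 \<in> G" by (simp add: G_def)
  have diff: "a - b \<in> G" if "a \<in> G" "b \<in> G" for a b
  proof -
    have a: "((\<lambda>t. f t - f (t - a)) \<longlongrightarrow> 0) at_top" and b: "((\<lambda>t. f t - f (t - b)) \<longlongrightarrow> 0) at_top"
      using that by (auto simp: G_def)
    have "((\<lambda>t. (f t - f (t - a)) - (f (t - (a - b)) - f (t - (a - b) - b))) \<longlongrightarrow> 0 - 0) at_top"
      by (intro tendsto_diff a filterlim_compose[OF b shift])
    then show ?thesis by (simp add: G_def algebra_simps)
  qed
  have nd: "\<not> (\<exists>c>0. \<forall>x\<in>G. \<exists>k::int. x = c * of_int k)"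
  proof
    assume "\<exists>c>0. \<forall>x\<in>G. \<exists>k::int. x = c * of_int k"
    then obtain c where c: "c > 0" "\<And>x. x \<in> G \<Longrightarrow> \<exists>k::int. x = c * of_int k" by blast
    have "AE x in \<eta>. x \<in> measure_support \<eta>" by (rule AE_measure_support) simp
    then have "AE x in \<eta>. \<exists>k::int. x = c * of_int k"
    proof eventually_elim
      case (elim x)
      have "measure \<eta> (ball x d) > 0" if "d > 0" for d
        using elim that by (auto simp: measure_support_def emeasure_eq_measure)
      then show ?case using supp c(2) by blast
    qed
    then show False using nonlattice c(1) by blast
  qed
  show ?thesis
  proof (rule tendstoI)
    fix e :: real assume "e > 0"
    obtain d where d: "d > 0" "\<And>a b. dist a b < d \<Longrightarrow> dist (f a) (f b) < e/2"
      using uc \<open>e > 0\<close> unfolding uniformly_continuous_on_def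
      by (metis UNIV_I half_gt_zero)
    obtain x where x: "x \<in> G" "\<bar>x - y\<bar> < d"
      using additive_subgroup_real[OF z0 diff nd \<open>d > 0\<close>] by blast
    have "eventually (\<lambda>t. dist (f t - f (t - x)) 0 < e/2) at_top"
      using x(1) half_gt_zero[OF \<open>e > 0\<close>] unfolding G_def mem_Collect_eq tendsto_iff by blast
    then show "eventually (\<lambda>t. dist (f t - f (t - y)) 0 < e) at_top"
    proof eventually_elim
      case (elim t)
      have "dist (f (t - x)) (f (t - y)) < e/2" using x(2) by (intro d(2)) (auto simp: dist_real_def)
      with elim show ?case by (simp add: dist_real_def) (smt (verit) field_sum_of_halves)
    qed
  qed
qed

text \<open>The increments of the primitive \<open>smooth {..0} f\<close> of \<open>f\<close> satisfy a conservation law, which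
  identifies the limit.\<close>

lemma limit_from_primitive:
  assumes th: "0 < \<theta>" "\<theta> \<le> \<alpha>" and fb: "exp_bdd \<theta> K f" and bdd: "\<And>t. f t \<le> M"
    and shift: "\<And>y. ((\<lambda>t. f t - f (t - y)) \<longlongrightarrow> 0) at_top"
    and prim: "((\<lambda>t. smooth {..0} f t - step (smooth {..0} f) t) \<longlongrightarrow> l) at_top"
    and Sint: "integrable lborel (\<lambda>v. indicator {..0} v * exp (\<theta> * v))"
  shows "(f \<longlongrightarrow> l / mean) at_top"
proof -
  note [measurable] = exp_bdd_D(1)[OF fb]
  have fM: "\<bar>f t\<bar> \<le> M" for t using bdd[of t] exp_bdd_D(2)[OF fb, of t] by simp
  have M: "0 \<le> M" using fM[of 0] by linarith
  define \<Phi> where "\<Phi> = smooth {..0} f"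
  have \<Phi>b: "exp_bdd \<theta> (K * (\<integral>v. indicator {..0} v * exp (\<theta> * v) \<partial>lborel)) \<Phi>"
    unfolding \<Phi>_def by (rule smooth_bdd[OF _ Sint _ th(2) fb]) (use th in auto)
  have [measurable]: "\<Phi> \<in> borel_measurable borel" using exp_bdd_D(1)[OF \<Phi>b] .
  \<comment> \<open>The signed indicator of the interval between \<open>- x\<close> and 0, with
    total integral x. It writes the increment of the primitive as an integral of f over a bounded
    interval, for either sign of x.\<close>
  define k :: "real \<Rightarrow> real \<Rightarrow> real" where "k x v = indicator {..0} v - indicator {..-x} v" for x v
  have [measurable]: "k x \<in> borel_measurable borel" for x unfolding k_def[abs_def] by measurable
  have kabs: "\<bar>k x v\<bar> = indicator {min 0 (-x)<..max 0 (-x)} v" for x v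
    by (auto simp: k_def indicator_def)
  have kval: "k x v = sgn x * indicator {min 0 (-x)<..max 0 (-x)} v" for x v
    by (cases "x = 0") (auto simp: k_def indicator_def sgn_real_def)
  have kint: "integrable lborel (k x)" for x
    unfolding kval[abs_def] by (intro integrable_mult_right integrable_real_indicator) auto
  have kx: "(\<integral>v. k x v \<partial>lborel) = x" for x
    unfolding kval[abs_def] by (cases "x \<ge> 0") (auto simp: sgn_real_def)
  have kax: "(\<integral>v. \<bar>k x v\<bar> \<partial>lborel) = \<bar>x\<bar>" for x
    unfolding kabs by (cases "x \<ge> 0") auto
  have kf: "integrable lborel (\<lambda>v. k x v * f (t + v))" for x t
    using fM M by (intro Bochner_Integration.integrable_bound[OF integrable_mult_right[OF integrable_abs[OF kint[of x]], of M]])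
      (auto intro!: always_eventually simp: abs_mult mult.commute[of M] mult_left_mono)
  have inc: "\<Phi> t - \<Phi> (t - x) = (\<integral>v. k x v * f (t + v) \<partial>lborel)" for t x
  proof -
    have s: "integrable lborel (\<lambda>v. indicator {..0} v * f (t + v))" for t
      by (rule smooth_integrable[OF _ Sint _ th(2) fb]) (use th in auto)
    have eq: "indicator {..0} (x + 1 * v) * f (t - x + (x + 1 * v)) = indicator {..-x} v * f (t + v)" for v
      by (auto simp: indicator_def)
    have a: "integrable lborel (\<lambda>v. indicator {..-x} v * f (t + v))"
      using lborel_integrable_real_affine[OF s[of "t - x"], of 1 x] unfolding eq by simp
    have b: "\<Phi> (t - x) = (\<integral>v. indicator {..-x} v * f (t + v) \<partial>lborel)"
      unfolding \<Phi>_def smooth_def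
      by (subst lborel_integral_real_affine[of 1 _ x]) (simp_all only: eq, simp_all)
    show ?thesis
      unfolding b using s[of t] a by (simp add: \<Phi>_def smooth_def k_def left_diff_distrib)
  qed
  have incb: "\<bar>\<Phi> t - \<Phi> (t - x)\<bar> \<le> M * \<bar>x\<bar>" for t x
  proof -
    have "\<bar>\<Phi> t - \<Phi> (t - x)\<bar> \<le> (\<integral>v. \<bar>k x v * f (t + v)\<bar> \<partial>lborel)"
      unfolding inc by (rule integral_abs_bound)
    also have "\<dots> \<le> (\<integral>v. M * \<bar>k x v\<bar> \<partial>lborel)"
      using kf[of x t] kint[of x] fM by (intro integral_mono integrable_abs) (auto simp: abs_mult mult.commute[of M] mult_left_mono)
    also have "\<dots> = M * \<bar>x\<bar>" using kax by simp
    finally show ?thesis .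
  qed
  \<comment> \<open>On a bounded interval around t asymptotic invariance allows f to be replaced by
    the single value \<open>f t\<close>, so an increment of length x is asymptotically
    \<open>x * f t\<close>.\<close>
  have inclim: "((\<lambda>t. \<Phi> t - \<Phi> (t - x) - x * f t) \<longlongrightarrow> 0) at_top" for x
  proof -
    have eq: "\<Phi> t - \<Phi> (t - x) - x * f t = (\<integral>v. k x v * (f (t + v) - f t) \<partial>lborel)" for t
    proof -
      have "(\<integral>v. k x v * (f (t + v) - f t) \<partial>lborel) = (\<integral>v. k x v * f (t + v) - f t * k x v \<partial>lborel)"
        by (simp add: algebra_simps)
      also have "\<dots> = \<Phi> t - \<Phi> (t - x) - f t * x"
        using kf[of x t] kint[of x] kx[of x] by (simp add: inc)
      finally show ?thesis by simp
    qed
    have "((\<lambda>t. \<integral>v. k x v * (f (t + v) - f t) \<partial>lborel) \<longlongrightarrow> integral\<^sup>L (lborel :: real measure) (\<lambda>_. 0)) at_top"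
    proof (rule integral_dominated_convergence_at_top[where w = "\<lambda>v. 2 * M * \<bar>k x v\<bar>"
        and s = "\<lambda>t v. k x v * (f (t + v) - f t)" and f = "\<lambda>_. 0"])
      show "integrable lborel (\<lambda>v. 2 * M * \<bar>k x v\<bar>)" using kint[of x] by simp
      have "norm (k x v * (f (t + v) - f t)) \<le> 2 * M * \<bar>k x v\<bar>" for t v
      proof -
        have "\<bar>f (t + v) - f t\<bar> \<le> 2 * M" using fM[of "t + v"] fM[of t] by linarith
        then show ?thesis by (simp add: abs_mult mult.commute[of _ "\<bar>k x v\<bar>"] mult_left_mono)
      qed
      then show "\<forall>\<^sub>F t in at_top. AE v in lborel. norm (k x v * (f (t + v) - f t)) \<le> 2 * M * \<bar>k x v\<bar>"
        by (intro always_eventually allI)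
      have "((\<lambda>t. k x v * (f (t + v) - f t)) \<longlongrightarrow> 0) at_top" for v
      proof -
        have "((\<lambda>t. k x v * - (f t - f (t - (- v)))) \<longlongrightarrow> k x v * - 0) at_top"
          by (intro tendsto_intros shift)
        then show ?thesis by simp
      qed
      then show "AE v in lborel. ((\<lambda>t. k x v * (f (t + v) - f t)) \<longlongrightarrow> 0) at_top"
        by simp
    qed auto
    then show ?thesis by (simp add: eq)
  qed
  have \<Phi>int: "integrable \<eta> (\<lambda>x. \<Phi> (t - x))" for t
    using exp_bdd_integrable[OF _ th(2) \<Phi>b] th by simp
  \<comment> \<open>Averaging over the step x, with the integrable bound
    \<open>2 * M * \<bar>x\<bar>\<close>, turns the increments into the defect of the primitive and
    x into the mean. As that defect tends to l, so does \<open>mean * f t\<close>.\<close>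
  have "((\<lambda>t. \<integral>x. \<Phi> t - \<Phi> (t - x) - x * f t \<partial>\<eta>) \<longlongrightarrow> (\<integral>x. 0 \<partial>\<eta>)) at_top"
  proof (rule integral_dominated_convergence_at_top[where w = "\<lambda>x. 2 * M * \<bar>x\<bar>"
        and s = "\<lambda>t x. \<Phi> t - \<Phi> (t - x) - x * f t" and f = "\<lambda>_. 0"])
    show "integrable \<eta> (\<lambda>x. 2 * M * \<bar>x\<bar>)" using mean_integrable by simp
    have "norm (\<Phi> t - \<Phi> (t - x) - x * f t) \<le> 2 * M * \<bar>x\<bar>" for t x
    proof -
      have "\<bar>x * f t\<bar> \<le> M * \<bar>x\<bar>" using fM[of t] by (simp add: abs_mult mult.commute[of M] mult_left_mono)
      then show ?thesis using incb[of t x] by simp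
    qed
    then show "\<forall>\<^sub>F t in at_top. AE x in \<eta>. norm (\<Phi> t - \<Phi> (t - x) - x * f t) \<le> 2 * M * \<bar>x\<bar>"
      by (intro always_eventually allI)
    show "AE x in \<eta>. ((\<lambda>t. \<Phi> t - \<Phi> (t - x) - x * f t) \<longlongrightarrow> 0) at_top" using inclim by simp
  qed auto
  moreover have "(\<integral>x. \<Phi> t - \<Phi> (t - x) - x * f t \<partial>\<eta>) = \<Phi> t - step \<Phi> t - mean * f t" for t
    using \<Phi>int mean_integrable prob_space by (simp add: step_def mean_def)
  ultimately have "((\<lambda>t. \<Phi> t - step \<Phi> t - mean * f t) \<longlongrightarrow> 0) at_top" by simp
  from tendsto_diff[OF prim[folded \<Phi>_def] this]
  have "((\<lambda>t. mean * f t) \<longlongrightarrow> l) at_top" by simp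
  from tendsto_divide[OF this tendsto_const[of mean]] show ?thesis using mean_pos by simp
qed

end

section \<open>Window integrals and primitives of integrable functions\<close>

lemma integrable_indicator_Icc [simp]: "integrable lborel (indicator {a..b::real} :: real \<Rightarrow> real)"
  by (rule integrable_real_indicator) (auto simp: emeasure_lborel_Icc_eq)

lemma exp_Iic:
  fixes \<theta> :: real
  assumes "\<theta> > 0"
  shows integrable_exp_Iic: "integrable lborel (\<lambda>v. indicator {..0} v * exp (\<theta> * v))"
    and integral_exp_Iic: "(\<integral>v. indicator {..0} v * exp (\<theta> * v) \<partial>lborel) = 1 / \<theta>"
proof -
  have "(\<integral>\<^sup>+x. ennreal (indicator {0..} x * exp (- x)) \<partial>lborel) = (\<integral>\<^sup>+x. ennreal (x ^ 0 * exp (- x)) * indicator {0..} x \<partial>lborel)"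
    by (intro nn_integral_cong) (auto simp: indicator_def)
  also have "\<dots> = 1" using nn_intergal_power_times_exp_Ici[of 0] by simp
  finally have nn: "(\<integral>\<^sup>+x. ennreal (indicator {0..} x * exp (- x :: real)) \<partial>lborel) = 1" .
  then have int: "integrable lborel (\<lambda>x::real. indicator {0..} x * exp (- x))"
    by (intro integrableI_nonneg) auto
  have reflect: "(\<lambda>v. indicator {0..} (- \<theta> * v) * exp (\<theta> * v)) = (\<lambda>v. indicator {..0} v * exp (\<theta> * v))"
    using assms by (auto simp: indicator_def fun_eq_iff mult_le_0_iff)
  show "integrable lborel (\<lambda>v. indicator {..0} v * exp (\<theta> * v))"
    using lborel_integrable_real_affine[OF int, of "-\<theta>" 0] assms by (simp add: reflect[symmetric])
  have "1 = (\<integral>x. indicator {0..} x * exp (- x :: real) \<partial>lborel)"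
    using nn by (subst integral_eq_nn_integral) auto
  also have "\<dots> = \<theta> * (\<integral>v. indicator {0..} (- \<theta> * v) * exp (\<theta> * v) \<partial>lborel)"
    using assms by (subst lborel_integral_real_affine[of "-\<theta>" _ 0]) auto
  finally show "(\<integral>v. indicator {..0} v * exp (\<theta> * v) \<partial>lborel) = 1 / \<theta>"
    unfolding reflect using assms by (simp add: field_simps)
qed

lemma integrable_exp_Icc:
  fixes \<theta> :: real
  shows "integrable lborel (\<lambda>v. indicator {a..b} v * exp (\<theta> * v))"
proof -
  have "set_integrable lborel {a..b} (\<lambda>v. exp (\<theta> * v))"
    by (intro borel_integrable_atLeastAtMost' continuous_intros)
  then show ?thesis by (simp add: set_integrable_def)
qed

lemma smooth_translate:
  "smooth S f t = (\<integral>u. indicator S (u - t) * f u \<partial>lborel)"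
  unfolding smooth_def by (subst (2) lborel_integral_real_affine[of 1 _ t]) simp_all

text \<open>For fixed u the argument \<open>u - t\<close> runs to minus infinity. Hence c is 0 for a
  window, which leaves every point behind, and 1 for the half-line, which eventually covers every
  point.\<close>

lemma tendsto_smooth:
  assumes g: "integrable lborel g" and [measurable]: "S \<in> sets borel"
    and S: "\<And>u. ((\<lambda>t. indicator S (u - t) :: real) \<longlongrightarrow> c) at_top"
  shows "(smooth S g \<longlongrightarrow> c * (\<integral>u. g u \<partial>lborel)) at_top"
proof -
  have [measurable]: "g \<in> borel_measurable borel" using borel_measurable_integrable[OF g] by simp
  have "((\<lambda>t. \<integral>u. indicator S (u - t) * g u \<partial>lborel) \<longlongrightarrow> (\<integral>u. c * g u \<partial>lborel)) at_top"
  proof (rule integral_dominated_convergence_at_top[where w = "\<lambda>u. \<bar>g u\<bar>"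
        and s = "\<lambda>t u. indicator S (u - t) * g u" and f = "\<lambda>u. c * g u"])
    show "integrable lborel (\<lambda>u. \<bar>g u\<bar>)" using g by simp
    show "\<forall>\<^sub>F t in at_top. AE u in lborel. norm (indicator S (u - t) * g u) \<le> \<bar>g u\<bar>"
      by (auto simp: indicator_def)
    have "((\<lambda>t. indicator S (u - t) * g u) \<longlongrightarrow> c * g u) at_top" for u
      by (intro tendsto_intros S)
    then show "AE u in lborel. ((\<lambda>t. indicator S (u - t) * g u) \<longlongrightarrow> c * g u) at_top" by simp
  qed measurable
  then show ?thesis by (simp add: smooth_translate[abs_def])
qed

lemma tendsto_smooth_Icc:
  fixes h :: real
  assumes "integrable lborel g"
  shows "(smooth {0..h} g \<longlongrightarrow> 0) at_top"
proof -
  have "((\<lambda>t::real. indicator {0..h} (u - t) :: real) \<longlongrightarrow> 0) at_top" for u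
    by (rule tendsto_eventually, rule eventually_mono[OF eventually_gt_at_top[of u]]) auto
  from tendsto_smooth[OF assms _ this] show ?thesis by simp
qed

lemma tendsto_smooth_Iic:
  assumes "integrable lborel g"
  shows "(smooth {..0} g \<longlongrightarrow> (\<integral>u. g u \<partial>lborel)) at_top"
proof -
  have "((\<lambda>t::real. indicator {..0} (u - t) :: real) \<longlongrightarrow> 1) at_top" for u
    by (rule tendsto_eventually, rule eventually_mono[OF eventually_ge_at_top[of u]]) auto
  from tendsto_smooth[OF assms _ this] show ?thesis by simp
qed

lemma integral_smooth_Icc:
  assumes g: "integrable lborel g" and h: "h \<ge> 0"
  shows "integrable lborel (smooth {0..h} g)" "(\<integral>t. smooth {0..h} g t \<partial>lborel) = h * (\<integral>u. g u \<partial>lborel)"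
proof -
  have [measurable]: "g \<in> borel_measurable borel" using borel_measurable_integrable[OF g] by simp
  have gt: "integrable lborel (\<lambda>t. g (t + v))" for v
    using lborel_integrable_real_affine[OF g, of 1 v] by (simp add: add.commute)
  have shift: "(\<integral>t. k (t + v) \<partial>lborel) = (\<integral>t. k t \<partial>lborel)" for k :: "real \<Rightarrow> real" and v
    by (subst (2) lborel_integral_real_affine[of 1 _ v]) (simp_all add: add.commute)
  have int: "integrable (lborel \<Otimes>\<^sub>M lborel) (\<lambda>(v, t). indicator {0..h} v * g (t + v))"
  proof (rule lborel_pair.Fubini_integrable)
    show "AE v in lborel. integrable lborel (\<lambda>t. case (v, t) of (v, t) \<Rightarrow> indicator {0..h} v * g (t + v))"
      using gt by simp
    have "(\<integral>t. norm (indicator {0..h} v * g (t + v)) \<partial>lborel) = indicator {0..h} v * (\<integral>t. \<bar>g t\<bar> \<partial>lborel)" for v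
      using shift[of "\<lambda>t. \<bar>g t\<bar>" v] by (simp add: abs_mult)
    then show "integrable lborel (\<lambda>v. \<integral>t. norm (case (v, t) of (v, t) \<Rightarrow> indicator {0..h} v * g (t + v)) \<partial>lborel)"
      by simp
  qed measurable
  show "integrable lborel (smooth {0..h} g)"
    using lborel_pair.integrable_snd[OF int] by (simp add: smooth_def[abs_def])
  have "(\<integral>t. smooth {0..h} g t \<partial>lborel) = (\<integral>v. (\<integral>t. indicator {0..h} v * g (t + v) \<partial>lborel) \<partial>lborel)"
    unfolding smooth_def using lborel_pair.Fubini_integral[OF int] by simp
  also have "\<dots> = (\<integral>v. indicator {0..h} v * (\<integral>u. g u \<partial>lborel) \<partial>lborel)"
    by (simp add: shift)
  also have "\<dots> = h * (\<integral>u. g u \<partial>lborel)" using h by simp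
  finally show "(\<integral>t. smooth {0..h} g t \<partial>lborel) = h * (\<integral>u. g u \<partial>lborel)" .
qed

text \<open>The windows at s and t differ only inside \<open>{s..t}\<close> and
  \<open>{s+h..t+h}\<close>. This provides the uniform continuity on which the shift argument
  rests.\<close>

lemma smooth_Icc_Lipschitz:
  assumes [measurable]: "f \<in> borel_measurable borel" and R: "\<And>t. \<bar>f t\<bar> \<le> R" and st: "s \<le> t"
  shows "\<bar>smooth {0..h} f t - smooth {0..h} f s\<bar> \<le> 2 * R * (t - s)"
proof -
  have int: "integrable lborel (\<lambda>u. indicator {0..h} (u - t) * f u)" for t
  proof (rule Bochner_Integration.integrable_bound)
    show "integrable lborel (\<lambda>u. R * indicator {t..t+h} u)" by simp
    show "AE u in lborel. norm (indicator {0..h} (u - t) * f u) \<le> norm (R * indicator {t..t+h} u)"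
      using R by (intro always_eventually allI) (auto simp: indicator_def intro: order_trans[OF _ abs_ge_self])
  qed measurable
  have "\<bar>smooth {0..h} f t - smooth {0..h} f s\<bar>
      = \<bar>\<integral>u. indicator {0..h} (u - t) * f u - indicator {0..h} (u - s) * f u \<partial>lborel\<bar>"
    unfolding smooth_translate using int by simp
  also have "\<dots> \<le> (\<integral>u. \<bar>indicator {0..h} (u - t) * f u - indicator {0..h} (u - s) * f u\<bar> \<partial>lborel)"
    by (rule integral_abs_bound)
  also have "\<dots> \<le> (\<integral>u. R * (indicator {s..t} u + indicator {s+h..t+h} u) \<partial>lborel)"
  proof (rule integral_mono)
    show "integrable lborel (\<lambda>u. \<bar>indicator {0..h} (u - t) * f u - indicator {0..h} (u - s) * f u\<bar>)"
      using int by simp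
    show "integrable lborel (\<lambda>u. R * (indicator {s..t} u + indicator {s+h..t+h} u))" by simp
    show "\<bar>indicator {0..h} (u - t) * f u - indicator {0..h} (u - s) * f u\<bar>
        \<le> R * (indicator {s..t} u + indicator {s+h..t+h} u)" for u
      using R[of u] st by (auto simp: indicator_def)
  qed
  also have "\<dots> = 2 * R * (t - s)" using st by simp
  finally show ?thesis .
qed

section \<open>Removal of the smoothing and the renewal limit theorem\<close>

context renewal_walk
begin

text \<open>Monotonicity after the factor \<open>exp (- \<alpha> * t)\<close> means that r can fall
  freely but grow at most by \<open>exp (\<alpha> * h)\<close> across a window. Each window integral
  is therefore controlled by the value at its left end from above and at its right end from
  below.\<close>

lemma smooth_Icc_bounds:
  assumes th: "0 \<le> \<theta>" "\<theta> \<le> \<alpha>" and r: "exp_bdd \<theta> K r"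
    and anti: "antimono (\<lambda>t. exp (- \<alpha> * t) * r t)" and h: "h > 0"
  shows "h * exp (- \<alpha> * h) * r (t + h) \<le> smooth {0..h} r t"
    "smooth {0..h} r t \<le> h * exp (\<alpha> * h) * r t"
proof -
  have int: "integrable lborel (\<lambda>v. indicator {0..h} v * r (t + v))" for t
    by (rule smooth_integrable[OF _ integrable_exp_Icc th r]) simp
  have cmp: "r b \<le> exp (\<alpha> * h) * r a" if "a \<le> b" "b \<le> a + h" for a b
  proof -
    have "exp (- \<alpha> * b) * r b \<le> exp (- \<alpha> * a) * r a" using anti that by (auto dest: antimonoD)
    then have "exp (\<alpha> * b) * (exp (- \<alpha> * b) * r b) \<le> exp (\<alpha> * b) * (exp (- \<alpha> * a) * r a)"
      by (intro mult_left_mono) auto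
    then have "r b \<le> exp (\<alpha> * (b - a)) * r a"
      by (simp add: exp_diff exp_minus field_simps)
    also have "\<dots> \<le> exp (\<alpha> * h) * r a"
      using that alpha_pos exp_bdd_D(2)[OF r] by (intro mult_right_mono) auto
    finally show ?thesis .
  qed
  have cmp': "exp (- \<alpha> * h) * r b \<le> r a" if "a \<le> b" "b \<le> a + h" for a b
    using mult_left_mono[OF cmp[OF that], of "exp (- \<alpha> * h)"] by (simp add: mult.assoc[symmetric] flip: exp_add)
  have "h * exp (- \<alpha> * h) * r (t + h) = (\<integral>v. indicator {0..h} v * (exp (- \<alpha> * h) * r (t + h)) \<partial>lborel)"
    using h by simp
  also have "\<dots> \<le> smooth {0..h} r t"
    unfolding smooth_def
  proof (rule integral_mono[OF _ int])
    show "integrable lborel (\<lambda>v. indicator {0..h} v * (exp (- \<alpha> * h) * r (t + h)))" by simp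
  qed (use cmp' in \<open>auto simp: indicator_def\<close>)
  finally show "h * exp (- \<alpha> * h) * r (t + h) \<le> smooth {0..h} r t" .
  have "smooth {0..h} r t \<le> (\<integral>v. indicator {0..h} v * (exp (\<alpha> * h) * r t) \<partial>lborel)"
    unfolding smooth_def
  proof (rule integral_mono[OF int])
    show "integrable lborel (\<lambda>v. indicator {0..h} v * (exp (\<alpha> * h) * r t))" by simp
  qed (use cmp in \<open>auto simp: indicator_def\<close>)
  also have "\<dots> = h * exp (\<alpha> * h) * r t" using h by simp
  finally show "smooth {0..h} r t \<le> h * exp (\<alpha> * h) * r t" .
qed

text \<open>A Tauberian step: r is squeezed between window integrals divided by h, up to factors
  \<open>exp (\<alpha> * h)\<close> and \<open>exp (- \<alpha> * h)\<close>. For a given target a, a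
  single small h suffices, so no uniformity in h is required.\<close>

lemma unsmooth:
  assumes th: "0 \<le> \<theta>" "\<theta> \<le> \<alpha>" and r: "exp_bdd \<theta> K r"
    and anti: "antimono (\<lambda>t. exp (- \<alpha> * t) * r t)"
    and lim: "\<And>h. h > 0 \<Longrightarrow> (smooth {0..h} r \<longlongrightarrow> h * c) at_top"
  shows "(r \<longlongrightarrow> c) at_top"
proof (rule order_tendstoI)
  note b = smooth_Icc_bounds[OF th r anti]
  have l: "((\<lambda>h. exp (s * h) * c) \<longlongrightarrow> exp (s * 0) * c) (at_right 0)" for s
    by (intro tendsto_intros)
  fix a assume "a < c"
  then have "eventually (\<lambda>h. a < exp (- \<alpha> * h) * c) (at_right 0)"
    using order_tendstoD(1)[OF l[of "- \<alpha>"]] by simp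
  then obtain h where h: "h > 0" "a < exp (- \<alpha> * h) * c"
    by (metis (mono_tags, lifting) eventually_at_right_less eventually_conj eventually_happens trivial_limit_at_right_real)
  have "h * exp (\<alpha> * h) * a < h * c"
    using h mult_strict_left_mono[OF h(2), of "exp (\<alpha> * h)"] by (simp add: mult.assoc[symmetric] flip: exp_add)
  then have "eventually (\<lambda>t. h * exp (\<alpha> * h) * a < smooth {0..h} r t) at_top"
    using lim[OF h(1)] by (rule order_tendstoD(1)[rotated])
  then show "eventually (\<lambda>t. a < r t) at_top"
  proof eventually_elim
    case (elim t)
    then have "h * exp (\<alpha> * h) * a < h * exp (\<alpha> * h) * r t" using b(2)[OF h(1), of t] by simp
    then show ?case using h by simp
  qed
next
  note b = smooth_Icc_bounds[OF th r anti]
  have l: "((\<lambda>h. exp (s * h) * c) \<longlongrightarrow> exp (s * 0) * c) (at_right 0)" for s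
    by (intro tendsto_intros)
  fix a assume "c < a"
  then have "eventually (\<lambda>h. exp (\<alpha> * h) * c < a) (at_right 0)"
    using order_tendstoD(2)[OF l[of "\<alpha>"]] by simp
  then obtain h where h: "h > 0" "exp (\<alpha> * h) * c < a"
    by (metis (mono_tags, lifting) eventually_at_right_less eventually_conj eventually_happens trivial_limit_at_right_real)
  have "h * c < h * exp (- \<alpha> * h) * a"
    using h mult_strict_left_mono[OF h(2), of "exp (- \<alpha> * h)"] by (simp add: mult.assoc[symmetric] flip: exp_add)
  then have "eventually (\<lambda>t. smooth {0..h} r t < h * exp (- \<alpha> * h) * a) at_top"
    using lim[OF h(1)] by (rule order_tendstoD(2)[rotated])
  moreover have "filterlim (\<lambda>t. t - h) at_top at_top"
    using filterlim_tendsto_add_at_top[OF tendsto_const filterlim_ident, of "-h"] by simp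
  ultimately have "eventually (\<lambda>t. smooth {0..h} r (t - h) < h * exp (- \<alpha> * h) * a) at_top"
    by (rule eventually_compose_filterlim)
  then show "eventually (\<lambda>t. r t < a) at_top"
  proof eventually_elim
    case (elim t)
    then have "h * exp (- \<alpha> * h) * r t < h * exp (- \<alpha> * h) * a" using b(1)[OF h(1), of "t - h"] by simp
    then show ?case using h by simp
  qed
qed

text \<open>All work is done for the window integral f of r. It is bounded and Lipschitz, its defect
  tends to 0, which gives asymptotic invariance, and the defect of its primitive tends to h times
  the integral of the forcing term, which identifies the limit.\<close>

theorem renewal_limit:
  assumes th: "0 < \<theta>" "\<theta> < \<alpha>" and r: "exp_bdd \<theta> K r"
    and g: "integrable lborel (\<lambda>t. r t - step r t)"
    and anti: "antimono (\<lambda>t. exp (- \<alpha> * t) * r t)"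
  shows "(r \<longlongrightarrow> (\<integral>t. r t - step r t \<partial>lborel) / mean) at_top"
proof (rule unsmooth[OF _ _ r anti])
  define g where "g = (\<lambda>t. r t - step r t)"
  have gi: "integrable lborel g" using g by (simp add: g_def)
  have th': "0 \<le> \<theta>" "\<theta> \<le> \<alpha>" using th by auto
  show "0 \<le> \<theta>" "\<theta> \<le> \<alpha>" using th' .
  note Icc = integrable_exp_Icc[of 0 _ \<theta>]
  have defect: "smooth {0..h} r t - step (smooth {0..h} r) t = smooth {0..h} g t"
    "integrable lborel (\<lambda>v. indicator {0..h} v * g (t + v))" for h t
    unfolding g_def using smooth_defect[OF _ Icc th' r] by auto
  define M where "M h = exp (\<theta> * h) / (1 - kap \<theta>) * (\<integral>u. \<bar>g u\<bar> \<partial>lborel)" for h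
  have fM: "smooth {0..h} r t \<le> M h" if "h \<ge> 0" for h t
    unfolding M_def
  proof (rule renewal_bound[OF th smooth_bdd[OF _ Icc th' r] gi that])
    fix t
    show "smooth {0..h} r t - step (smooth {0..h} r) t \<le> smooth {0..h} (\<lambda>u. \<bar>g u\<bar>) t"
      unfolding defect unfolding smooth_def
      using defect(2)[of h t] integrable_abs[OF defect(2)[of h t]]
      by (intro integral_mono) (auto simp: abs_mult indicator_def)
  qed simp
  \<comment> \<open>Boundedness of r itself comes back from the window of length 1 that ends at t,
    at the price of the factor \<open>exp \<alpha>\<close>.\<close>
  define R where "R = exp \<alpha> * M 1"
  have rR: "\<bar>r t\<bar> \<le> R" for t
  proof -
    have "exp (- \<alpha>) * r t \<le> M 1"
      using smooth_Icc_bounds(1)[OF th' r anti zero_less_one, of "t - 1"] fM[of 1 "t - 1"] by simp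
    from mult_left_mono[OF this, of "exp \<alpha>"] show ?thesis
      using exp_bdd_D(2)[OF r, of t] by (simp add: R_def mult.assoc[symmetric] flip: exp_add)
  qed
  fix h :: real assume h: "h > 0"
  define f where "f = smooth {0..h} r"
  obtain Kf where fb: "exp_bdd \<theta> Kf f" unfolding f_def using smooth_bdd[OF _ Icc th' r] by auto
  note [measurable] = exp_bdd_D(1)[OF r] exp_bdd_D(1)[OF fb]
  have fabs: "\<bar>f t\<bar> \<le> M h" for t
    using fM[of h t] h exp_bdd_D(2)[OF fb, of t] by (simp add: f_def)
  have R0: "R \<ge> 0" using rR[of 0] by linarith
  have lip: "\<bar>f t - f s\<bar> \<le> 2 * R * \<bar>t - s\<bar>" for s t
    using smooth_Icc_Lipschitz[of r R s t h] smooth_Icc_Lipschitz[of r R t s h] rR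
    unfolding f_def by (cases "s \<le> t") (auto simp: abs_minus_commute)
  have uc: "uniformly_continuous_on UNIV f"
  proof (rule lipschitz_on_uniformly_continuous)
    show "(2 * R)-lipschitz_on UNIV f"
      using lip R0 by (intro lipschitz_onI) (auto simp: dist_real_def)
  qed
  have harm: "((\<lambda>t. f t - step f t) \<longlongrightarrow> 0) at_top"
    unfolding f_def defect using tendsto_smooth_Icc[OF gi] .
  have shift: "((\<lambda>t. f t - f (t - y)) \<longlongrightarrow> 0) at_top" for y
    by (rule asymptotic_shift[OF _ fabs uc harm]) measurable
  have eqg: "(\<lambda>t. f t - step f t) = smooth {0..h} g" unfolding f_def defect ..
  have "smooth {..0} f t - step (smooth {..0} f) t = smooth {..0} (smooth {0..h} g) t" for t
    using smooth_defect(2)[OF _ integrable_exp_Iic[OF th(1)] th' fb]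
    by (simp add: eqg)
  then have prim: "((\<lambda>t. smooth {..0} f t - step (smooth {..0} f) t) \<longlongrightarrow> h * (\<integral>u. g u \<partial>lborel)) at_top"
    using tendsto_smooth_Iic[OF integral_smooth_Icc(1)[OF gi, of h]] integral_smooth_Icc(2)[OF gi, of h] h by simp
  have "(f \<longlongrightarrow> h * (\<integral>u. g u \<partial>lborel) / mean) at_top"
    by (rule limit_from_primitive[OF th(1) th'(2) fb _ shift prim integrable_exp_Iic[OF th(1)]])
       (use fabs abs_le_D1 in blast)
  then show "(smooth {0..h} r \<longlongrightarrow> h * ((\<integral>t. r t - step r t \<partial>lborel) / mean)) at_top"
    by (simp add: f_def g_def)
qed

end

section \<open>Powers and the layer-cake formula\<close>

text \<open>The layer-cake integrand on the logarithmic scale: integrating over u gives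
  \<open>y powr \<alpha> / \<alpha>\<close>, while averaging over a random y gives the exponentially
  weighted tail at u. Exchanging the two integrals links the forcing term to a moment.\<close>

definition pow_layer :: "real \<Rightarrow> real \<Rightarrow> real \<Rightarrow> real" where
  "pow_layer \<alpha> y u = (if exp u < y then exp (\<alpha> * u) else 0)"

lemma pow_layer_measurable [measurable (raw)]:
  assumes [measurable]: "f \<in> borel_measurable M" "g \<in> borel_measurable M"
  shows "(\<lambda>x. pow_layer \<alpha> (f x) (g x)) \<in> borel_measurable M"
  unfolding pow_layer_def by measurable

lemma pow_layer_integral:
  assumes "\<alpha> > 0" "y \<ge> 0"
  shows "integrable lborel (pow_layer \<alpha> y)" "(\<integral>u. pow_layer \<alpha> y u \<partial>lborel) = y powr \<alpha> / \<alpha>"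
proof -
  have "integrable lborel (pow_layer \<alpha> y) \<and> (\<integral>u. pow_layer \<alpha> y u \<partial>lborel) = y powr \<alpha> / \<alpha>"
  proof (cases "y = 0")
    case True
    then have "pow_layer \<alpha> y u = 0" for u by (simp add: pow_layer_def not_less)
    then have "pow_layer \<alpha> y = (\<lambda>_. 0)" by auto
    then show ?thesis using True by simp
  next
    case False
    then have y: "y > 0" using assms by simp
    define e where "e u = indicator {..0} (u - ln y) * (y powr \<alpha> * exp (\<alpha> * (u - ln y)))" for u
    have eq: "AE u in lborel. e u = pow_layer \<alpha> y u"
      using AE_lborel_singleton[of "ln y"]
    proof eventually_elim
      case (elim u)
      have "exp u < y \<longleftrightarrow> u < ln y" using y by (metis exp_less_cancel_iff exp_ln)
      moreover have "y powr \<alpha> * exp (\<alpha> * (u - ln y)) = exp (\<alpha> * u)"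
        using y by (simp add: powr_def algebra_simps flip: exp_add)
      ultimately show ?case using elim by (auto simp: e_def pow_layer_def indicator_def)
    qed
    have [measurable]: "e \<in> borel_measurable borel" "pow_layer \<alpha> y \<in> borel_measurable borel"
      unfolding e_def[abs_def] by measurable
    have i0: "integrable lborel (\<lambda>v. indicator {..0} v * (y powr \<alpha> * exp (\<alpha> * v)))"
      using integrable_mult_left[OF integrable_exp_Iic[OF assms(1)], of "y powr \<alpha>"] by (simp add: mult_ac)
    have "integrable lborel e"
      using lborel_integrable_real_affine[OF i0, of 1 "- ln y"] by (simp add: e_def[abs_def])
    moreover have "(\<integral>u. e u \<partial>lborel) = y powr \<alpha> * (1 / \<alpha>)"
    proof -
      have "(\<integral>u. e u \<partial>lborel) = (\<integral>v. indicator {..0} v * (y powr \<alpha> * exp (\<alpha> * v)) \<partial>lborel)"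
        unfolding e_def by (subst (2) lborel_integral_real_affine[of 1 _ "- ln y"]) simp_all
      also have "\<dots> = (\<integral>v. y powr \<alpha> * (indicator {..0} v * exp (\<alpha> * v)) \<partial>lborel)"
        by (simp add: mult_ac)
      also have "\<dots> = y powr \<alpha> * (1 / \<alpha>)"
        unfolding integral_mult_right_zero integral_exp_Iic[OF assms(1)] ..
      finally show ?thesis .
    qed
    moreover have "integrable lborel e \<longleftrightarrow> integrable lborel (pow_layer \<alpha> y)"
      by (rule integrable_cong_AE) (use eq in auto)
    moreover have "(\<integral>u. e u \<partial>lborel) = (\<integral>u. pow_layer \<alpha> y u \<partial>lborel)"
      by (rule integral_cong_AE) (use eq in auto)
    ultimately show ?thesis by simp
  qed
  then show "integrable lborel (pow_layer \<alpha> y)" "(\<integral>u. pow_layer \<alpha> y u \<partial>lborel) = y powr \<alpha> / \<alpha>" by auto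
qed

lemma pow_layer_mono:
  assumes "x \<le> y"
  shows "pow_layer \<alpha> x u \<le> pow_layer \<alpha> y u"
  using assms by (auto simp: pow_layer_def)

text \<open>Layers are monotone in their level, so the difference has constant sign. This makes
  absolute integrability of the forcing term a consequence of integrability of the difference of
  powers.\<close>

lemma pow_layer_abs_diff:
  assumes "\<alpha> > 0" "x \<ge> 0" "y \<ge> 0"
  shows "(\<integral>u. \<bar>pow_layer \<alpha> x u - pow_layer \<alpha> y u\<bar> \<partial>lborel) = \<bar>x powr \<alpha> - y powr \<alpha>\<bar> / \<alpha>"
proof -
  have *: "(\<integral>u. \<bar>pow_layer \<alpha> x u - pow_layer \<alpha> y u\<bar> \<partial>lborel) = \<bar>x powr \<alpha> - y powr \<alpha>\<bar> / \<alpha>"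
    if "0 \<le> y" "y \<le> x" for x y
  proof -
    have "(\<integral>u. \<bar>pow_layer \<alpha> x u - pow_layer \<alpha> y u\<bar> \<partial>lborel) = (\<integral>u. pow_layer \<alpha> x u - pow_layer \<alpha> y u \<partial>lborel)"
      using pow_layer_mono[OF that(2)] by simp
    also have "\<dots> = x powr \<alpha> / \<alpha> - y powr \<alpha> / \<alpha>"
      using that assms(1) by (subst Bochner_Integration.integral_diff) (auto simp: pow_layer_integral)
    also have "\<dots> = \<bar>x powr \<alpha> - y powr \<alpha>\<bar> / \<alpha>"
      using that assms(1) powr_mono2[of \<alpha> y x] by (simp add: diff_divide_distrib)
    finally show ?thesis .
  qed
  show ?thesis
    using *[of y x] *[of x y] assms by (cases "y \<le> x") (auto simp: abs_minus_commute)
qed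

text \<open>The split is at \<open>y = d * x\<close> with \<open>(1 + d) powr s = q\<close>. The
  point is that q may be as close to 1 as wanted, so that a contraction factor survives the
  perturbation.\<close>

lemma powr_add_le_eps:
  fixes s q :: real
  assumes "0 < s" "1 < q"
  obtains C where "C \<ge> 0" "\<And>x y. x \<ge> 0 \<Longrightarrow> y \<ge> 0 \<Longrightarrow> (x + y) powr s \<le> q * x powr s + C * y powr s"
proof -
  define d where "d = q powr (1/s) - 1"
  have d: "d > 0" "(1 + d) powr s = q"
    using assms by (auto simp: d_def powr_powr gr_one_powr)
  have "(x + y) powr s \<le> q * x powr s + (1 + 1/d) powr s * y powr s" if "x \<ge> 0" "y \<ge> 0" for x y
  proof (cases "y \<le> d * x")
    case True
    then have "(x + y) powr s \<le> ((1 + d) * x) powr s" using that assms by (intro powr_mono2) (auto simp: algebra_simps)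
    also have "\<dots> = q * x powr s" using that d by (simp add: powr_mult)
    finally show ?thesis by (simp add: add_increasing2)
  next
    case False
    then have "(x + y) powr s \<le> ((1 + 1/d) * y) powr s"
      using that assms d(1) by (intro powr_mono2) (auto simp: field_simps)
    also have "\<dots> = (1 + 1/d) powr s * y powr s" using that d by (simp add: powr_mult)
    finally show ?thesis using assms by (simp add: add_increasing)
  qed
  then show ?thesis by (intro that[of "(1 + 1/d) powr s"]) auto
qed

text \<open>A number in the unit interval is at most its power of exponent s; this is applied to the
  two shares of the sum, which add up to 1.\<close>

lemma powr_add_subadditive:
  fixes x y s :: real
  assumes "0 < s" "s \<le> 1" "x \<ge> 0" "y \<ge> 0"
  shows "(x + y) powr s \<le> x powr s + y powr s"
proof (cases "x + y = 0")
  case False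
  then have p: "x + y > 0" using assms by simp
  have *: "z / (x + y) \<le> (z / (x + y)) powr s" if "0 \<le> z" "z \<le> x + y" for z
    using powr_mono'[of s 1 "z / (x + y)"] that p assms by simp
  have "1 = x / (x + y) + y / (x + y)" using p by (simp add: add_divide_distrib[symmetric])
  also have "\<dots> \<le> (x / (x + y)) powr s + (y / (x + y)) powr s"
    using assms by (intro add_mono *) auto
  also have "\<dots> = (x powr s + y powr s) / (x + y) powr s"
    using assms p by (simp add: powr_divide add_divide_distrib)
  finally show ?thesis using p by (simp add: field_simps)
qed (use assms in auto)

lemma powr_diff_le_small:
  fixes x y d \<alpha> :: real
  assumes "0 < \<alpha>" "\<alpha> \<le> 1" "x \<ge> 0" "y \<ge> 0" "\<bar>x - y\<bar> \<le> d"
  shows "\<bar>x powr \<alpha> - y powr \<alpha>\<bar> \<le> d powr \<alpha>"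
proof -
  have *: "a powr \<alpha> \<le> b powr \<alpha> + d powr \<alpha>" if "a \<ge> 0" "b \<ge> 0" "\<bar>a - b\<bar> \<le> d" for a b
  proof -
    have "a powr \<alpha> \<le> (b + d) powr \<alpha>" using that assms by (intro powr_mono2) auto
    also have "\<dots> \<le> b powr \<alpha> + d powr \<alpha>" using that assms by (intro powr_add_subadditive) auto
    finally show ?thesis .
  qed
  show ?thesis using *[of x y] *[of y x] assms by (auto simp: abs_le_iff abs_minus_commute)
qed

text \<open>The mean value theorem, arranged so that y enters only with exponent
  \<open>\<alpha> - 1\<close>: for y = A X just a moment of X of order below \<open>\<alpha>\<close>
  is then involved.\<close>

lemma powr_diff_le_large:
  fixes x y d \<alpha> :: real
  assumes "1 < \<alpha>" "x \<ge> 0" "y \<ge> 0" "\<bar>x - y\<bar> \<le> d"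
  shows "\<bar>x powr \<alpha> - y powr \<alpha>\<bar> \<le> \<alpha> * 2 powr \<alpha> * (d * y powr (\<alpha> - 1) + d powr \<alpha>)"
proof -
  have mvt: "a powr \<alpha> - b powr \<alpha> \<le> \<alpha> * (a - b) * a powr (\<alpha> - 1)" if "0 \<le> b" "b \<le> a" for a b
  proof (cases "b < a")
    case True
    have cont: "continuous_on {b..a} (\<lambda>x. x powr \<alpha>)"
      using that assms by (intro continuous_on_powr' continuous_intros) auto
    obtain z where z: "b < z" "z < a" "a powr \<alpha> - b powr \<alpha> = \<alpha> * z powr (\<alpha> - 1) * (a - b)"
    proof (rule mvt[OF True cont])
      show "((\<lambda>x. x powr \<alpha>) has_derivative (*) (\<alpha> * x powr (\<alpha> - 1))) (at x)" if "b < x" for x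
        using has_real_derivative_powr[of x \<alpha>] that \<open>0 \<le> b\<close> by (simp add: has_field_derivative_def)
    qed blast
    have "z powr (\<alpha> - 1) * (a - b) \<le> a powr (\<alpha> - 1) * (a - b)"
      using z that assms by (intro mult_right_mono powr_mono2) auto
    then show ?thesis
      using z(3) assms by (simp add: mult_left_mono mult.assoc mult.commute[of "a - b"])
  qed (use that in auto)
  have m: "max x y powr (\<alpha> - 1) \<le> 2 powr \<alpha> * (y powr (\<alpha> - 1) + d powr (\<alpha> - 1))"
  proof -
    have "max x y powr (\<alpha> - 1) \<le> (2 * max y d) powr (\<alpha> - 1)" using assms by (intro powr_mono2) auto
    also have "\<dots> = 2 powr (\<alpha> - 1) * max y d powr (\<alpha> - 1)" using assms by (simp add: powr_mult)
    also have "\<dots> \<le> 2 powr \<alpha> * (y powr (\<alpha> - 1) + d powr (\<alpha> - 1))"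
      using assms by (intro mult_mono) (auto simp: max_def)
    finally show ?thesis .
  qed
  have d0: "d \<ge> 0" using assms by linarith
  have dd: "d * d powr (\<alpha> - 1) = d powr \<alpha>"
    using d0 by (cases "d = 0") (auto simp: powr_mult_base)
  have "\<bar>x powr \<alpha> - y powr \<alpha>\<bar> \<le> \<alpha> * \<bar>x - y\<bar> * max x y powr (\<alpha> - 1)"
  proof (cases "y \<le> x")
    case True
    then show ?thesis using mvt[of y x] powr_mono2[of \<alpha> y x] assms by (simp add: max_def)
  next
    case False
    then show ?thesis using mvt[of x y] powr_mono2[of \<alpha> x y] assms by (simp add: max_def)
  qed
  also have "\<dots> \<le> \<alpha> * d * (2 powr \<alpha> * (y powr (\<alpha> - 1) + d powr (\<alpha> - 1)))"
    using assms d0 m by (intro mult_mono) auto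
  also have "\<dots> = \<alpha> * 2 powr \<alpha> * (d * y powr (\<alpha> - 1) + d * d powr (\<alpha> - 1))"
    by (simp add: algebra_simps)
  finally show ?thesis unfolding dd .
qed

section \<open>Moments of the stationary law\<close>

locale cramer_pair = prob_space \<mu> for \<mu> :: "(real \<times> real) measure" +
  fixes \<alpha> :: real
  assumes sets_mu [measurable_cong]: "sets \<mu> = sets borel"
    and A_pos: "AE z in \<mu>. fst z > 0"
    and alpha_pos: "\<alpha> > 0"
    and cramer: "(\<integral>\<^sup>+ z. ennreal (fst z powr \<alpha>) \<partial>\<mu>) = 1"
    and log_moment: "integrable \<mu> (\<lambda>z. fst z powr \<alpha> * max 0 (ln (fst z)))"
    and nonarithmetic: "log_nonarithmetic \<mu>"
begin

text \<open>The Esscher transform of the law of log A; the Cramer condition makes it a probability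
  measure.\<close>

definition eta :: "real measure" where
  "eta = distr (density \<mu> (\<lambda>z. ennreal (fst z powr \<alpha>))) borel (\<lambda>z. ln (fst z))"

lemma fst_measurable_mu [measurable]: "fst \<in> borel_measurable \<mu>"
  unfolding measurable_cong_sets[OF sets_mu refl] by (intro borel_measurable_continuous_onI continuous_intros)

lemma snd_measurable_mu [measurable]: "snd \<in> borel_measurable \<mu>"
  unfolding measurable_cong_sets[OF sets_mu refl] by (intro borel_measurable_continuous_onI continuous_intros)

lemma eta_integrable_iff:
  assumes [measurable]: "f \<in> borel_measurable borel"
  shows "integrable eta f \<longleftrightarrow> integrable \<mu> (\<lambda>z. fst z powr \<alpha> * f (ln (fst z)))"
  unfolding eta_def by (subst integrable_distr_eq) (auto simp: integrable_density)

lemma eta_integral: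
  fixes f :: "real \<Rightarrow> real"
  assumes [measurable]: "f \<in> borel_measurable borel"
  shows "(\<integral>x. f x \<partial>eta) = (\<integral>z. fst z powr \<alpha> * f (ln (fst z)) \<partial>\<mu>)"
  unfolding eta_def by (subst integral_distr) (auto simp: integral_density)

lemma tilt_exp: "a > 0 \<Longrightarrow> a powr \<alpha> * exp (- \<theta> * ln a) = a powr (\<alpha> - \<theta>)"
  for a :: real by (simp add: powr_def algebra_simps flip: exp_add)

lemma AE_eta:
  assumes "AE x in eta. P x" and [measurable]: "Measurable.pred borel P"
  shows "AE z in \<mu>. P (ln (fst z))"
proof -
  have "AE z in density \<mu> (\<lambda>z. ennreal (fst z powr \<alpha>)). P (ln (fst z))"
    using assms(1) unfolding eta_def by (subst (asm) AE_distr_iff) auto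
  then have "AE z in \<mu>. 0 < ennreal (fst z powr \<alpha>) \<longrightarrow> P (ln (fst z))"
    by (subst (asm) AE_density) auto
  with A_pos show ?thesis by eventually_elim auto
qed

lemma prob_space_eta: "prob_space eta"
proof (rule prob_spaceI)
  have "emeasure eta (space eta) = (\<integral>\<^sup>+ z. ennreal (fst z powr \<alpha>) \<partial>\<mu>)"
    unfolding eta_def by (subst emeasure_distr) (auto simp: emeasure_density cong: nn_integral_cong)
  then show "emeasure eta (space eta) = 1" using cramer by simp
qed

sublocale W: renewal_walk eta \<alpha>
proof (intro renewal_walk.intro real_distribution.intro real_distribution_axioms.intro renewal_walk_axioms.intro)
  show "prob_space eta" by (rule prob_space_eta)
  show "sets eta = sets borel" by (simp add: eta_def)
  show "\<alpha> > 0" by (rule alpha_pos)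
  have ae: "AE z in \<mu>. fst z powr \<alpha> * exp (- \<alpha> * ln (fst z)) = 1"
    using A_pos by eventually_elim (use tilt_exp[of _ \<alpha>] in simp)
  show "integrable eta (\<lambda>x. exp (- \<alpha> * x))"
  proof (subst eta_integrable_iff)
    show "integrable \<mu> (\<lambda>z. fst z powr \<alpha> * exp (- \<alpha> * ln (fst z)))"
      by (rule integrable_cong_AE_imp[of _ "\<lambda>_. 1"]) (use ae in \<open>auto elim: eventually_mono\<close>)
  qed simp
  have "(\<integral>x. exp (- \<alpha> * x) \<partial>eta) = (\<integral>z. 1 \<partial>\<mu>)"
    by (subst eta_integral, simp, rule integral_cong_AE) (use ae in auto)
  then show "(\<integral>x. exp (- \<alpha> * x) \<partial>eta) \<le> 1" using prob_space by simp
  show "integrable eta (\<lambda>x. x)"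
  proof (subst eta_integrable_iff)
    show "integrable \<mu> (\<lambda>z. fst z powr \<alpha> * ln (fst z))"
    proof (rule Bochner_Integration.integrable_bound)
      show "integrable \<mu> (\<lambda>z. fst z powr \<alpha> * max 0 (ln (fst z)) + 1 / \<alpha>)" using log_moment by simp
      \<comment> \<open>For a below 1 the quantity \<open>a powr \<alpha> * \<bar>ln a\<bar>\<close>
        is at most \<open>1 / \<alpha>\<close>, by \<open>1 + y \<le> exp y\<close> at
        \<open>y = - (\<alpha> * ln a)\<close>. Thus only the upper side of log A requires a moment
        hypothesis.\<close>
      have b: "\<bar>a powr \<alpha> * ln a\<bar> \<le> a powr \<alpha> * max 0 (ln a) + 1 / \<alpha>" if "a > 0" for a :: real
      proof (cases "a \<ge> 1")
        case True
        then show ?thesis using alpha_pos by simp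
      next
        case False
        have "a powr \<alpha> * (1 + - (\<alpha> * ln a)) \<le> a powr \<alpha> * exp (- (\<alpha> * ln a))"
          by (intro mult_left_mono exp_ge_add_one_self) auto
        also have "\<dots> = 1" using tilt_exp[OF that, of \<alpha>] that by simp
        finally have "a powr \<alpha> + a powr \<alpha> * (- (\<alpha> * ln a)) \<le> 1" by (simp add: ring_distribs)
        then have "a powr \<alpha> * (- (\<alpha> * ln a)) \<le> 1" using powr_ge_zero[of a \<alpha>] by linarith
        then have "a powr \<alpha> * (- ln a) \<le> 1 / \<alpha>" using alpha_pos by (simp add: field_simps)
        moreover have "\<bar>a powr \<alpha> * ln a\<bar> = a powr \<alpha> * (- ln a)" using False that by (simp add: abs_mult)
        ultimately show ?thesis by (simp add: add_increasing)
      qed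
      show "AE z in \<mu>. norm (fst z powr \<alpha> * ln (fst z)) \<le> norm (fst z powr \<alpha> * max 0 (ln (fst z)) + 1 / \<alpha>)"
        using A_pos by eventually_elim (use b in \<open>auto intro: order_trans[OF _ abs_ge_self]\<close>)
    qed measurable
  qed simp
  show "\<not> (\<exists>c>0. AE x in eta. \<exists>k::int. x = c * of_int k)"
  proof
    assume "\<exists>c>0. AE x in eta. \<exists>k::int. x = c * of_int k"
    then obtain c where c: "c > 0" "AE x in eta. \<exists>k::int. x = c * of_int k" by blast
    have "AE z in \<mu>. \<exists>k::int. ln (fst z) = c * of_int k" by (rule AE_eta[OF c(2)]) measurable
    then show False using nonarithmetic c(1) by (auto simp: log_nonarithmetic_def)
  qed
qed

definition A_moment :: "real \<Rightarrow> real" where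
  "A_moment s = (\<integral>z. fst z powr s \<partial>\<mu>)"

text \<open>Undoing the tilt identifies the moment of order s with
  \<open>W.kap (\<alpha> - s)\<close>. Its being below 1 is the contraction factor of every later
  iteration.\<close>

lemma A_moment_facts:
  assumes "0 < s" "s < \<alpha>"
  shows "integrable \<mu> (\<lambda>z. fst z powr s)" "0 \<le> A_moment s" "A_moment s < 1"
proof -
  have eq: "AE z in \<mu>. fst z powr \<alpha> * exp (- (\<alpha> - s) * ln (fst z)) = fst z powr s"
    using A_pos by eventually_elim (use tilt_exp[of _ "\<alpha> - s"] in simp)
  have "integrable eta (\<lambda>x. exp (- (\<alpha> - s) * x))"
    using W.exp_integrable[of "\<alpha> - s"] assms by simp
  then have "integrable \<mu> (\<lambda>z. fst z powr \<alpha> * exp (- (\<alpha> - s) * ln (fst z)))"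
    by (subst (asm) eta_integrable_iff) measurable
  then show "integrable \<mu> (\<lambda>z. fst z powr s)"
    by (rule integrable_cong_AE_imp) (use eq in \<open>auto elim: eventually_mono\<close>)
  have "A_moment s = W.kap (\<alpha> - s)"
    unfolding A_moment_def W.kap_def
    by (subst eta_integral, simp, rule integral_cong_AE) (use eq in \<open>auto elim: eventually_mono\<close>)
  then show "0 \<le> A_moment s" "A_moment s < 1"
    using W.kap_less_1[of "\<alpha> - s"] W.kap_nonneg[of "\<alpha> - s"] assms by auto
qed

lemma A_alpha_integrable: "integrable \<mu> (\<lambda>z. fst z powr \<alpha>)"
  using cramer by (intro integrableI_nonneg) auto

end

text \<open>A common frame for the Letac recursion and the capped one: any nonnegative map within
  distance \<open>\<beta>\<close> of multiplication by A. It suffices for the tail asymptotics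
  because \<open>\<beta>\<close> has a moment of order \<open>\<alpha>\<close>.\<close>

locale perturbed_recursion = cramer_pair +
  fixes \<nu> :: "real measure" and T :: "real \<times> real \<Rightarrow> real \<Rightarrow> real" and \<beta> :: "real \<times> real \<Rightarrow> real"
  assumes nu_prob: "prob_space \<nu>" and sets_nu [measurable_cong]: "sets \<nu> = sets borel"
    and T_measurable [measurable]: "(\<lambda>(z, x). T z x) \<in> borel_measurable (borel \<Otimes>\<^sub>M borel)"
    and stationary: "\<nu> = distr (\<mu> \<Otimes>\<^sub>M \<nu>) borel (\<lambda>(z, x). T z x)"
    and T_nonneg: "T z x \<ge> 0"
    and T_close: "fst z > 0 \<Longrightarrow> x \<ge> 0 \<Longrightarrow> \<bar>T z x - fst z * x\<bar> \<le> \<beta> z"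
    and \<beta>_measurable [measurable]: "\<beta> \<in> borel_measurable borel"
    and \<beta>_nonneg: "\<beta> z \<ge> 0"
    and \<beta>_moment: "integrable \<mu> (\<lambda>z. \<beta> z powr \<alpha>)"
begin

sublocale P: pair_prob_space \<mu> \<nu>
proof -
  interpret N: prob_space \<nu> by (rule nu_prob)
  show "pair_prob_space \<mu> \<nu>" ..
qed

lemma prod_integrable:
  fixes h :: "real \<times> real \<Rightarrow> real" and k :: "real \<Rightarrow> real"
  assumes h: "integrable \<mu> h" and k: "integrable \<nu> k"
  shows "integrable (\<mu> \<Otimes>\<^sub>M \<nu>) (\<lambda>(z, x). h z * k x)"
    "(\<integral>w. (case w of (z, x) \<Rightarrow> h z * k x) \<partial>(\<mu> \<Otimes>\<^sub>M \<nu>)) = (\<integral>z. h z \<partial>\<mu>) * (\<integral>x. k x \<partial>\<nu>)"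
proof -
  note [measurable] = borel_measurable_integrable[OF h] borel_measurable_integrable[OF k]
  show i: "integrable (\<mu> \<Otimes>\<^sub>M \<nu>) (\<lambda>(z, x). h z * k x)"
  proof (rule P.Fubini_integrable)
    show "integrable \<mu> (\<lambda>z. \<integral>x. norm (case (z, x) of (z, x) \<Rightarrow> h z * k x) \<partial>\<nu>)"
      using h by (simp add: abs_mult)
    show "AE z in \<mu>. integrable \<nu> (\<lambda>x. case (z, x) of (z, x) \<Rightarrow> h z * k x)" using k by simp
  qed measurable
  have "(\<integral>z. (\<integral>x. h z * k x \<partial>\<nu>) \<partial>\<mu>) = (\<integral>w. (case w of (z, x) \<Rightarrow> h z * k x) \<partial>(\<mu> \<Otimes>\<^sub>M \<nu>))"
    by (rule P.integral_fst[OF i])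
  then show "(\<integral>w. (case w of (z, x) \<Rightarrow> h z * k x) \<partial>(\<mu> \<Otimes>\<^sub>M \<nu>)) = (\<integral>z. h z \<partial>\<mu>) * (\<integral>x. k x \<partial>\<nu>)"
    by simp
qed

lemma stationary_integral:
  fixes f :: "real \<Rightarrow> real"
  assumes [measurable]: "f \<in> borel_measurable borel"
  shows "(\<integral>x. f x \<partial>\<nu>) = (\<integral>(z, x). f (T z x) \<partial>(\<mu> \<Otimes>\<^sub>M \<nu>))"
  by (subst stationary, subst integral_distr) (auto simp: case_prod_unfold)

lemma AE_nonneg: "AE x in \<nu>. x \<ge> 0"
  by (subst stationary, subst AE_distr_iff) (use T_nonneg in \<open>auto simp: case_prod_beta\<close>)

lemma AE_pair: "AE w in \<mu> \<Otimes>\<^sub>M \<nu>. fst (fst w) > 0 \<and> snd w \<ge> 0"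
proof -
  have "AE z in \<mu>. AE x in \<nu>. fst (fst (z, x)) > 0 \<and> snd (z, x) \<ge> 0"
    using A_pos by eventually_elim (use AE_nonneg in simp)
  then show ?thesis
    by (subst (asm) P.AE_pair_iff) auto
qed

lemma \<beta>_powr_integrable:
  assumes "0 < s" "s \<le> \<alpha>"
  shows "integrable \<mu> (\<lambda>z. \<beta> z powr s)"
proof (rule Bochner_Integration.integrable_bound)
  show "integrable \<mu> (\<lambda>z. 1 + \<beta> z powr \<alpha>)" using \<beta>_moment by simp
  have "b powr s \<le> 1 + b powr \<alpha>" if "b \<ge> 0" for b :: real
  proof (cases "b \<le> 1")
    case True
    then have "b powr s \<le> 1" using that assms by (intro powr_le1) auto
    then show ?thesis by (simp add: add_increasing2)
  next
    case False
    then have "b powr s \<le> b powr \<alpha>" using assms by (intro powr_mono) auto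
    then show ?thesis by simp
  qed
  then show "AE z in \<mu>. norm (\<beta> z powr s) \<le> norm (1 + \<beta> z powr \<alpha>)"
    using \<beta>_nonneg by (intro always_eventually) (auto intro: order_trans[OF _ abs_ge_self])
qed measurable

text \<open>Only truncated moments are known to be finite a priori, so the contraction is applied to
  \<open>E min (c X\<^sup>s) N\<close>: passing from \<open>c\<close> to \<open>q c\<close> costs \<open>c\<close> times a constant.\<close>

lemma moment_integrable:
  assumes s: "0 < s" "s < \<alpha>"
  shows "integrable \<nu> (\<lambda>x. x powr s)"
proof -
  define k where "k = A_moment s"
  have k: "0 \<le> k" "k < 1" using A_moment_facts[OF s] by (auto simp: k_def)
  have Ai: "integrable \<mu> (\<lambda>z. fst z powr s)" using A_moment_facts[OF s] by simp
  \<comment> \<open>Chosen above 1 with \<open>e * k < 1\<close>: for positive k the product q is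
    \<open>(1 + k) / 2\<close>, and for \<open>k = 0\<close> any e above 1 will do.\<close>
  define e where "e = (if k = 0 then 2 else (1 + k) / (2 * k))"
  define q where "q = e * k"
  have e: "e > 1" "0 \<le> q" "q < 1" using k by (auto simp: e_def q_def field_simps)
  obtain C where C: "C \<ge> 0" "\<And>x y. x \<ge> 0 \<Longrightarrow> y \<ge> 0 \<Longrightarrow> (x + y) powr s \<le> e * x powr s + C * y powr s"
    using powr_add_le_eps[OF s(1) e(1)] by blast
  define b where "b = C * (\<integral>z. \<beta> z powr s \<partial>\<mu>)"
  have bi: "integrable \<mu> (\<lambda>z. \<beta> z powr s)" using \<beta>_powr_integrable s by simp
  have b0: "b \<ge> 0" unfolding b_def using C by (intro mult_nonneg_nonneg integral_nonneg_AE) auto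
  define m where "m N c = (\<integral>x. min (c * x powr s) N \<partial>\<nu>)" for N c
  have mi: "integrable \<nu> (\<lambda>x. min (c * x powr s) N)" if "c \<ge> 0" "N \<ge> 0" for c N
    using that by (intro P.M2.integrable_const_bound[of _ N]) auto
  \<comment> \<open>The perturbation is split off outside the minimum. In the main term z is
    integrated first: truncation at N is concave, so the mean over z is at most the truncation of
    the mean, which has q c in place of c.\<close>
  have contract: "m N c \<le> m N (q * c) + c * b" if c: "c \<ge> 0" and N: "N \<ge> 0" for N c
  proof -
    have i1: "integrable (\<mu> \<Otimes>\<^sub>M \<nu>) (\<lambda>(z, x). min (c * T z x powr s) N)"
      using c N by (intro P.P.integrable_const_bound[of _ N]) (auto simp: case_prod_beta)
    have i2: "integrable (\<mu> \<Otimes>\<^sub>M \<nu>) (\<lambda>(z, x). min (c * e * fst z powr s * x powr s) N)"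
      using c N e by (intro P.P.integrable_const_bound[of _ N]) (auto simp: case_prod_beta)
    have i3: "integrable (\<mu> \<Otimes>\<^sub>M \<nu>) (\<lambda>(z, x). c * C * \<beta> z powr s * 1)"
      using bi by (intro prod_integrable) auto
    have "m N c = (\<integral>(z, x). min (c * T z x powr s) N \<partial>(\<mu> \<Otimes>\<^sub>M \<nu>))"
      unfolding m_def by (rule stationary_integral) measurable
    also have "\<dots> \<le> (\<integral>w. (case w of (z, x) \<Rightarrow> min (c * e * fst z powr s * x powr s) N)
        + (case w of (z, x) \<Rightarrow> c * C * \<beta> z powr s * 1) \<partial>(\<mu> \<Otimes>\<^sub>M \<nu>))"
    proof (rule integral_mono_AE)
      show "AE w in \<mu> \<Otimes>\<^sub>M \<nu>. (case w of (z, x) \<Rightarrow> min (c * T z x powr s) N)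
        \<le> (case w of (z, x) \<Rightarrow> min (c * e * fst z powr s * x powr s) N) + (case w of (z, x) \<Rightarrow> c * C * \<beta> z powr s * 1)"
        using AE_pair
      proof eventually_elim
        case (elim w)
        obtain z x where w: "w = (z, x)" by (cases w)
        have p: "fst z > 0" "x \<ge> 0" using elim w by auto
        have "T z x \<le> fst z * x + \<beta> z" using T_close[OF p] by auto
        then have "T z x powr s \<le> (fst z * x + \<beta> z) powr s" using T_nonneg s by (intro powr_mono2) auto
        also have "\<dots> \<le> e * (fst z * x) powr s + C * \<beta> z powr s" using C(2) p \<beta>_nonneg by simp
        finally have "c * T z x powr s \<le> c * (e * (fst z * x) powr s + C * \<beta> z powr s)"
          using c by (rule mult_left_mono)
        also have "\<dots> = c * e * fst z powr s * x powr s + c * C * \<beta> z powr s"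
          using p by (simp add: powr_mult algebra_simps)
        finally have "c * T z x powr s \<le> c * e * fst z powr s * x powr s + c * C * \<beta> z powr s" .
        moreover have "0 \<le> c * C * \<beta> z powr s" using c C by simp
        ultimately show ?case unfolding w by (auto simp: min_def)
      qed
    qed (use i1 i2 i3 in auto)
    also have "\<dots> = (\<integral>(z, x). min (c * e * fst z powr s * x powr s) N \<partial>(\<mu> \<Otimes>\<^sub>M \<nu>)) + c * b"
      using i2 i3 bi prod_integrable(2)[of "\<lambda>z. c * C * \<beta> z powr s" "\<lambda>_. 1"]
      by (subst Bochner_Integration.integral_add) (auto simp: b_def P.M2.prob_space)
    also have "(\<integral>(z, x). min (c * e * fst z powr s * x powr s) N \<partial>(\<mu> \<Otimes>\<^sub>M \<nu>))
        = (\<integral>x. (\<integral>z. min (c * e * fst z powr s * x powr s) N \<partial>\<mu>) \<partial>\<nu>)"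
      using P.integral_snd[OF i2] by simp
    also have "\<dots> \<le> m N (q * c)"
      unfolding m_def
    proof (rule integral_mono)
      show "integrable \<nu> (\<lambda>x. \<integral>z. min (c * e * fst z powr s * x powr s) N \<partial>\<mu>)"
        using P.integrable_snd[OF i2] by simp
      show "integrable \<nu> (\<lambda>x. min (q * c * x powr s) N)" using c N e by (intro mi) auto
      fix x
      have j: "integrable \<mu> (\<lambda>z. min (c * e * fst z powr s * x powr s) N)"
        using c N e by (intro integrable_const_bound[of _ N]) auto
      have "(\<integral>z. min (c * e * fst z powr s * x powr s) N \<partial>\<mu>) \<le> (\<integral>z. (c * e * x powr s) * fst z powr s \<partial>\<mu>)"
        using j Ai by (intro integral_mono) (auto simp: mult_ac)
      then have "(\<integral>z. min (c * e * fst z powr s * x powr s) N \<partial>\<mu>) \<le> q * c * x powr s"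
        by (simp add: q_def k_def A_moment_def mult_ac)
      moreover have "(\<integral>z. min (c * e * fst z powr s * x powr s) N \<partial>\<mu>) \<le> (\<integral>z. N \<partial>\<mu>)"
        using j by (intro integral_mono) auto
      ultimately show "(\<integral>z. min (c * e * fst z powr s * x powr s) N \<partial>\<mu>) \<le> min (q * c * x powr s) N"
        using prob_space by simp
    qed
    finally show ?thesis by simp
  qed
  have bound: "m N 1 \<le> b / (1 - q)" if N: "N \<ge> 0" for N
  proof -
    have it: "m N 1 \<le> m N (q ^ n) + b * (\<Sum>j<n. q ^ j)" for n
    proof (induction n)
      case (Suc n)
      then show ?case using contract[of "q ^ n" N] e N by (simp add: algebra_simps)
    qed simp
    \<comment> \<open>Here the truncation pays off: at fixed N dominated convergence applies,
      although nothing is known yet about the full moment. The resulting bound does not depend on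
      N.\<close>
    have "(\<lambda>n. m N (q ^ n)) \<longlonglongrightarrow> (\<integral>x. 0 \<partial>\<nu>)"
      unfolding m_def
    proof (rule integral_dominated_convergence[where w = "\<lambda>_. N"])
      have "(\<lambda>n. min (q ^ n * x powr s) N) \<longlonglongrightarrow> min (0 * x powr s) N" for x
        using e by (intro tendsto_min tendsto_mult LIMSEQ_realpow_zero tendsto_const) auto
      then show "AE x in \<nu>. (\<lambda>n. min (q ^ n * x powr s) N) \<longlonglongrightarrow> 0" using N by simp
      show "AE x in \<nu>. norm (min (q ^ n * x powr s) N) \<le> N" for n using N e by auto
    qed auto
    then have "(\<lambda>n. m N (q ^ n) + b / (1 - q)) \<longlonglongrightarrow> 0 + b / (1 - q)" by (intro tendsto_add) auto
    moreover have "m N 1 \<le> m N (q ^ n) + b / (1 - q)" for n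
    proof -
      have "(\<Sum>j<n. q ^ j) \<le> 1 / (1 - q)"
        using e by (subst sum_gp_strict) (auto simp: divide_right_mono)
      then have "b * (\<Sum>j<n. q ^ j) \<le> b * (1 / (1 - q))" using b0 by (rule mult_left_mono)
      then show ?thesis using it[of n] by simp
    qed
    ultimately show ?thesis by (intro LIMSEQ_le_const) auto
  qed
  show ?thesis
  proof (rule integrable_monotone_convergence)
    show "integrable \<nu> (\<lambda>x. min (x powr s) (real n))" for n using mi[of 1 "real n"] by simp
    show "AE x in \<nu>. mono (\<lambda>n. min (x powr s) (real n))" by (auto intro!: monoI)
    have "(\<lambda>n. min (x powr s) (real n)) \<longlonglongrightarrow> x powr s" for x
      by (rule tendsto_eventually, rule eventually_mono[OF eventually_ge_at_top[of "nat \<lceil>x powr s\<rceil>"]]) linarith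
    then show "AE x in \<nu>. (\<lambda>n. min (x powr s) (real n)) \<longlonglongrightarrow> x powr s" by simp
    show "(\<lambda>n. \<integral>x. min (x powr s) (real n) \<partial>\<nu>) \<longlonglongrightarrow> (SUP n. m (real n) 1)"
      unfolding m_def by (simp, rule LIMSEQ_incseq_SUP) 
        (use bound mi[of 1] in \<open>auto simp: m_def incseq_def intro!: bdd_aboveI[of _ "b / (1 - q)"] integral_mono\<close>)
  qed measurable
qed

end

section \<open>Implicit renewal theorem\<close>

text \<open>A crude form of Young's inequality: the product is at most the power
  \<open>\<alpha>\<close> of the larger of the two factors.\<close>

lemma (in cramer_pair) cross_moment_integrable:
  assumes [measurable]: "b \<in> borel_measurable borel" and b: "\<And>z. b z \<ge> 0"
    and bi: "integrable \<mu> (\<lambda>z. b z powr \<alpha>)" and \<alpha>: "1 < \<alpha>"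
  shows "integrable \<mu> (\<lambda>z. b z * fst z powr (\<alpha> - 1))"
proof (rule Bochner_Integration.integrable_bound)
  show "integrable \<mu> (\<lambda>z. b z powr \<alpha> + fst z powr \<alpha>)" using bi A_alpha_integrable by simp
  have *: "x * a powr (\<alpha> - 1) \<le> x powr \<alpha> + a powr \<alpha>" if "x \<ge> 0" "a > 0" for x a :: real
  proof (cases "x \<le> a")
    case True
    then have "x * a powr (\<alpha> - 1) \<le> a * a powr (\<alpha> - 1)" by (intro mult_right_mono) auto
    also have "\<dots> = a powr \<alpha>" using that by (simp add: powr_mult_base)
    finally show ?thesis by (simp add: add_increasing)
  next
    case False
    then have "x * a powr (\<alpha> - 1) \<le> x * x powr (\<alpha> - 1)" using that \<alpha> by (intro mult_left_mono powr_mono2) auto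
    also have "\<dots> = x powr \<alpha>" using that by (simp add: powr_mult_base)
    finally show ?thesis by (simp add: add_increasing2)
  qed
  show "AE z in \<mu>. norm (b z * fst z powr (\<alpha> - 1)) \<le> norm (b z powr \<alpha> + fst z powr \<alpha>)"
    using A_pos
  proof eventually_elim
    case (elim z)
    then show ?case using *[OF b[of z] elim] b[of z] by simp
  qed
qed measurable

context perturbed_recursion
begin

text \<open>The two powers may have infinite mean separately; only their difference is controlled.
  For \<open>\<alpha> \<le> 1\<close> it is at most \<open>\<beta> z powr \<alpha>\<close>. For
  larger \<open>\<alpha>\<close> the additional cross term factorises by independence and uses the
  moment of X of order \<open>\<alpha> - 1\<close>.\<close>

lemma difference_integrable:
  "integrable (\<mu> \<Otimes>\<^sub>M \<nu>) (\<lambda>(z, x). T z x powr \<alpha> - (fst z * x) powr \<alpha>)"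
proof (cases "\<alpha> \<le> 1")
  case True
  show ?thesis
  proof (rule Bochner_Integration.integrable_bound)
    show "integrable (\<mu> \<Otimes>\<^sub>M \<nu>) (\<lambda>(z, x). \<beta> z powr \<alpha> * 1)"
      using \<beta>_moment by (intro prod_integrable) auto
    show "AE w in \<mu> \<Otimes>\<^sub>M \<nu>. norm (case w of (z, x) \<Rightarrow> T z x powr \<alpha> - (fst z * x) powr \<alpha>)
        \<le> norm (case w of (z, x) \<Rightarrow> \<beta> z powr \<alpha> * 1)"
      using AE_pair
    proof eventually_elim
      case (elim w)
      then show ?case
        using powr_diff_le_small[OF alpha_pos True T_nonneg _ T_close, of "fst w" "snd w"]
        by (cases w) simp
    qed
  qed measurable
next
  case False
  then have \<alpha>: "1 < \<alpha>" by simp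
  show ?thesis
  proof (rule Bochner_Integration.integrable_bound)
    have "integrable (\<mu> \<Otimes>\<^sub>M \<nu>) (\<lambda>(z, x). (\<beta> z * fst z powr (\<alpha> - 1)) * x powr (\<alpha> - 1))"
      using cross_moment_integrable[OF _ \<beta>_nonneg \<beta>_moment \<alpha>] moment_integrable[of "\<alpha> - 1"] \<alpha>
      by (intro prod_integrable) auto
    moreover have "integrable (\<mu> \<Otimes>\<^sub>M \<nu>) (\<lambda>(z, x). \<beta> z powr \<alpha> * 1)"
      using \<beta>_moment by (intro prod_integrable) auto
    ultimately show "integrable (\<mu> \<Otimes>\<^sub>M \<nu>) (\<lambda>w. \<alpha> * 2 powr \<alpha> *
        ((case w of (z, x) \<Rightarrow> \<beta> z * fst z powr (\<alpha> - 1) * x powr (\<alpha> - 1)) + (case w of (z, x) \<Rightarrow> \<beta> z powr \<alpha> * 1)))"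
      by (intro integrable_mult_right Bochner_Integration.integrable_add)
    show "AE w in \<mu> \<Otimes>\<^sub>M \<nu>. norm (case w of (z, x) \<Rightarrow> T z x powr \<alpha> - (fst z * x) powr \<alpha>)
        \<le> norm (\<alpha> * 2 powr \<alpha> *
        ((case w of (z, x) \<Rightarrow> \<beta> z * fst z powr (\<alpha> - 1) * x powr (\<alpha> - 1)) + (case w of (z, x) \<Rightarrow> \<beta> z powr \<alpha> * 1)))"
      using AE_pair
    proof eventually_elim
      case (elim w)
      obtain z x where w: "w = (z, x)" by (cases w)
      have p: "fst z > 0" "x \<ge> 0" using elim w by auto
      have "\<bar>T z x powr \<alpha> - (fst z * x) powr \<alpha>\<bar>
          \<le> \<alpha> * 2 powr \<alpha> * (\<beta> z * (fst z * x) powr (\<alpha> - 1) + \<beta> z powr \<alpha>)"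
        using p by (intro powr_diff_le_large[OF \<alpha> T_nonneg _ T_close]) auto
      also have "\<dots> = \<alpha> * 2 powr \<alpha> * (\<beta> z * fst z powr (\<alpha> - 1) * x powr (\<alpha> - 1) + \<beta> z powr \<alpha>)"
        using p by (simp add: powr_mult)
      finally show ?case unfolding w by (simp add: order_trans[OF _ abs_ge_self])
    qed
  qed measurable
qed

definition tail_weight :: "real \<Rightarrow> real" where
  "tail_weight u = exp (\<alpha> * u) * measure \<nu> {exp u<..}"

lemma tail_weight_layer: "tail_weight u = (\<integral>x. pow_layer \<alpha> x u \<partial>\<nu>)"
proof -
  have "(\<integral>x. pow_layer \<alpha> x u \<partial>\<nu>) = (\<integral>x. exp (\<alpha> * u) * indicator {exp u<..} x \<partial>\<nu>)"
    by (intro Bochner_Integration.integral_cong) (auto simp: pow_layer_def)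
  then show ?thesis by (simp add: tail_weight_def sets_eq_imp_space_eq[OF sets_nu])
qed

lemma pow_layer_pair_integrable:
  assumes [measurable]: "f \<in> borel_measurable (\<mu> \<Otimes>\<^sub>M \<nu>)"
  shows "integrable (\<mu> \<Otimes>\<^sub>M \<nu>) (\<lambda>w. pow_layer \<alpha> (f w) u)"
  by (rule P.P.integrable_const_bound[of _ "exp (\<alpha> * u)"]) (auto simp: pow_layer_def)

lemma tail_weight_stationary: "tail_weight u = (\<integral>w. pow_layer \<alpha> (T (fst w) (snd w)) u \<partial>(\<mu> \<Otimes>\<^sub>M \<nu>))"
  unfolding tail_weight_layer by (subst stationary_integral) (auto simp: case_prod_unfold)

lemma tail_weight_measurable [measurable]: "tail_weight \<in> borel_measurable borel"
  unfolding tail_weight_layer[abs_def] by measurable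

text \<open>Under the tilt, one step of the walk replaces X by A X: the weight A^alpha combined with
  a shift by log A carries the layer of x at \<open>u - ln A\<close> to the layer of A x at
  u.\<close>

lemma step_tail_weight:
  "W.step tail_weight u = (\<integral>w. pow_layer \<alpha> (fst (fst w) * snd w) u \<partial>(\<mu> \<Otimes>\<^sub>M \<nu>))"
proof -
  have "W.step tail_weight u = (\<integral>z. fst z powr \<alpha> * tail_weight (u - ln (fst z)) \<partial>\<mu>)"
    unfolding W.step_def by (rule eta_integral) measurable
  also have "\<dots> = (\<integral>z. (\<integral>x. pow_layer \<alpha> (fst z * x) u \<partial>\<nu>) \<partial>\<mu>)"
  proof (rule integral_cong_AE)
    show "AE z in \<mu>. fst z powr \<alpha> * tail_weight (u - ln (fst z)) = (\<integral>x. pow_layer \<alpha> (fst z * x) u \<partial>\<nu>)"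
      using A_pos
    proof eventually_elim
      case (elim z)
      have "fst z powr \<alpha> * pow_layer \<alpha> x (u - ln (fst z)) = pow_layer \<alpha> (fst z * x) u" for x
        using elim tilt_exp[of "fst z" \<alpha>]
        by (auto simp: pow_layer_def exp_diff powr_def right_diff_distrib divide_simps mult.commute)
      then show ?case by (simp add: tail_weight_layer flip: integral_mult_right_zero)
    qed
  qed measurable
  also have "\<dots> = (\<integral>w. pow_layer \<alpha> (fst (fst w) * snd w) u \<partial>(\<mu> \<Otimes>\<^sub>M \<nu>))"
    using P.integral_fst[of "\<lambda>z x. pow_layer \<alpha> (fst z * x) u"] pow_layer_pair_integrable[of "\<lambda>w. fst (fst w) * snd w" u]
    by (simp add: case_prod_unfold)
  finally show ?thesis .
qed

text \<open>By stationarity and the previous identity the defect at u is the mean difference of the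
  layers of the new value and of A X. Integrating u out inside the expectation gives both
  integrability and value.\<close>

lemma tail_weight_defect:
  shows "integrable lborel (\<lambda>u. tail_weight u - W.step tail_weight u)"
    and "(\<integral>u. tail_weight u - W.step tail_weight u \<partial>lborel)
      = (\<integral>(z, x). T z x powr \<alpha> - (fst z * x) powr \<alpha> \<partial>(\<mu> \<Otimes>\<^sub>M \<nu>)) / \<alpha>"
proof -
  interpret Q: pair_sigma_finite "\<mu> \<Otimes>\<^sub>M \<nu>" lborel ..
  define \<psi> where "\<psi> w u = pow_layer \<alpha> (T (fst w) (snd w)) u - pow_layer \<alpha> (fst (fst w) * snd w) u"
    for w :: "(real \<times> real) \<times> real" and u
  have \<psi>m [measurable]: "(\<lambda>(w, u). \<psi> w u) \<in> borel_measurable ((\<mu> \<Otimes>\<^sub>M \<nu>) \<Otimes>\<^sub>M lborel)"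
    unfolding \<psi>_def by measurable
  have abs: "AE w in \<mu> \<Otimes>\<^sub>M \<nu>. (\<integral>u. \<bar>\<psi> w u\<bar> \<partial>lborel)
      = \<bar>T (fst w) (snd w) powr \<alpha> - (fst (fst w) * snd w) powr \<alpha>\<bar> / \<alpha>"
    using AE_pair
  proof eventually_elim
    case (elim w)
    then show ?case unfolding \<psi>_def using alpha_pos T_nonneg by (intro pow_layer_abs_diff) auto
  qed
  have plain: "AE w in \<mu> \<Otimes>\<^sub>M \<nu>. (\<integral>u. \<psi> w u \<partial>lborel)
      = (T (fst w) (snd w) powr \<alpha> - (fst (fst w) * snd w) powr \<alpha>) / \<alpha>"
    using AE_pair
  proof eventually_elim
    case (elim w)
    then show ?case unfolding \<psi>_def using alpha_pos T_nonneg
      by (subst Bochner_Integration.integral_diff) (auto simp: pow_layer_integral diff_divide_distrib)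
  qed
  have di: "integrable (\<mu> \<Otimes>\<^sub>M \<nu>) (\<lambda>w. T (fst w) (snd w) powr \<alpha> - (fst (fst w) * snd w) powr \<alpha>)"
    using difference_integrable by (simp add: case_prod_unfold)
  have int: "integrable ((\<mu> \<Otimes>\<^sub>M \<nu>) \<Otimes>\<^sub>M lborel) (\<lambda>(w, u). \<psi> w u)"
  proof (rule Q.Fubini_integrable[OF \<psi>m])
    have "integrable (\<mu> \<Otimes>\<^sub>M \<nu>) (\<lambda>w. \<integral>u. \<bar>\<psi> w u\<bar> \<partial>lborel)"
    proof (rule integrable_cong_AE_imp)
      show "integrable (\<mu> \<Otimes>\<^sub>M \<nu>) (\<lambda>w. \<bar>T (fst w) (snd w) powr \<alpha> - (fst (fst w) * snd w) powr \<alpha>\<bar> / \<alpha>)"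
        using di by simp
      show "AE w in \<mu> \<Otimes>\<^sub>M \<nu>. \<bar>T (fst w) (snd w) powr \<alpha> - (fst (fst w) * snd w) powr \<alpha>\<bar> / \<alpha> = (\<integral>u. \<bar>\<psi> w u\<bar> \<partial>lborel)"
        using abs by eventually_elim simp
    qed measurable
    then show "integrable (\<mu> \<Otimes>\<^sub>M \<nu>) (\<lambda>w. \<integral>u. norm (case (w, u) of (w, u) \<Rightarrow> \<psi> w u) \<partial>lborel)" by simp
    show "AE w in \<mu> \<Otimes>\<^sub>M \<nu>. integrable lborel (\<lambda>u. case (w, u) of (w, u) \<Rightarrow> \<psi> w u)"
      using AE_pair by eventually_elim (use alpha_pos T_nonneg in \<open>auto simp: \<psi>_def intro!: pow_layer_integral\<close>)
  qed
  have g: "tail_weight u - W.step tail_weight u = (\<integral>w. \<psi> w u \<partial>(\<mu> \<Otimes>\<^sub>M \<nu>))" for u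
    unfolding tail_weight_stationary step_tail_weight \<psi>_def
    by (rule Bochner_Integration.integral_diff[symmetric]; rule pow_layer_pair_integrable) measurable
  show "integrable lborel (\<lambda>u. tail_weight u - W.step tail_weight u)"
    unfolding g using Q.integrable_snd[OF int] by simp
  have "(\<integral>u. tail_weight u - W.step tail_weight u \<partial>lborel) = (\<integral>w. (\<integral>u. \<psi> w u \<partial>lborel) \<partial>(\<mu> \<Otimes>\<^sub>M \<nu>))"
    unfolding g using Q.Fubini_integral[OF int] by simp
  also have "\<dots> = (\<integral>w. (T (fst w) (snd w) powr \<alpha> - (fst (fst w) * snd w) powr \<alpha>) / \<alpha> \<partial>(\<mu> \<Otimes>\<^sub>M \<nu>))"
    by (rule integral_cong_AE[OF _ _ plain]) measurable
  finally show "(\<integral>u. tail_weight u - W.step tail_weight u \<partial>lborel)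
      = (\<integral>(z, x). T z x powr \<alpha> - (fst z * x) powr \<alpha> \<partial>(\<mu> \<Otimes>\<^sub>M \<nu>)) / \<alpha>"
    by (simp add: case_prod_unfold)
qed

lemma tail_markov:
  assumes "0 < s" "s < \<alpha>" "t > 0"
  shows "measure \<nu> {t<..} \<le> (\<integral>x. x powr s \<partial>\<nu>) * t powr (- s)"
proof -
  have "t powr s * measure \<nu> {t<..} = (\<integral>x. t powr s * indicator {t<..} x \<partial>\<nu>)"
    by (simp add: sets_eq_imp_space_eq[OF sets_nu])
  also have "\<dots> \<le> (\<integral>x. x powr s \<partial>\<nu>)"
  proof (rule integral_mono)
    show "integrable \<nu> (\<lambda>x. t powr s * indicator {t<..} x)"
      by (intro integrable_mult_right integrable_real_indicator) (auto simp: P.M2.emeasure_eq_measure)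
    show "integrable \<nu> (\<lambda>x. x powr s)" using assms by (intro moment_integrable)
    show "t powr s * indicator {t<..} x \<le> x powr s" for x
      using assms by (auto simp: indicator_def intro!: powr_mono2)
  qed
  finally show ?thesis using assms by (simp add: powr_minus field_simps)
qed

theorem tail_limit:
  "((\<lambda>t. measure \<nu> {t<..} * t powr \<alpha>) \<longlongrightarrow>
     (\<integral>(z, x). T z x powr \<alpha> - (fst z * x) powr \<alpha> \<partial>(\<mu> \<Otimes>\<^sub>M \<nu>)) / (\<alpha> * W.mean)) at_top"
proof -
  \<comment> \<open>Any s strictly between 0 and \<open>\<alpha>\<close> would serve; Markov's
    inequality then bounds the weight with the growth exponent \<open>\<alpha> - s\<close>, which
    lies in the contraction range.\<close>
  define s where "s = \<alpha> / 2"
  have s: "0 < s" "s < \<alpha>" using alpha_pos by (auto simp: s_def)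
  define K where "K = (\<integral>x. x powr s \<partial>\<nu>)"
  have "W.exp_bdd (\<alpha> - s) K tail_weight"
    unfolding W.exp_bdd_def
  proof (intro conjI allI tail_weight_measurable)
    fix u
    show "0 \<le> tail_weight u" by (simp add: tail_weight_def)
    have "tail_weight u \<le> exp (\<alpha> * u) * (K * exp u powr (- s))"
      unfolding tail_weight_def K_def using s by (intro mult_left_mono tail_markov) auto
    then show "tail_weight u \<le> K * exp ((\<alpha> - s) * u)"
      by (simp add: powr_def algebra_simps exp_diff exp_minus divide_simps)
  qed
  moreover have "antimono (\<lambda>u. exp (- \<alpha> * u) * tail_weight u)"
    by (intro antimonoI)
      (auto simp: tail_weight_def mult.assoc[symmetric] exp_add[symmetric] intro!: P.M2.finite_measure_mono)
  ultimately have "(tail_weight \<longlongrightarrow> (\<integral>u. tail_weight u - W.step tail_weight u \<partial>lborel) / W.mean) at_top"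
    using s by (intro W.renewal_limit[of "\<alpha> - s" K] tail_weight_defect) auto
  from filterlim_compose[OF this ln_at_top]
  have "((\<lambda>t. tail_weight (ln t)) \<longlongrightarrow>
     (\<integral>(z, x). T z x powr \<alpha> - (fst z * x) powr \<alpha> \<partial>(\<mu> \<Otimes>\<^sub>M \<nu>)) / (\<alpha> * W.mean)) at_top"
    unfolding tail_weight_defect by simp
  moreover have "eventually (\<lambda>t. tail_weight (ln t) = measure \<nu> {t<..} * t powr \<alpha>) at_top"
    using eventually_gt_at_top[of 0] by eventually_elim (simp add: tail_weight_def powr_def)
  ultimately show ?thesis by (rule Lim_transform_eventually)
qed

end

section \<open>The capped recursion\<close>

context cramer_pair
begin

text \<open>The action of \<open>Q \<mapsto> max (A Q - c) 1\<close> on distribution functions; the iterates started from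
  the point mass at 1 decrease to the stationary one.\<close>

definition cap_step :: "(real \<times> real \<Rightarrow> real) \<Rightarrow> (real \<Rightarrow> real) \<Rightarrow> real \<Rightarrow> real" where
  "cap_step c f t = (if t < 1 then 0 else \<integral>z. f ((t + c z) / fst z) \<partial>\<mu>)"

text \<open>The last clause is a Pareto bound on the tail. It is preserved by the iteration because
  E A^s < 1, and it keeps mass from escaping to infinity in the limit.\<close>

definition cap_cdf :: "real \<Rightarrow> (real \<Rightarrow> real) \<Rightarrow> bool" where
  "cap_cdf s f \<longleftrightarrow> mono f \<and> (\<forall>t. 0 \<le> f t \<and> f t \<le> 1) \<and> (\<forall>t<1. f t = 0)
     \<and> (\<forall>t\<ge>1. 1 - t powr (- s) \<le> f t)"

lemma cap_cdf_integrable: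
  assumes f: "cap_cdf s f" and [measurable]: "c \<in> borel_measurable borel"
  shows "integrable \<mu> (\<lambda>z. f ((t + c z) / fst z))"
proof (rule integrable_const_bound[of _ 1])
  have [measurable]: "f \<in> borel_measurable borel"
    using f by (intro borel_measurable_mono) (simp add: cap_cdf_def)
  show "(\<lambda>z. f ((t + c z) / fst z)) \<in> borel_measurable \<mu>" by measurable
  show "AE z in \<mu>. norm (f ((t + c z) / fst z)) \<le> 1" using f by (auto simp: cap_cdf_def)
qed

context
  fixes c :: "real \<times> real \<Rightarrow> real" and s :: real
  assumes c_meas [measurable]: "c \<in> borel_measurable borel" and c_nonneg: "\<And>z. c z \<ge> 0"
    and s: "0 < s" "s < \<alpha>"
begin

lemma cap_step_mono:
  assumes "cap_cdf s f" "cap_cdf s g" "\<And>t. f t \<le> g t"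
  shows "cap_step c f t \<le> cap_step c g t"
  unfolding cap_step_def
  using assms(3) cap_cdf_integrable[OF assms(1) c_meas] cap_cdf_integrable[OF assms(2) c_meas]
  by (auto intro!: integral_mono)

lemma cap_step_cdf:
  assumes f: "cap_cdf s f"
  shows "cap_cdf s (cap_step c f)"
  unfolding cap_cdf_def
proof (intro conjI allI impI)
  note fi = cap_cdf_integrable[OF f c_meas]
  have f01: "0 \<le> f t" "f t \<le> 1" for t using f by (auto simp: cap_cdf_def)
  show "0 \<le> cap_step c f t" for t
    using f01 by (auto simp: cap_step_def intro!: integral_nonneg_AE)
  have "(\<integral>z. f ((t + c z) / fst z) \<partial>\<mu>) \<le> (\<integral>z. 1 \<partial>\<mu>)" for t
    using fi f01 by (intro integral_mono) auto
  then show "cap_step c f t \<le> 1" for t using prob_space by (auto simp: cap_step_def)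
  show "cap_step c f t = 0" if "t < 1" for t using that by (simp add: cap_step_def)
  show "mono (cap_step c f)"
  proof (rule monoI)
    fix t u :: real assume tu: "t \<le> u"
    have "(\<integral>z. f ((t + c z) / fst z) \<partial>\<mu>) \<le> (\<integral>z. f ((u + c z) / fst z) \<partial>\<mu>)"
    proof (rule integral_mono_AE[OF fi fi])
      show "AE z in \<mu>. f ((t + c z) / fst z) \<le> f ((u + c z) / fst z)"
        using A_pos
      proof eventually_elim
        case (elim z)
        then have "(t + c z) / fst z \<le> (u + c z) / fst z" using tu by (intro divide_right_mono) auto
        then show ?case using f by (auto simp: cap_cdf_def dest: monoD)
      qed
    qed
    then show "cap_step c f t \<le> cap_step c f u"
      using tu f01 by (auto simp: cap_step_def intro!: integral_nonneg_AE)
  qed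
  fix t :: real assume t: "1 \<le> t"
  note A = A_moment_facts[OF s]
  have "1 - t powr (- s) \<le> 1 - A_moment s * t powr (- s)"
    using A by (simp add: mult_left_le_one_le)
  also have "\<dots> = (\<integral>z. 1 - fst z powr s * t powr (- s) \<partial>\<mu>)"
    using A(1) prob_space by (simp add: A_moment_def)
  also have "\<dots> \<le> (\<integral>z. f ((t + c z) / fst z) \<partial>\<mu>)"
  proof (rule integral_mono_AE)
    show "integrable \<mu> (\<lambda>z. 1 - fst z powr s * t powr (- s))" using A(1) by simp
    show "AE z in \<mu>. 1 - fst z powr s * t powr (- s) \<le> f ((t + c z) / fst z)"
      using A_pos
    proof eventually_elim
      case (elim z)
      define y where "y = (t + c z) / fst z"
      have y: "y > 0" using elim t c_nonneg[of z] by (auto simp: y_def intro!: divide_pos_pos add_pos_nonneg)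
      have yt: "t / fst z \<le> y" using elim c_nonneg[of z] by (auto simp: y_def intro!: divide_right_mono)
      have "y powr (- s) \<le> (t / fst z) powr (- s)"
        using elim t s yt by (intro powr_mono2') auto
      also have "\<dots> = fst z powr s * t powr (- s)"
        using elim t by (simp add: powr_divide powr_minus field_simps)
      finally have le: "y powr (- s) \<le> fst z powr s * t powr (- s)" .
      have "1 - y powr (- s) \<le> f y"
      proof (cases "1 \<le> y")
        case True
        then show ?thesis using f by (simp add: cap_cdf_def)
      next
        case False
        then have "1 powr (- s) \<le> y powr (- s)" using y s by (intro powr_mono2') auto
        then show ?thesis using f01(1)[of y] by simp
      qed
      then show ?case using le by (simp add: y_def)
    qed
  qed (rule fi)
  finally show "1 - t powr (- s) \<le> cap_step c f t" using t by (simp add: cap_step_def)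
qed

lemma cap_step_right_cont:
  assumes f: "cap_cdf s f" and rc: "\<And>a. (f \<longlongrightarrow> f a) (at_right a)"
  shows "(cap_step c f \<longlongrightarrow> cap_step c f a) (at_right a)"
proof (cases "a < 1")
  case True
  have "eventually (\<lambda>t. cap_step c f t = 0) (at_right a)"
    unfolding eventually_at_right_field using True by (auto simp: cap_step_def)
  then show ?thesis using True by (simp add: cap_step_def tendsto_eventually)
next
  case False
  have [measurable]: "f \<in> borel_measurable borel"
    using f by (intro borel_measurable_mono) (simp add: cap_cdf_def)
  have "((\<lambda>t. \<integral>z. f ((t + c z) / fst z) \<partial>\<mu>) \<longlongrightarrow> (\<integral>z. f ((a + c z) / fst z) \<partial>\<mu>)) (at_right a)"
  proof (rule tendsto_at_right_sequentially[of a "a + 1"])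
    fix S :: "nat \<Rightarrow> real" assume S: "\<And>n. a < S n" "S \<longlonglongrightarrow> a"
    show "(\<lambda>n. \<integral>z. f ((S n + c z) / fst z) \<partial>\<mu>) \<longlonglongrightarrow> (\<integral>z. f ((a + c z) / fst z) \<partial>\<mu>)"
    proof (rule integral_dominated_convergence[where w = "\<lambda>_. 1"])
      show "AE z in \<mu>. (\<lambda>n. f ((S n + c z) / fst z)) \<longlonglongrightarrow> f ((a + c z) / fst z)"
        using A_pos
      proof eventually_elim
        case (elim z)
        have "(\<lambda>n. (S n + c z) / fst z) \<longlonglongrightarrow> (a + c z) / fst z"
          using elim by (intro tendsto_intros S) auto
        moreover have "(a + c z) / fst z < (S n + c z) / fst z" for n
          using S(1)[of n] elim by (intro divide_strict_right_mono) auto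
        ultimately have "filterlim (\<lambda>n. (S n + c z) / fst z) (at_right ((a + c z) / fst z)) sequentially"
          by (intro tendsto_imp_filterlim_at_right) auto
        then show ?case by (rule filterlim_compose[OF rc])
      qed
      show "AE z in \<mu>. norm (f ((S n + c z) / fst z)) \<le> 1" for n using f by (auto simp: cap_cdf_def)
    qed auto
  qed simp
  moreover have "eventually (\<lambda>t. (\<integral>z. f ((t + c z) / fst z) \<partial>\<mu>) = cap_step c f t) (at_right a)"
    unfolding eventually_at_right_field using False by (auto simp: cap_step_def intro!: exI[of _ "a + 1"])
  ultimately show ?thesis using False by (auto simp: cap_step_def elim: Lim_transform_eventually)
qed

lemma cap_fixpoint:
  obtains F where "cap_cdf s F" "\<And>a. (F \<longlongrightarrow> F a) (at_right a)" "cap_step c F = F"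
proof -
  define f where "f n = (cap_step c ^^ n) (indicator {1..})" for n
  have f_Suc: "f (Suc n) = cap_step c (f n)" for n by (simp add: f_def)
  have cdf: "cap_cdf s (f n)" for n
  proof (induction n)
    case 0
    show ?case unfolding f_def cap_cdf_def by (auto simp: mono_def indicator_def)
  next
    case (Suc n)
    then show ?case by (simp add: f_Suc cap_step_cdf)
  qed
  have rc: "(f n \<longlongrightarrow> f n a) (at_right a)" for n a
  proof (induction n arbitrary: a)
    case 0
    have "eventually (\<lambda>t. indicator {1..} t = (indicator {1..} a :: real)) (at_right a)"
      unfolding eventually_at_right_field by (rule exI[of _ "if a < 1 then 1 else a + 1"]) auto
    then show ?case by (simp add: f_def tendsto_eventually)
  next
    case (Suc n)
    show ?case unfolding f_Suc by (rule cap_step_right_cont[OF cdf Suc])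
  qed
  have dec: "f (Suc n) t \<le> f n t" for n t
  proof (induction n arbitrary: t)
    case 0
    have "f (Suc 0) t \<le> 1" "t < 1 \<Longrightarrow> f (Suc 0) t = 0" using cdf[of "Suc 0"] by (auto simp: cap_cdf_def)
    then show ?case by (cases "t < 1") (auto simp: f_def)
  next
    case (Suc n)
    show ?case unfolding f_Suc[of "Suc n"] f_Suc[of n]
      by (rule cap_step_mono) (use Suc cdf cdf[of "Suc n"] in \<open>auto simp: f_Suc\<close>)
  qed
  define F where "F t = (INF n. f n t)" for t
  have f01: "0 \<le> f n t" "f n t \<le> 1" for n t using cdf[of n] by (auto simp: cap_cdf_def)
  have bdd: "bdd_below (range (\<lambda>n. f n t))" for t using f01 by (auto intro!: bdd_belowI[of _ 0])
  have lim: "(\<lambda>n. f n t) \<longlonglongrightarrow> F t" for t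
    unfolding F_def using dec by (intro LIMSEQ_decseq_INF bdd) (auto intro!: decseq_SucI)
  have Fle: "F t \<le> f n t" for n t unfolding F_def by (rule cINF_lower[OF bdd]) simp
  have Fmono: "mono F"
  proof (rule monoI)
    fix t u :: real assume "t \<le> u"
    then have "f n t \<le> f n u" for n using cdf[of n] by (auto simp: cap_cdf_def dest: monoD)
    then show "F t \<le> F u" by (intro LIMSEQ_le[OF lim lim]) auto
  qed
  have Fcdf: "cap_cdf s F"
    unfolding cap_cdf_def
  proof (intro conjI allI impI Fmono)
    show "0 \<le> F t" for t unfolding F_def using f01 by (intro cINF_greatest) auto
    show "F t \<le> 1" for t using Fle[of t 0] f01[of 0 t] by simp
    show "F t = 0" if "t < 1" for t
      using cdf that unfolding F_def cap_cdf_def by simp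
    show "1 - t powr (- s) \<le> F t" if "1 \<le> t" for t
      unfolding F_def using cdf that by (intro cINF_greatest) (auto simp: cap_cdf_def)
  qed
  have Frc: "(F \<longlongrightarrow> F a) (at_right a)" for a
  proof (rule order_tendstoI)
    fix y assume "y < F a"
    then show "eventually (\<lambda>t. y < F t) (at_right a)"
      unfolding eventually_at_right_field
      by (intro exI[of _ "a + 1"]) (auto intro: less_le_trans dest: monoD[OF Fmono] less_imp_le)
  next
    \<comment> \<open>Right continuity survives the infimum because the sequence decreases: one
      iterate below y at a stays below y slightly to the right, and F lies under it.\<close>
    fix y assume "F a < y"
    then obtain n where "f n a < y"
      using eventually_happens'[OF sequentially_bot order_tendstoD(2)[OF lim]] by blast
    then have "eventually (\<lambda>t. f n t < y) (at_right a)" by (rule order_tendstoD(2)[OF rc])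
    then show "eventually (\<lambda>t. F t < y) (at_right a)"
      by eventually_elim (use Fle le_less_trans in blast)
  qed
  have [measurable]: "f n \<in> borel_measurable borel" "F \<in> borel_measurable borel" for n
    using cdf Fmono by (auto intro!: borel_measurable_mono simp: cap_cdf_def)
  have "cap_step c F = F"
  proof
    fix t
    show "cap_step c F t = F t"
    proof (cases "t < 1")
      case True
      then show ?thesis using Fcdf by (simp add: cap_step_def cap_cdf_def)
    next
      case False
      have "(\<lambda>n. \<integral>z. f n ((t + c z) / fst z) \<partial>\<mu>) \<longlonglongrightarrow> (\<integral>z. F ((t + c z) / fst z) \<partial>\<mu>)"
        by (rule integral_dominated_convergence[where w = "\<lambda>_. 1"]) (use lim f01 in auto)
      then have "(\<lambda>n. f (Suc n) t) \<longlonglongrightarrow> cap_step c F t" using False by (simp add: f_Suc cap_step_def)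
      with LIMSEQ_Suc[OF lim] show ?thesis by (rule LIMSEQ_unique[rotated])
    qed
  qed
  with Fcdf Frc show ?thesis by (rule that)
qed

text \<open>Stationarity is checked on distribution functions. For t at least 1 the capped value is
  at most t exactly when x is at most \<open>(t + c z) / fst z\<close>, which is the fixed-point
  equation of \<open>cap_step\<close>.\<close>

lemma capped_law_exists:
  obtains \<kappa> :: "real measure" where "real_distribution \<kappa>"
    "\<kappa> = distr (\<mu> \<Otimes>\<^sub>M \<kappa>) borel (\<lambda>(z, x). max (fst z * x - c z) 1)"
proof -
  obtain F where F: "cap_cdf s F" "\<And>a. (F \<longlongrightarrow> F a) (at_right a)" "cap_step c F = F"
    using cap_fixpoint by blast
  have F01: "0 \<le> F t" "F t \<le> 1" for t using F(1) by (auto simp: cap_cdf_def)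
  have Fm: "F x \<le> F y" if "x \<le> y" for x y using F(1) that by (auto simp: cap_cdf_def dest: monoD)
  have Fr: "continuous (at_right a) F" for a using F(2) by (simp add: continuous_within)
  have Fbot: "(F \<longlongrightarrow> 0) at_bot"
    by (rule tendsto_eventually, rule eventually_mono[OF eventually_gt_at_bot[of 1]])
      (use F(1) in \<open>auto simp: cap_cdf_def\<close>)
  have Ftop: "(F \<longlongrightarrow> 1) at_top"
  proof (rule tendsto_sandwich[OF _ _ _ tendsto_const])
    show "eventually (\<lambda>t. 1 - t powr (- s) \<le> F t) at_top"
      using eventually_ge_at_top[of 1] by eventually_elim (use F(1) in \<open>auto simp: cap_cdf_def\<close>)
    show "eventually (\<lambda>t. F t \<le> 1) at_top" using F01 by simp
    have "((\<lambda>t::real. t powr (- s)) \<longlongrightarrow> 0) at_top"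
      using s by (intro tendsto_neg_powr filterlim_ident) auto
    from tendsto_diff[OF tendsto_const[of 1] this]
    show "((\<lambda>t::real. 1 - t powr (- s)) \<longlongrightarrow> 1) at_top" by simp
  qed
  define \<kappa> where "\<kappa> = interval_measure F"
  have rd: "real_distribution \<kappa>"
    unfolding \<kappa>_def by (rule real_distribution_interval_measure[OF Fm Fr Fbot Ftop])
  have cdf: "measure \<kappa> {..t} = F t" for t
    using cdf_interval_measure[OF Fm Fr Fbot] by (simp add: \<kappa>_def cdf_def fun_eq_iff)
  interpret K: real_distribution \<kappa> by (rule rd)
  interpret KP: pair_prob_space \<mu> \<kappa> ..
  define T where "T = (\<lambda>(z :: real \<times> real, x). max (fst z * x - c z) 1)"
  have Tm [measurable]: "T \<in> borel_measurable (\<mu> \<Otimes>\<^sub>M \<kappa>)" unfolding T_def by measurable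
  have rd2: "real_distribution (distr (\<mu> \<Otimes>\<^sub>M \<kappa>) borel T)"
    by (rule KP.P.real_distribution_distr) measurable
  have "cdf (distr (\<mu> \<Otimes>\<^sub>M \<kappa>) borel T) t = cdf \<kappa> t" for t
  proof -
    have "cdf (distr (\<mu> \<Otimes>\<^sub>M \<kappa>) borel T) t = (\<integral>w. indicator {..t} (T w) \<partial>(\<mu> \<Otimes>\<^sub>M \<kappa>))"
      unfolding cdf_def by (subst integral_distr[symmetric, where N = borel]) auto
    also have "\<dots> = (\<integral>z. (\<integral>x. indicator {..t} (T (z, x)) \<partial>\<kappa>) \<partial>\<mu>)"
    proof (rule KP.integral_fst'[symmetric])
      show "integrable (\<mu> \<Otimes>\<^sub>M \<kappa>) (\<lambda>w. indicator {..t} (T w) :: real)"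
        by (rule KP.P.integrable_const_bound[of _ 1]) auto
    qed
    also have "\<dots> = cap_step c F t"
    proof (cases "t < 1")
      case True
      then have "indicator {..t} (T (z, x)) = (0 :: real)" for z x by (auto simp: T_def)
      then show ?thesis using True by (simp add: cap_step_def)
    next
      case False
      have "(\<integral>z. (\<integral>x. indicator {..t} (T (z, x)) \<partial>\<kappa>) \<partial>\<mu>) = (\<integral>z. F ((t + c z) / fst z) \<partial>\<mu>)"
      proof (rule integral_cong_AE)
        have "F \<in> borel_measurable borel" by (rule borel_measurable_mono) (use Fm in \<open>auto intro: monoI\<close>)
        then show "(\<lambda>z. F ((t + c z) / fst z)) \<in> borel_measurable \<mu>" by measurable
        show "AE z in \<mu>. (\<integral>x. indicator {..t} (T (z, x)) \<partial>\<kappa>) = F ((t + c z) / fst z)"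
          using A_pos
        proof eventually_elim
          case (elim z)
          then have "indicator {..t} (T (z, x)) = (indicator {..(t + c z) / fst z} x :: real)" for x
            using False by (auto simp: T_def indicator_def field_simps)
          then show ?case by (simp add: cdf)
        qed
      qed measurable
      then show ?thesis using False by (simp add: cap_step_def)
    qed
    also have "\<dots> = cdf \<kappa> t" by (simp add: F(3) cdf_def cdf)
    finally show ?thesis .
  qed
  then have "cdf (distr (\<mu> \<Otimes>\<^sub>M \<kappa>) borel T) = cdf \<kappa>" by blast
  then have "\<kappa> = distr (\<mu> \<Otimes>\<^sub>M \<kappa>) borel T" using cdf_unique[OF rd2 rd] by simp
  then show ?thesis using rd that unfolding T_def by blast
qed

end

end

lemma powr_abs_add_one_integrable:
  fixes b :: "'a \<Rightarrow> real"
  assumes "finite_measure M" and [measurable]: "b \<in> borel_measurable M" and b: "\<And>z. b z \<ge> 0"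
    and bi: "integrable M (\<lambda>z. b z powr \<alpha>)" and "\<alpha> > 0"
  shows "integrable M (\<lambda>z. (b z + 1) powr \<alpha>)"
proof -
  interpret finite_measure M by fact
  obtain C where C: "\<And>x y. x \<ge> 0 \<Longrightarrow> y \<ge> 0 \<Longrightarrow> (x + y) powr \<alpha> \<le> 2 * x powr \<alpha> + C * y powr \<alpha>" "C \<ge> 0"
    using powr_add_le_eps[OF \<open>\<alpha> > 0\<close>, of 2] by (metis one_less_numeral_iff semiring_norm(76))
  show ?thesis
  proof (rule Bochner_Integration.integrable_bound)
    show "integrable M (\<lambda>z. 2 * b z powr \<alpha> + C)" using bi by simp
    show "AE z in M. norm ((b z + 1) powr \<alpha>) \<le> norm (2 * b z powr \<alpha> + C)"
      using C(1)[OF b, of 1] C(2) by (intro always_eventually) (auto intro: order_trans[OF _ abs_ge_self])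
  qed measurable
qed

section \<open>Uniform lower bound for the tail constant of the capped recursion\<close>

locale letac_pair = cramer_pair +
  assumes B_moment: "integrable \<mu> (\<lambda>z. \<bar>snd z\<bar> powr \<alpha>)"
begin

text \<open>A pessimistic Letac step measured in units of \<open>1 / \<epsilon>\<close>: B is
  replaced by its worst value \<open>- \<bar>snd z\<bar>\<close>, which makes comparison from below
  possible whatever the sign of B.\<close>

definition cap :: "real \<Rightarrow> real \<times> real \<Rightarrow> real \<Rightarrow> real" where
  "cap \<epsilon> z x = max (fst z * x - \<epsilon> * \<bar>snd z\<bar>) 1"

text \<open>An upper bound for the mean of |max(A Q - eps |B|, 0)^alpha - (A Q)^alpha|, read off
  from the two estimates for differences of powers. The factor
  \<open>1 / (1 - A_moment (\<alpha> - 1))\<close> stands for a bound on E Q^(alpha - 1) uniform in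
  eps.\<close>

definition cap_error :: "real \<Rightarrow> real" where
  "cap_error \<epsilon> = (if \<alpha> \<le> 1 then \<epsilon> powr \<alpha> * (\<integral>z. \<bar>snd z\<bar> powr \<alpha> \<partial>\<mu>)
     else \<epsilon> * (\<alpha> * 2 powr \<alpha> * ((\<integral>z. \<bar>snd z\<bar> * fst z powr (\<alpha> - 1) \<partial>\<mu>) * (1 / (1 - A_moment (\<alpha> - 1)))
       + (\<integral>z. \<bar>snd z\<bar> powr \<alpha> \<partial>\<mu>))))"

lemma cap_error_tendsto: "(cap_error \<longlongrightarrow> 0) (at_right 0)"
proof (cases "\<alpha> \<le> 1")
  case True
  have "((\<lambda>e. e powr \<alpha> * (\<integral>z. \<bar>snd z\<bar> powr \<alpha> \<partial>\<mu>)) \<longlongrightarrow> 0 powr \<alpha> * (\<integral>z. \<bar>snd z\<bar> powr \<alpha> \<partial>\<mu>)) (at_right 0)"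
    using alpha_pos by (intro tendsto_intros tendsto_powr') (auto intro!: eventually_at_right_less[THEN eventually_mono])
  then show ?thesis using True by (simp add: cap_error_def[abs_def])
next
  case False
  have "((\<lambda>e. e * c) \<longlongrightarrow> 0 * c) (at_right 0)" for c :: real by (intro tendsto_intros)
  then show ?thesis using False by (simp add: cap_error_def[abs_def])
qed

lemma perturbed_cap:
  assumes \<epsilon>: "0 < \<epsilon>" and K: "real_distribution \<kappa>"
    and st: "\<kappa> = distr (\<mu> \<Otimes>\<^sub>M \<kappa>) borel (\<lambda>(z, x). cap \<epsilon> z x)"
  shows "perturbed_recursion \<mu> \<alpha> \<kappa> (cap \<epsilon>) (\<lambda>z. \<epsilon> * \<bar>snd z\<bar> + 1)"
proof (intro perturbed_recursion.intro perturbed_recursion_axioms.intro cramer_pair_axioms st)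
  interpret K: real_distribution \<kappa> by (rule K)
  show "prob_space \<kappa>" by (rule K.prob_space_axioms)
  show "sets \<kappa> = sets borel" by simp
  show "(\<lambda>(z, x). cap \<epsilon> z x) \<in> borel_measurable (borel \<Otimes>\<^sub>M borel)"
    unfolding borel_prod cap_def case_prod_unfold by (intro borel_measurable_continuous_onI continuous_intros)
  show "(\<lambda>z :: real \<times> real. \<epsilon> * \<bar>snd z\<bar> + 1) \<in> borel_measurable borel"
    by (intro borel_measurable_continuous_onI continuous_intros)
  show "0 \<le> cap \<epsilon> z x" for z x by (simp add: cap_def)
  show "0 \<le> \<epsilon> * \<bar>snd z\<bar> + 1" for z :: "real \<times> real" using \<epsilon> by simp
  show "\<bar>cap \<epsilon> z x - fst z * x\<bar> \<le> \<epsilon> * \<bar>snd z\<bar> + 1" if "0 < fst z" "0 \<le> x" for z x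
  proof -
    have "0 \<le> fst z * x" "0 \<le> \<epsilon> * \<bar>snd z\<bar>" using that \<epsilon> by auto
    then show ?thesis unfolding cap_def by linarith
  qed
  have "integrable \<mu> (\<lambda>z. \<epsilon> powr \<alpha> * \<bar>snd z\<bar> powr \<alpha>)" using B_moment by simp
  then show "integrable \<mu> (\<lambda>z. (\<epsilon> * \<bar>snd z\<bar> + 1) powr \<alpha>)"
    using \<epsilon> alpha_pos finite_measure_axioms by (intro powr_abs_add_one_integrable) (auto simp: powr_mult)
qed

context
  fixes \<epsilon> :: real and \<kappa> :: "real measure"
  assumes \<epsilon>: "0 < \<epsilon>" "\<epsilon> \<le> 1" and K: "real_distribution \<kappa>"
    and st: "\<kappa> = distr (\<mu> \<Otimes>\<^sub>M \<kappa>) borel (\<lambda>(z, x). cap \<epsilon> z x)"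
begin

text \<open>Since \<open>E Q\<^sup>s \<le> E (A Q)\<^sup>s + E (1 - min 1 (A Q)\<^sup>s)\<close>, the last expectation is bounded below
  independently of \<open>\<epsilon>\<close>.\<close>

lemma cap_moments:
  assumes s: "0 < s" "s < \<alpha>"
  defines "p \<equiv> (\<integral>w. 1 - min 1 (fst (fst w) * snd w) powr s \<partial>(\<mu> \<Otimes>\<^sub>M \<kappa>))"
  shows "integrable (\<mu> \<Otimes>\<^sub>M \<kappa>) (\<lambda>w. 1 - min 1 (fst (fst w) * snd w) powr s)"
    and "1 - A_moment s \<le> p" and "(\<integral>x. x powr s \<partial>\<kappa>) \<le> 1 / (1 - A_moment s)"
proof -
  interpret C: perturbed_recursion \<mu> \<alpha> \<kappa> "cap \<epsilon>" "\<lambda>z. \<epsilon> * \<bar>snd z\<bar> + 1"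
    by (rule perturbed_cap[OF \<epsilon>(1) K st])
  note A = A_moment_facts[OF s]
  note Qi = C.moment_integrable[OF s]
  show int: "integrable (\<mu> \<Otimes>\<^sub>M \<kappa>) (\<lambda>w. 1 - min 1 (fst (fst w) * snd w) powr s)"
  proof (rule C.P.P.integrable_const_bound[of _ 1])
    show "AE w in \<mu> \<Otimes>\<^sub>M \<kappa>. norm (1 - min 1 (fst (fst w) * snd w) powr s) \<le> 1"
      using C.AE_pair
    proof eventually_elim
      case (elim w)
      then have "min 1 (fst (fst w) * snd w) powr s \<le> 1" using s by (intro powr_le1) auto
      then show ?case by simp
    qed
  qed measurable
  have p1: "p \<le> 1"
  proof -
    have "p \<le> (\<integral>w. 1 \<partial>(\<mu> \<Otimes>\<^sub>M \<kappa>))" unfolding p_def using int by (intro integral_mono) auto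
    then show ?thesis using C.P.P.prob_space by simp
  qed
  define m where "m = (\<integral>x. x powr s \<partial>\<kappa>)"
  have AQ: "integrable (\<mu> \<Otimes>\<^sub>M \<kappa>) (\<lambda>(z, x). fst z powr s * x powr s)"
    using A(1) Qi by (rule C.prod_integrable)
  have Ti: "integrable (\<mu> \<Otimes>\<^sub>M \<kappa>) (\<lambda>(z, x). cap \<epsilon> z x powr s)"
  proof -
    have "integrable (distr (\<mu> \<Otimes>\<^sub>M \<kappa>) borel (\<lambda>(z, x). cap \<epsilon> z x)) (\<lambda>x. x powr s)"
      using Qi by (subst st[symmetric])
    then show ?thesis by (subst (asm) integrable_distr_eq) (auto simp: case_prod_unfold)
  qed
  have mT: "m = (\<integral>(z, x). cap \<epsilon> z x powr s \<partial>(\<mu> \<Otimes>\<^sub>M \<kappa>))"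
    unfolding m_def by (rule C.stationary_integral) measurable
  also have "\<dots> \<le> (\<integral>w. (case w of (z, x) \<Rightarrow> fst z powr s * x powr s) + (1 - min 1 (fst (fst w) * snd w) powr s) \<partial>(\<mu> \<Otimes>\<^sub>M \<kappa>))"
  proof (rule integral_mono_AE)
    show "AE w in \<mu> \<Otimes>\<^sub>M \<kappa>. (case w of (z, x) \<Rightarrow> cap \<epsilon> z x powr s)
      \<le> (case w of (z, x) \<Rightarrow> fst z powr s * x powr s) + (1 - min 1 (fst (fst w) * snd w) powr s)"
      using C.AE_pair
    proof eventually_elim
      case (elim w)
      obtain z x where w: "w = (z, x)" by (cases w)
      define y where "y = fst z * x"
      have p: "fst z > 0" "x \<ge> 0" using elim w by auto
      have y: "y \<ge> 0" "fst z powr s * x powr s = y powr s" using p by (auto simp: y_def powr_mult)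
      have e: "0 \<le> \<epsilon> * \<bar>snd z\<bar>" using \<epsilon> by simp
      \<comment> \<open>The right-hand side is the power s of max(y, 1), and the subtracted term can
        only lower the capped value.\<close>
      have "cap \<epsilon> z x powr s \<le> y powr s + (1 - min 1 y powr s)"
      proof (cases "y \<le> 1")
        case True
        then have "cap \<epsilon> z x = 1" using e by (simp add: cap_def y_def)
        then show ?thesis using True by (simp add: min_def)
      next
        case False
        then have "cap \<epsilon> z x \<le> y" "0 \<le> cap \<epsilon> z x" using e by (auto simp: cap_def y_def)
        then show ?thesis using False s by (simp add: min_def powr_mono2)
      qed
      then show ?case unfolding w by (simp add: y y_def[symmetric])
    qed
  qed (use Ti AQ int in auto)
  also have "\<dots> = A_moment s * m + p"
    using AQ int C.prod_integrable(2)[OF A(1) Qi]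
    by (subst Bochner_Integration.integral_add) (auto simp: p_def A_moment_def m_def)
  finally have mp: "(1 - A_moment s) * m \<le> p" by (simp add: algebra_simps)
  \<comment> \<open>The cap keeps Q at least 1, hence m at least 1. This turns the inequality
    between m and p into a lower bound for p; the opposite conclusion, an upper bound for m, uses p
    at most 1.\<close>
  have "(\<integral>w. 1 \<partial>(\<mu> \<Otimes>\<^sub>M \<kappa>)) \<le> m"
    unfolding mT
  proof (rule integral_mono[OF _ Ti])
    show "1 \<le> (case w of (z, x) \<Rightarrow> cap \<epsilon> z x powr s)" for w :: "(real \<times> real) \<times> real"
      using s by (cases w) (auto simp: cap_def intro!: ge_one_powr_ge_zero)
  qed simp
  then have m1: "1 \<le> m" using C.P.P.prob_space by simp
  have "(1 - A_moment s) * 1 \<le> (1 - A_moment s) * m"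
    using A(3) m1 by (intro mult_left_mono) auto
  then show "1 - A_moment s \<le> p" using mp by simp
  show "(\<integral>x. x powr s \<partial>\<kappa>) \<le> 1 / (1 - A_moment s)"
    using mp p1 A(3) by (simp add: m_def[symmetric] field_simps)
qed

text \<open>Where y = A Q is at most 1 the capped value is 1, and the gain
  \<open>1 - y powr \<alpha>\<close> is at least \<open>1 - y powr (\<alpha> / 2)\<close>. Elsewhere
  the loss is at most that caused by \<open>\<epsilon> * \<bar>snd z\<bar>\<close>. The smaller
  exponent is taken because the mean gain is then at least
  \<open>1 - A_moment (\<alpha> / 2)\<close>, a positive number free of
  \<open>\<epsilon>\<close>.\<close>

lemma cap_constant_lower:
  "1 - A_moment (\<alpha> / 2) - cap_error \<epsilon>
    \<le> (\<integral>(z, x). cap \<epsilon> z x powr \<alpha> - (fst z * x) powr \<alpha> \<partial>(\<mu> \<Otimes>\<^sub>M \<kappa>))"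
proof -
  interpret C: perturbed_recursion \<mu> \<alpha> \<kappa> "cap \<epsilon>" "\<lambda>z. \<epsilon> * \<bar>snd z\<bar> + 1"
    by (rule perturbed_cap[OF \<epsilon>(1) K st])
  define s where "s = \<alpha> / 2"
  have s: "0 < s" "s < \<alpha>" using alpha_pos by (auto simp: s_def)
  define b where "b = (\<integral>z. \<bar>snd z\<bar> powr \<alpha> \<partial>\<mu>)"
  have b0: "b \<ge> 0" unfolding b_def by (intro integral_nonneg_AE) auto
  have "\<exists>E. integrable (\<mu> \<Otimes>\<^sub>M \<kappa>) E \<and> (\<integral>w. E w \<partial>(\<mu> \<Otimes>\<^sub>M \<kappa>)) \<le> cap_error \<epsilon> \<and>
    (AE w in \<mu> \<Otimes>\<^sub>M \<kappa>. \<bar>max (fst (fst w) * snd w - \<epsilon> * \<bar>snd (fst w)\<bar>) 0 powr \<alpha> - (fst (fst w) * snd w) powr \<alpha>\<bar> \<le> E w)"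
  proof (cases "\<alpha> \<le> 1")
    case True
    define E where "E = (\<lambda>(z :: real \<times> real, x :: real). (\<epsilon> powr \<alpha> * \<bar>snd z\<bar> powr \<alpha>) * 1)"
    have "integrable \<mu> (\<lambda>z. \<epsilon> powr \<alpha> * \<bar>snd z\<bar> powr \<alpha>)" using B_moment by simp
    note i = C.prod_integrable[OF this, of "\<lambda>_. 1"]
    have "integrable (\<mu> \<Otimes>\<^sub>M \<kappa>) E" unfolding E_def by (rule i) simp
    moreover have "(\<integral>w. E w \<partial>(\<mu> \<Otimes>\<^sub>M \<kappa>)) \<le> cap_error \<epsilon>"
      unfolding E_def using i(2) True by (simp add: cap_error_def C.P.M2.prob_space)
    moreover have "AE w in \<mu> \<Otimes>\<^sub>M \<kappa>. \<bar>max (fst (fst w) * snd w - \<epsilon> * \<bar>snd (fst w)\<bar>) 0 powr \<alpha> - (fst (fst w) * snd w) powr \<alpha>\<bar> \<le> E w"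
      using C.AE_pair
    proof eventually_elim
      case (elim w)
      have "0 \<le> fst (fst w) * snd w" "0 \<le> \<epsilon> * \<bar>snd (fst w)\<bar>" using elim \<epsilon> by auto
      then have "\<bar>max (fst (fst w) * snd w - \<epsilon> * \<bar>snd (fst w)\<bar>) 0 powr \<alpha> - (fst (fst w) * snd w) powr \<alpha>\<bar>
        \<le> (\<epsilon> * \<bar>snd (fst w)\<bar>) powr \<alpha>"
        by (intro powr_diff_le_small alpha_pos True) auto
      then show ?case using \<epsilon> by (cases w) (simp add: E_def powr_mult)
    qed
    ultimately show ?thesis by blast
  next
    case False
    then have \<alpha>: "1 < \<alpha>" by simp
    have s1: "0 < \<alpha> - 1" "\<alpha> - 1 < \<alpha>" using \<alpha> by auto
    define x where "x = (\<integral>z. \<bar>snd z\<bar> * fst z powr (\<alpha> - 1) \<partial>\<mu>)"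
    have x0: "x \<ge> 0" unfolding x_def by (intro integral_nonneg_AE) auto
    have cross: "integrable \<mu> (\<lambda>z. \<bar>snd z\<bar> * fst z powr (\<alpha> - 1))"
      using B_moment \<alpha> by (intro cross_moment_integrable borel_measurable_continuous_onI continuous_intros) auto
    have "integrable \<mu> (\<lambda>z. \<epsilon> * (\<bar>snd z\<bar> * fst z powr (\<alpha> - 1)))" using cross by simp
    note i1 = C.prod_integrable[OF this C.moment_integrable[OF s1]]
    have "integrable \<mu> (\<lambda>z. \<epsilon> powr \<alpha> * \<bar>snd z\<bar> powr \<alpha>)" using B_moment by simp
    note i2 = C.prod_integrable[OF this, of "\<lambda>_. 1"]
    define E where "E w = \<alpha> * 2 powr \<alpha> * ((case w of (z, x) \<Rightarrow> \<epsilon> * (\<bar>snd z\<bar> * fst z powr (\<alpha> - 1)) * x powr (\<alpha> - 1))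
        + (case w of (z, x) \<Rightarrow> (\<epsilon> powr \<alpha> * \<bar>snd z\<bar> powr \<alpha>) * 1))" for w :: "(real \<times> real) \<times> real"
    have "integrable (\<mu> \<Otimes>\<^sub>M \<kappa>) E"
      unfolding E_def[abs_def] using i1(1) i2(1) by (intro integrable_mult_right Bochner_Integration.integrable_add) auto
    moreover have "(\<integral>w. E w \<partial>(\<mu> \<Otimes>\<^sub>M \<kappa>)) \<le> cap_error \<epsilon>"
    proof -
      define m where "m = (\<integral>x. x powr (\<alpha> - 1) \<partial>\<kappa>)"
      have "(\<integral>w. E w \<partial>(\<mu> \<Otimes>\<^sub>M \<kappa>)) = \<alpha> * 2 powr \<alpha> * (\<epsilon> * x * m + \<epsilon> powr \<alpha> * b)"
        unfolding E_def integral_mult_right_zero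
        using i1 i2 by (subst Bochner_Integration.integral_add) (auto simp: m_def b_def x_def C.P.M2.prob_space)
      also have "\<dots> \<le> \<alpha> * 2 powr \<alpha> * (\<epsilon> * x * (1 / (1 - A_moment (\<alpha> - 1))) + \<epsilon> * b)"
      proof -
        \<comment> \<open>As \<open>\<epsilon> \<le> 1\<close> and \<open>1 < \<alpha>\<close>, both
          parts of the error become linear in \<open>\<epsilon>\<close>.\<close>
        have "\<epsilon> powr \<alpha> \<le> \<epsilon> powr 1" using \<epsilon> \<alpha> by (intro powr_mono') auto
        then have "\<epsilon> powr \<alpha> * b \<le> \<epsilon> * b" using b0 \<epsilon> by (intro mult_right_mono) auto
        moreover have "\<epsilon> * x * m \<le> \<epsilon> * x * (1 / (1 - A_moment (\<alpha> - 1)))"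
          unfolding m_def using cap_moments(3)[OF s1] x0 \<epsilon> by (intro mult_left_mono) auto
        ultimately show ?thesis using \<alpha> by (intro mult_left_mono) auto
      qed
      also have "\<dots> = cap_error \<epsilon>"
        using False by (simp add: cap_error_def x_def b_def algebra_simps)
      finally show ?thesis .
    qed
    moreover have "AE w in \<mu> \<Otimes>\<^sub>M \<kappa>. \<bar>max (fst (fst w) * snd w - \<epsilon> * \<bar>snd (fst w)\<bar>) 0 powr \<alpha> - (fst (fst w) * snd w) powr \<alpha>\<bar> \<le> E w"
      using C.AE_pair
    proof eventually_elim
      case (elim w)
      obtain z x where w: "w = (z, x)" by (cases w)
      have p: "fst z > 0" "x \<ge> 0" using elim w by auto
      have "0 \<le> fst z * x" "0 \<le> \<epsilon> * \<bar>snd z\<bar>" using p \<epsilon> by auto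
      then have "\<bar>max (fst z * x - \<epsilon> * \<bar>snd z\<bar>) 0 powr \<alpha> - (fst z * x) powr \<alpha>\<bar>
        \<le> \<alpha> * 2 powr \<alpha> * ((\<epsilon> * \<bar>snd z\<bar>) * (fst z * x) powr (\<alpha> - 1) + (\<epsilon> * \<bar>snd z\<bar>) powr \<alpha>)"
        by (intro powr_diff_le_large \<alpha>) auto
      then show ?case using \<epsilon> p by (simp add: w E_def powr_mult mult.assoc)
    qed
    ultimately show ?thesis by blast
  qed
  then obtain E where E: "integrable (\<mu> \<Otimes>\<^sub>M \<kappa>) E" "(\<integral>w. E w \<partial>(\<mu> \<Otimes>\<^sub>M \<kappa>)) \<le> cap_error \<epsilon>"
    "AE w in \<mu> \<Otimes>\<^sub>M \<kappa>. \<bar>max (fst (fst w) * snd w - \<epsilon> * \<bar>snd (fst w)\<bar>) 0 powr \<alpha> - (fst (fst w) * snd w) powr \<alpha>\<bar> \<le> E w"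
    by blast
  note mom = cap_moments[OF s]
  have "1 - A_moment s - cap_error \<epsilon>
      \<le> (\<integral>w. (1 - min 1 (fst (fst w) * snd w) powr s) - E w \<partial>(\<mu> \<Otimes>\<^sub>M \<kappa>))"
    using mom(1,2) E(1,2) by simp
  also have "\<dots> \<le> (\<integral>(z, x). cap \<epsilon> z x powr \<alpha> - (fst z * x) powr \<alpha> \<partial>(\<mu> \<Otimes>\<^sub>M \<kappa>))"
  proof (rule integral_mono_AE)
    show "AE w in \<mu> \<Otimes>\<^sub>M \<kappa>. 1 - min 1 (fst (fst w) * snd w) powr s - E w
      \<le> (case w of (z, x) \<Rightarrow> cap \<epsilon> z x powr \<alpha> - (fst z * x) powr \<alpha>)"
      using C.AE_pair E(3)
    proof eventually_elim
      case (elim w)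
      obtain z x where w: "w = (z, x)" by (cases w)
      define y where "y = fst z * x"
      have p: "fst z > 0" "x \<ge> 0" using elim w by auto
      have y: "y \<ge> 0" using p by (auto simp: y_def)
      have e: "0 \<le> \<epsilon> * \<bar>snd z\<bar>" using \<epsilon> by simp
      have Ew: "\<bar>max (y - \<epsilon> * \<bar>snd z\<bar>) 0 powr \<alpha> - y powr \<alpha>\<bar> \<le> E w" using elim by (simp add: w y_def)
      have "1 - min 1 y powr s - E w \<le> cap \<epsilon> z x powr \<alpha> - y powr \<alpha>"
      proof (cases "y \<le> 1")
        case True
        then have "cap \<epsilon> z x = 1" using e by (simp add: cap_def y_def)
        moreover have "y powr \<alpha> \<le> y powr s" using True y s by (intro powr_mono') auto
        ultimately show ?thesis using True Ew by (simp add: min_def)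
      next
        case False
        have "max (y - \<epsilon> * \<bar>snd z\<bar>) 0 powr \<alpha> \<le> cap \<epsilon> z x powr \<alpha>"
          using alpha_pos by (intro powr_mono2) (auto simp: cap_def y_def)
        then show ?thesis using False Ew by (simp add: min_def)
      qed
      then show ?case by (simp add: w y_def)
    qed
    show "integrable (\<mu> \<Otimes>\<^sub>M \<kappa>) (\<lambda>w. 1 - min 1 (fst (fst w) * snd w) powr s - E w)" using mom(1) E(1) by simp
    show "integrable (\<mu> \<Otimes>\<^sub>M \<kappa>) (\<lambda>(z, x). cap \<epsilon> z x powr \<alpha> - (fst z * x) powr \<alpha>)" by (rule C.difference_integrable)
  qed
  finally show ?thesis by (simp add: s_def)
qed

end

lemma capped_law_positive_tail:
  obtains \<epsilon>\<^sub>0 where "\<epsilon>\<^sub>0 > 0"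
    "\<And>\<epsilon>. 0 < \<epsilon> \<Longrightarrow> \<epsilon> < \<epsilon>\<^sub>0 \<Longrightarrow> \<exists>\<kappa> C. real_distribution \<kappa> \<and> \<kappa> = distr (\<mu> \<Otimes>\<^sub>M \<kappa>) borel (\<lambda>(z, x). cap \<epsilon> z x)
       \<and> C > 0 \<and> ((\<lambda>t. measure \<kappa> {t<..} * t powr \<alpha>) \<longlongrightarrow> C) at_top"
proof -
  have s: "0 < \<alpha> / 2" "\<alpha> / 2 < \<alpha>" using alpha_pos by auto
  have "eventually (\<lambda>e. cap_error e < 1 - A_moment (\<alpha> / 2)) (at_right 0)"
    using cap_error_tendsto A_moment_facts(3)[OF s] by (intro order_tendstoD(2)) auto
  then obtain e0 where e0: "e0 > 0" "\<And>e. 0 < e \<Longrightarrow> e < e0 \<Longrightarrow> cap_error e < 1 - A_moment (\<alpha> / 2)"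
    unfolding eventually_at_right_field by blast
  show ?thesis
  proof (rule that[of "min e0 1"])
    show "min e0 1 > 0" using e0 by simp
    fix \<epsilon> :: real assume \<epsilon>: "0 < \<epsilon>" "\<epsilon> < min e0 1"
    have cm: "(\<lambda>z :: real \<times> real. \<epsilon> * \<bar>snd z\<bar>) \<in> borel_measurable borel"
      by (intro borel_measurable_continuous_onI continuous_intros)
    obtain \<kappa> where \<kappa>: "real_distribution \<kappa>" "\<kappa> = distr (\<mu> \<Otimes>\<^sub>M \<kappa>) borel (\<lambda>(z, x). cap \<epsilon> z x)"
    proof (rule capped_law_exists[OF cm _ s])
      show "0 \<le> \<epsilon> * \<bar>snd z\<bar>" for z :: "real \<times> real" using \<epsilon> by simp
    qed (rule that[unfolded cap_def])
    interpret C: perturbed_recursion \<mu> \<alpha> \<kappa> "cap \<epsilon>" "\<lambda>z. \<epsilon> * \<bar>snd z\<bar> + 1"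
      by (rule perturbed_cap[OF \<epsilon>(1) \<kappa>])
    have "0 < 1 - A_moment (\<alpha> / 2) - cap_error \<epsilon>" using e0(2)[of \<epsilon>] \<epsilon> by simp
    also have "\<dots> \<le> (\<integral>(z, x). cap \<epsilon> z x powr \<alpha> - (fst z * x) powr \<alpha> \<partial>(\<mu> \<Otimes>\<^sub>M \<kappa>))"
      using \<epsilon> by (intro cap_constant_lower \<kappa>) auto
    finally have "0 < (\<integral>(z, x). cap \<epsilon> z x powr \<alpha> - (fst z * x) powr \<alpha> \<partial>(\<mu> \<Otimes>\<^sub>M \<kappa>)) / (\<alpha> * W.mean)"
      using alpha_pos W.mean_pos by simp
    with \<kappa> C.tail_limit show "\<exists>\<kappa> C. real_distribution \<kappa> \<and> \<kappa> = distr (\<mu> \<Otimes>\<^sub>M \<kappa>) borel (\<lambda>(z, x). cap \<epsilon> z x)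
       \<and> C > 0 \<and> ((\<lambda>t. measure \<kappa> {t<..} * t powr \<alpha>) \<longlongrightarrow> C) at_top"
      by blast
  qed
qed

end

section \<open>The Letac recursion\<close>

lemma (in perturbed_recursion) tail_recursion:
  assumes [measurable]: "u \<in> borel_measurable borel"
    and u: "\<And>z x. fst z > 0 \<Longrightarrow> t < T z x \<longleftrightarrow> u z < x"
  shows "measure \<nu> {t<..} = (\<integral>z. measure \<nu> {u z<..} \<partial>\<mu>)"
proof -
  have ind: "(\<integral>x. indicator {a<..} x \<partial>\<nu>) = measure \<nu> {a<..}" for a :: real
    by (simp add: sets_eq_imp_space_eq[OF sets_nu])
  have "measure \<nu> {t<..} = (\<integral>(z, x). indicator {t<..} (T z x) \<partial>(\<mu> \<Otimes>\<^sub>M \<nu>))"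
    unfolding ind[symmetric] by (rule stationary_integral) measurable
  also have "\<dots> = (\<integral>z. (\<integral>x. indicator {t<..} (T z x) \<partial>\<nu>) \<partial>\<mu>)"
  proof (rule P.integral_fst[symmetric])
    show "integrable (\<mu> \<Otimes>\<^sub>M \<nu>) (\<lambda>(z, x). indicator {t<..} (T z x) :: real)"
      by (rule P.P.integrable_const_bound[of _ 1]) (auto simp: case_prod_unfold)
  qed
  also have "\<dots> = (\<integral>z. (\<integral>x. indicator {u z<..} x \<partial>\<nu>) \<partial>\<mu>)"
  proof (rule integral_cong_AE)
    show "AE z in \<mu>. (\<integral>x. indicator {t<..} (T z x) \<partial>\<nu>) = (\<integral>x. indicator {u z<..} x \<partial>\<nu>)"
      using A_pos by eventually_elim (use u in \<open>simp add: indicator_def\<close>)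
  qed (simp_all add: indicator_def)
  finally show ?thesis by (simp only: ind)
qed

section \<open>Comparison with the capped law, and bounded stationary solutions\<close>

context letac_pair
begin

context
  fixes \<nu> :: "real measure"
  assumes stat: "letac_stationary \<mu> \<nu>"
begin

lemma perturbed_letac:
  "perturbed_recursion \<mu> \<alpha> \<nu> (\<lambda>z x. max (fst z * x + snd z) 0) (\<lambda>z. \<bar>snd z\<bar>)"
proof (intro perturbed_recursion.intro perturbed_recursion_axioms.intro cramer_pair_axioms)
  show "prob_space \<nu>" "sets \<nu> = sets borel" using stat by (auto simp: letac_stationary_def)
  have "(\<lambda>((a, b), x). max (a * x + b) 0) = (\<lambda>(z, x). max (fst z * x + snd z) (0::real))" by auto
  then show "\<nu> = distr (\<mu> \<Otimes>\<^sub>M \<nu>) borel (\<lambda>(z, x). max (fst z * x + snd z) 0)"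
    using stat by (simp add: letac_stationary_def)
  show "(\<lambda>(z :: real \<times> real, x). max (fst z * x + snd z) 0) \<in> borel_measurable (borel \<Otimes>\<^sub>M borel)"
    unfolding borel_prod case_prod_unfold by (intro borel_measurable_continuous_onI continuous_intros)
  show "(\<lambda>z :: real \<times> real. \<bar>snd z\<bar>) \<in> borel_measurable borel"
    by (intro borel_measurable_continuous_onI continuous_intros)
  show "\<bar>max (fst z * x + snd z) 0 - fst z * x\<bar> \<le> \<bar>snd z\<bar>" if "0 < fst z" "0 \<le> x" for z :: "real \<times> real" and x
  proof -
    have "0 \<le> fst z * x" using that by simp
    then show ?thesis by linarith
  qed
qed (use B_moment in auto)

interpretation X: perturbed_recursion \<mu> \<alpha> \<nu> "\<lambda>z x. max (fst z * x + snd z) 0" "\<lambda>z. \<bar>snd z\<bar>"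
  by (rule perturbed_letac)

lemma letac_tail_recursion:
  assumes "t \<ge> 0"
  shows "measure \<nu> {t<..} = (\<integral>z. measure \<nu> {(t - snd z) / fst z<..} \<partial>\<mu>)"
proof (rule X.tail_recursion)
  show "(\<lambda>z :: real \<times> real. (t - snd z) / fst z) \<in> borel_measurable borel"
    unfolding borel_prod[symmetric] by measurable
  show "t < max (fst z * x + snd z) 0 \<longleftrightarrow> (t - snd z) / fst z < x" if "0 < fst z" for z :: "real \<times> real" and x
    using that assms by (auto simp: field_simps)
qed

lemma tail_antimono: "a \<le> b \<Longrightarrow> measure \<nu> {b<..} \<le> measure \<nu> {a<..}"
  by (rule X.P.M2.finite_measure_mono) auto

text \<open>Above level \<open>L\<close> the recursion dominates \<open>L\<close> times the capped recursion with
  \<open>\<epsilon> = 1 / L\<close>; the defect contracts under the moment of order \<open>\<alpha> / 2\<close>.\<close>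

lemma tail_ge_capped:
  assumes L: "L > 0" and K: "real_distribution \<kappa>"
    and st: "\<kappa> = distr (\<mu> \<Otimes>\<^sub>M \<kappa>) borel (\<lambda>(z, x). cap (1 / L) z x)" and t: "t > 0"
  shows "measure \<nu> {L<..} * measure \<kappa> {t / L<..} \<le> measure \<nu> {t<..}"
proof -
  interpret C: perturbed_recursion \<mu> \<alpha> \<kappa> "cap (1 / L)" "\<lambda>z. 1 / L * \<bar>snd z\<bar> + 1"
    by (rule perturbed_cap[OF _ K st]) (use L in simp)
  define p where "p = measure \<nu> {L<..}"
  have p: "0 \<le> p" "p \<le> 1" by (auto simp: p_def)
  define F where "F t = measure \<nu> {t<..}" for t
  define H where "H t = measure \<kappa> {t / L<..}" for t
  have H01: "0 \<le> H t" "H t \<le> 1" for t by (auto simp: H_def)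
  have Fa: "F b \<le> F a" if "a \<le> b" for a b using tail_antimono[OF that] by (simp add: F_def)
  have Ha: "H b \<le> H a" if "a \<le> b" for a b
    unfolding H_def using that L by (intro C.P.M2.finite_measure_mono) (auto simp: field_simps)
  have Fm [measurable]: "F \<in> borel_measurable borel"
    using borel_measurable_mono[of "\<lambda>t. - F t"] Fa by (auto simp: mono_def)
  have Hm [measurable]: "H \<in> borel_measurable borel"
    using borel_measurable_mono[of "\<lambda>t. - H t"] Ha by (auto simp: mono_def)
  have F01: "0 \<le> F t" "F t \<le> 1" for t by (auto simp: F_def)
  define s where "s = \<alpha> / 2"
  have s: "0 < s" "s < \<alpha>" using alpha_pos by (auto simp: s_def)
  note A = A_moment_facts[OF s]
  define D where "D t = max 0 (p * H t - F t)" for t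
  have [measurable]: "D \<in> borel_measurable borel" unfolding D_def[abs_def] by measurable
  have pH: "0 \<le> p * H t" "p * H t \<le> 1" for t using p H01[of t] by (auto intro: mult_le_one)
  have D01: "0 \<le> D t" "D t \<le> 1" for t
    using pH[of t] F01[of t] by (auto simp: D_def)
  have Di: "integrable \<mu> (\<lambda>z. D ((t + \<bar>snd z\<bar>) / fst z))" for t
    using D01 by (intro integrable_const_bound[of _ 1]) auto
  \<comment> \<open>Below L nothing has to be proved: the tail of X there is at least its value p at
    L, and H is at most 1.\<close>
  have low: "D t = 0" if "t < L" for t
  proof -
    have "p * H t \<le> p * 1" using p H01 by (intro mult_left_mono) auto
    also have "\<dots> \<le> F t" using that tail_antimono[of t L] by (simp add: p_def F_def)
    finally show ?thesis by (simp add: D_def)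
  qed
  \<comment> \<open>From level L on the cap is inactive, since \<open>t / L \<ge> 1\<close>, so both
    tails obey linear recursions. Replacing B by \<open>- \<bar>snd z\<bar>\<close> in that of X
    only lowers its right-hand side and makes the arguments agree.\<close>
  have step: "D t \<le> (\<integral>z. D ((t + \<bar>snd z\<bar>) / fst z) \<partial>\<mu>)" if t: "t \<ge> L" for t
  proof -
    have "H t = (\<integral>z. measure \<kappa> {(t / L + 1 / L * \<bar>snd z\<bar>) / fst z<..} \<partial>\<mu>)"
      unfolding H_def
    proof (rule C.tail_recursion)
      show "(\<lambda>z :: real \<times> real. (t / L + 1 / L * \<bar>snd z\<bar>) / fst z) \<in> borel_measurable borel"
        unfolding borel_prod[symmetric] by measurable
      have "1 \<le> t / L" using t L by simp
      then show "t / L < cap (1 / L) z x \<longleftrightarrow> (t / L + 1 / L * \<bar>snd z\<bar>) / fst z < x" if "0 < fst z" for z x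
        using that unfolding cap_def by (simp add: less_max_iff_disj pos_divide_less_eq algebra_simps)
    qed
    also have "\<dots> = (\<integral>z. H ((t + \<bar>snd z\<bar>) / fst z) \<partial>\<mu>)"
      by (simp add: H_def add_divide_distrib mult.commute)
    finally have Ht: "p * H t = (\<integral>z. p * H ((t + \<bar>snd z\<bar>) / fst z) \<partial>\<mu>)" by simp
    have Fi: "integrable \<mu> (\<lambda>z. F ((t + \<bar>snd z\<bar>) / fst z))" "integrable \<mu> (\<lambda>z. F ((t - snd z) / fst z))"
      using F01 by (intro integrable_const_bound[of _ 1]; auto)+
    have Hi: "integrable \<mu> (\<lambda>z. p * H ((t + \<bar>snd z\<bar>) / fst z))"
      using pH by (intro integrable_const_bound[of _ 1]; auto)
    have "(\<integral>z. F ((t + \<bar>snd z\<bar>) / fst z) \<partial>\<mu>) \<le> (\<integral>z. F ((t - snd z) / fst z) \<partial>\<mu>)"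
    proof (rule integral_mono_AE[OF Fi])
      show "AE z in \<mu>. F ((t + \<bar>snd z\<bar>) / fst z) \<le> F ((t - snd z) / fst z)"
        using A_pos by eventually_elim (auto intro!: Fa divide_right_mono)
    qed
    also have "\<dots> = F t" using letac_tail_recursion[of t] t L by (simp add: F_def)
    finally have "p * H t - F t \<le> (\<integral>z. p * H ((t + \<bar>snd z\<bar>) / fst z) - F ((t + \<bar>snd z\<bar>) / fst z) \<partial>\<mu>)"
      unfolding Bochner_Integration.integral_diff[OF Hi Fi(1)] using Ht by linarith
    also have "\<dots> \<le> (\<integral>z. D ((t + \<bar>snd z\<bar>) / fst z) \<partial>\<mu>)"
      by (rule integral_mono) (use Hi Fi(1) Di in \<open>auto simp: D_def\<close>)
    finally have "p * H t - F t \<le> (\<integral>z. D ((t + \<bar>snd z\<bar>) / fst z) \<partial>\<mu>)" .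
    moreover have "0 \<le> (\<integral>z. D ((t + \<bar>snd z\<bar>) / fst z) \<partial>\<mu>)"
      using D01 by (intro integral_nonneg_AE) auto
    ultimately show ?thesis by (simp add: D_def)
  qed
  define M where "M = (\<integral>x. x powr s \<partial>\<kappa>) * L powr s"
  have M0: "0 \<le> M" unfolding M_def by (intro mult_nonneg_nonneg integral_nonneg_AE) auto
  \<comment> \<open>The defect starts below the Markov bound for the capped law, and each
    application of the recursion multiplies the bound by \<open>A_moment s\<close>; a fixed defect
    bounded by a geometric sequence vanishes.\<close>
  have iter: "D t \<le> M * A_moment s ^ n * t powr (- s)" if "t > 0" for t n
    using that
  proof (induction n arbitrary: t)
    case 0
    have "D t \<le> H t"
      using H01[of t] F01[of t] p by (auto simp: D_def intro: order_trans[OF _ mult_left_le_one_le[of "H t" p]])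
    also have "\<dots> \<le> (\<integral>x. x powr s \<partial>\<kappa>) * (t / L) powr (- s)"
      unfolding H_def using 0 L by (intro C.tail_markov s) auto
    also have "\<dots> = M * t powr (- s)"
      using 0 L by (simp add: M_def powr_divide powr_minus field_simps)
    finally show ?case by simp
  next
    case (Suc n)
    show ?case
    proof (cases "t < L")
      case True
      then show ?thesis using low A M0 by simp
    next
      case False
      then have "D t \<le> (\<integral>z. D ((t + \<bar>snd z\<bar>) / fst z) \<partial>\<mu>)" by (intro step) auto
      also have "\<dots> \<le> (\<integral>z. M * A_moment s ^ n * t powr (- s) * fst z powr s \<partial>\<mu>)"
      proof (rule integral_mono_AE[OF Di])
        show "integrable \<mu> (\<lambda>z. M * A_moment s ^ n * t powr (- s) * fst z powr s)" using A(1) by simp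
        show "AE z in \<mu>. D ((t + \<bar>snd z\<bar>) / fst z) \<le> M * A_moment s ^ n * t powr (- s) * fst z powr s"
          using A_pos
        proof eventually_elim
          case (elim z)
          have tp: "0 < t" using Suc.prems .
          have "D ((t + \<bar>snd z\<bar>) / fst z) \<le> M * A_moment s ^ n * ((t + \<bar>snd z\<bar>) / fst z) powr (- s)"
            using elim tp by (intro Suc.IH divide_pos_pos) auto
          also have "\<dots> \<le> M * A_moment s ^ n * (t / fst z) powr (- s)"
            using elim tp s M0 A(2) by (intro mult_left_mono powr_mono2' divide_right_mono) auto
          also have "\<dots> = M * A_moment s ^ n * t powr (- s) * fst z powr s"
            using elim tp by (simp add: powr_divide powr_minus field_simps)
          finally show ?case .
        qed
      qed
      also have "\<dots> = M * A_moment s ^ Suc n * t powr (- s)" by (simp add: A_moment_def)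
      finally show ?thesis .
    qed
  qed
  have "(\<lambda>n. M * A_moment s ^ n * t powr (- s)) \<longlonglongrightarrow> M * 0 * t powr (- s)"
    using A by (intro tendsto_intros LIMSEQ_realpow_zero) auto
  then have "D t \<le> M * 0 * t powr (- s)"
    by (rule LIMSEQ_le_const) (use iter[OF t] in blast)
  then show ?thesis by (simp add: D_def p_def H_def F_def)
qed

lemma tail_constant_pos:
  assumes unb: "\<And>L. measure \<nu> {L<..} > 0"
    and lim: "((\<lambda>t. measure \<nu> {t<..} * t powr \<alpha>) \<longlongrightarrow> C) at_top"
  shows "C > 0"
proof -
  obtain e0 where e0: "e0 > 0"
    "\<And>\<epsilon>. 0 < \<epsilon> \<Longrightarrow> \<epsilon> < e0 \<Longrightarrow> \<exists>\<kappa> C. real_distribution \<kappa> \<and> \<kappa> = distr (\<mu> \<Otimes>\<^sub>M \<kappa>) borel (\<lambda>(z, x). cap \<epsilon> z x)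
       \<and> C > 0 \<and> ((\<lambda>t. measure \<kappa> {t<..} * t powr \<alpha>) \<longlongrightarrow> C) at_top"
    using capped_law_positive_tail by blast
  \<comment> \<open>Only \<open>1 / L < e0\<close> matters: the level of comparison fixes the
    strength of the perturbation in the capped recursion.\<close>
  define L where "L = 2 / e0"
  have L: "L > 0" "1 / L < e0" using e0(1) by (auto simp: L_def)
  obtain \<kappa> c where \<kappa>: "real_distribution \<kappa>" "\<kappa> = distr (\<mu> \<Otimes>\<^sub>M \<kappa>) borel (\<lambda>(z, x). cap (1 / L) z x)"
    and c: "c > 0" "((\<lambda>t. measure \<kappa> {t<..} * t powr \<alpha>) \<longlongrightarrow> c) at_top"
    using e0(2)[of "1 / L"] L by auto
  define p where "p = measure \<nu> {L<..}"
  have "filterlim (\<lambda>t. t / L) at_top at_top"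
    using L by (intro filterlim_tendsto_pos_mult_at_top[OF tendsto_const[of "1 / L"] _ filterlim_ident, simplified]) auto
  from filterlim_compose[OF c(2) this]
  have "((\<lambda>t. p * L powr \<alpha> * (measure \<kappa> {t / L<..} * (t / L) powr \<alpha>)) \<longlongrightarrow> p * L powr \<alpha> * c) at_top"
    by (intro tendsto_mult tendsto_const)
  moreover have "eventually (\<lambda>t. p * L powr \<alpha> * (measure \<kappa> {t / L<..} * (t / L) powr \<alpha>) \<le> measure \<nu> {t<..} * t powr \<alpha>) at_top"
    using eventually_gt_at_top[of 0]
  proof eventually_elim
    case (elim t)
    have "p * L powr \<alpha> * (measure \<kappa> {t / L<..} * (t / L) powr \<alpha>) = (p * measure \<kappa> {t / L<..}) * t powr \<alpha>"
      using elim L by (simp add: powr_divide)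
    also have "\<dots> \<le> measure \<nu> {t<..} * t powr \<alpha>"
      unfolding p_def using tail_ge_capped[OF L(1) \<kappa> elim] by (intro mult_right_mono) auto
    finally show ?case .
  qed
  ultimately have "p * L powr \<alpha> * c \<le> C"
    using tendsto_le[OF _ lim] by (meson trivial_limit_at_top_linorder)
  moreover have "0 < p * L powr \<alpha> * c" using unb[of L] L c by (simp add: p_def)
  ultimately show ?thesis by simp
qed

text \<open>The excess over M contracts: if the affine map does not raise M, the new excess is at
  most A times the old one. Its moment of order \<open>\<alpha> / 2\<close> is finite and by
  stationarity at most E A^(alpha/2) times itself, hence 0.\<close>

lemma bounded_if_invariant:
  assumes M: "M \<ge> 0" and inv: "AE z in \<mu>. fst z * M + snd z \<le> M"
  shows "measure \<nu> {M<..} = 0"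
proof -
  define s where "s = \<alpha> / 2"
  have s: "0 < s" "s < \<alpha>" using alpha_pos by (auto simp: s_def)
  note A = A_moment_facts[OF s]
  define f where "f x = max 0 (x - M) powr s" for x
  have [measurable]: "f \<in> borel_measurable borel" unfolding f_def[abs_def] by measurable
  have fi: "integrable \<nu> f"
  proof (rule Bochner_Integration.integrable_bound[OF X.moment_integrable[OF s]])
    show "AE x in \<nu>. norm (f x) \<le> norm (x powr s)"
      using X.AE_nonneg by eventually_elim (use s M in \<open>auto simp: f_def intro!: powr_mono2\<close>)
  qed measurable
  have Ti: "integrable (\<mu> \<Otimes>\<^sub>M \<nu>) (\<lambda>(z, x). f (max (fst z * x + snd z) 0))"
  proof -
    have "integrable (distr (\<mu> \<Otimes>\<^sub>M \<nu>) borel (\<lambda>(z, x). max (fst z * x + snd z) 0)) f"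
      using fi by (subst X.stationary[symmetric])
    then show ?thesis by (subst (asm) integrable_distr_eq) (auto simp: case_prod_unfold)
  qed
  have "(\<integral>x. f x \<partial>\<nu>) = (\<integral>(z, x). f (max (fst z * x + snd z) 0) \<partial>(\<mu> \<Otimes>\<^sub>M \<nu>))"
    by (rule X.stationary_integral) measurable
  also have "\<dots> \<le> (\<integral>(z, x). fst z powr s * f x \<partial>(\<mu> \<Otimes>\<^sub>M \<nu>))"
  proof (rule integral_mono_AE[OF Ti X.prod_integrable(1)[OF A(1) fi]])
    have "AE z in \<mu>. AE x in \<nu>. fst (fst (z, x)) * M + snd (fst (z, x)) \<le> M"
      using inv by eventually_elim simp
    then have "AE w in \<mu> \<Otimes>\<^sub>M \<nu>. fst (fst w) * M + snd (fst w) \<le> M"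
      by (subst (asm) X.P.AE_pair_iff) auto
    then show "AE w in \<mu> \<Otimes>\<^sub>M \<nu>. (case w of (z, x) \<Rightarrow> f (max (fst z * x + snd z) 0)) \<le> (case w of (z, x) \<Rightarrow> fst z powr s * f x)"
      using X.AE_pair
    proof eventually_elim
      case (elim w)
      obtain z x where w: "w = (z, x)" by (cases w)
      have h: "fst z * M + snd z \<le> M" "fst z > 0" using elim w by auto
      have "max (fst z * x + snd z) 0 - M \<le> max 0 (fst z * (x - M))"
        using h(1) M right_diff_distrib[of "fst z" x M] by linarith
      also have "\<dots> = fst z * max 0 (x - M)"
        using h(2) by (auto simp: max_def zero_le_mult_iff)
      finally have "max 0 (max (fst z * x + snd z) 0 - M) \<le> fst z * max 0 (x - M)"
        using h(2) by simp
      then have "f (max (fst z * x + snd z) 0) \<le> (fst z * max 0 (x - M)) powr s"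
        unfolding f_def using s by (intro powr_mono2) auto
      also have "\<dots> = fst z powr s * f x" using h(2) by (simp add: f_def powr_mult)
      finally show ?case by (simp add: w)
    qed
  qed
  also have "\<dots> = A_moment s * (\<integral>x. f x \<partial>\<nu>)"
    unfolding A_moment_def by (rule X.prod_integrable(2)[OF A(1) fi])
  finally have "(1 - A_moment s) * (\<integral>x. f x \<partial>\<nu>) \<le> 0" by (simp add: algebra_simps)
  then have "(\<integral>x. f x \<partial>\<nu>) \<le> 0" using A(3) by (simp add: mult_le_0_iff)
  moreover have "(\<integral>x. f x \<partial>\<nu>) \<ge> 0" unfolding f_def by (intro integral_nonneg_AE) auto
  ultimately have f0: "(\<integral>x. f x \<partial>\<nu>) = 0" by simp
  have "AE x in \<nu>. 0 \<le> f x" by (simp add: f_def)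
  from integral_nonneg_eq_0_iff_AE[OF fi this] f0 have "AE x in \<nu>. f x = 0" by blast
  then have "AE x in \<nu>. x \<notin> {M<..}"
    by eventually_elim (auto simp: f_def)
  then show ?thesis
    by (subst X.P.M2.prob_eq_0) auto
qed

text \<open>M is the essential supremum of X. Independence gives, for almost every pair, A x + B at
  most M for almost every x; as every interval (M - d, M] is charged, this extends to x = M by
  letting d tend to 0.\<close>

lemma invariant_if_bounded:
  assumes L: "measure \<nu> {L<..} = 0"
  obtains M where "M \<ge> 0" "AE z in \<mu>. fst z * M + snd z \<le> M"
proof -
  define S where "S = {t. measure \<nu> {t<..} = 0}"
  define M where "M = Inf S"
  have neg: "measure \<nu> {t<..} = 1" if "t < 0" for t
    using X.AE_nonneg that by (subst X.P.M2.prob_eq_1) (auto elim: eventually_mono)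
  have S0: "0 \<le> t" if "t \<in> S" for t using neg[of t] that by (force simp: S_def)
  have LS: "L \<in> S" using L by (simp add: S_def)
  have "M \<ge> 0" unfolding M_def using S0 LS by (intro cInf_greatest) auto
  have below: "measure \<nu> {t<..} > 0" if "t < M" for t
  proof -
    have "bdd_below S" using S0 by (rule bdd_belowI)
    then have "t \<notin> S" using that cInf_lower[of t S] by (auto simp: M_def)
    then show ?thesis by (simp add: S_def zero_less_measure_iff)
  qed
  have "AE x in \<nu>. x \<le> M + 1 / Suc n" for n
  proof -
    obtain t where t: "t \<in> S" "t < M + 1 / Suc n"
      using cInf_lessD[of S "M + 1 / Suc n"] LS by (auto simp: M_def)
    then have "AE x in \<nu>. x \<notin> {t<..}" by (subst X.P.M2.prob_eq_0[symmetric]) (auto simp: S_def)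
    then show ?thesis by eventually_elim (use t in auto)
  qed
  then have "AE x in \<nu>. \<forall>n. x \<le> M + 1 / Suc n" by (simp add: AE_all_countable)
  then have top: "AE x in \<nu>. x \<le> M"
  proof eventually_elim
    case (elim x)
    have "(\<lambda>n. M + 1 / Suc n) \<longlonglongrightarrow> M + 0"
      by (intro tendsto_add tendsto_const LIMSEQ_inverse_real_of_nat[unfolded inverse_eq_divide])
    then show ?case using elim by (intro LIMSEQ_le_const) auto
  qed
  have "AE w in \<mu> \<Otimes>\<^sub>M \<nu>. (case w of (z, x) \<Rightarrow> max (fst z * x + snd z) 0) \<le> M"
    using top by (subst (asm) X.stationary, subst (asm) AE_distr_iff) (auto simp: case_prod_unfold)
  then have "AE z in \<mu>. AE x in \<nu>. max (fst z * x + snd z) 0 \<le> M"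
    by (subst X.P.AE_pair_iff) (auto simp: case_prod_unfold)
  with A_pos have "AE z in \<mu>. fst z * M + snd z \<le> M"
  proof eventually_elim
    case (elim z)
    have "fst z * (M - d) + snd z \<le> M" if "d > 0" for d
    proof (rule ccontr)
      assume n: "\<not> fst z * (M - d) + snd z \<le> M"
      from elim(2) have "AE x in \<nu>. x \<notin> {M - d<..}"
      proof eventually_elim
        case (elim x)
        show ?case
        proof
          assume "x \<in> {M - d<..}"
          then have "fst z * (M - d) \<le> fst z * x" using \<open>0 < fst z\<close> by (intro mult_left_mono) auto
          then show False using elim n by simp
        qed
      qed
      then have "measure \<nu> {M - d<..} = 0" by (subst X.P.M2.prob_eq_0) auto
      then show False using below[of "M - d"] that by simp
    qed
    note le = this
    have "((\<lambda>d. fst z * (M - d) + snd z) \<longlongrightarrow> fst z * (M - 0) + snd z) (at_right 0)"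
      by (intro tendsto_intros)
    then have "fst z * (M - 0) + snd z \<le> M"
      by (rule tendsto_upperbound) (auto intro!: eventually_at_rightI[of 0 1] le)
    then show ?case by simp
  qed
  with \<open>M \<ge> 0\<close> show ?thesis by (rule that)
qed

end

section \<open>Invariant upper bounds in terms of fixed points\<close>

lemma null_open_misses_support:
  assumes "z \<in> measure_support \<mu>" "open U" "z \<in> U" "AE w in \<mu>. w \<notin> U"
  shows False
proof -
  have "U \<in> sets \<mu>" using assms(2) sets_mu by auto
  then have "emeasure \<mu> U = 0" using assms(4) by (subst AE_iff_measurable[symmetric]) (auto dest: sets.sets_into_space)
  then show False using assms by (auto simp: measure_support_def)
qed

text \<open>The inequality A M + B \<le> M is closed, so it holds on the whole support. There it
  says that fixed points of contracting maps lie at or below M and those of expanding maps at or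
  above it, so M separates the two families.\<close>

lemma not_condition_if_invariant:
  assumes M: "M \<ge> 0" and inv: "AE z in \<mu>. fst z * M + snd z \<le> M"
  shows "N2 \<mu> \<le> N3 \<mu>" "measure \<mu> {z. fst z > 1 \<and> snd z > 0} = 0"
proof -
  have supp: "fst z * M + snd z \<le> M" if z: "z \<in> measure_support \<mu>" for z
  proof (rule ccontr)
    assume n: "\<not> fst z * M + snd z \<le> M"
    show False
    proof (rule null_open_misses_support[OF z, of "{z. M < fst z * M + snd z}"])
      show "open {z :: real \<times> real. M < fst z * M + snd z}" by (intro open_Collect_less continuous_intros)
      show "AE w in \<mu>. w \<notin> {z. M < fst z * M + snd z}" using inv by eventually_elim auto
    qed (use n in auto)
  qed
  have "N2 \<mu> \<le> ereal M"
    unfolding N2_def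
  proof (rule Sup_least, clarsimp)
    fix a b assume "(a, b) \<in> measure_support \<mu>" "a < 1"
    then show "xfix a b \<le> M" using supp[of "(a, b)"] by (simp add: xfix_def field_simps)
  qed
  also have "ereal M \<le> N3 \<mu>"
    unfolding N3_def
  proof (rule Inf_greatest, clarsimp)
    fix a b assume "(a, b) \<in> measure_support \<mu>" "1 < a"
    then show "M \<le> xfix a b" using supp[of "(a, b)"] by (simp add: xfix_def field_simps)
  qed
  finally show "N2 \<mu> \<le> N3 \<mu>" .
  have "AE z in \<mu>. z \<notin> {z. fst z > 1 \<and> snd z > 0}"
    using inv
  proof eventually_elim
    case (elim z)
    have "M \<le> fst z * M" if "fst z > 1" using mult_right_mono[of 1 "fst z" M] that M by simp
    then show ?case using elim by auto
  qed
  then show "measure \<mu> {z. fst z > 1 \<and> snd z > 0} = 0"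
    by (subst prob_eq_0) (auto simp: sets_mu intro!: borel_open open_Collect_conj open_Collect_less continuous_intros)
qed

text \<open>Otherwise log A would be almost surely at most 0 and the tilted walk could not have
  positive mean. The consequence sought is that the infimum defining \<open>N3 \<mu>\<close> runs
  over a nonempty set.\<close>

lemma A_greater_1_in_support: "\<exists>z\<in>measure_support \<mu>. fst z > 1"
proof (rule ccontr)
  assume n: "\<not> (\<exists>z\<in>measure_support \<mu>. fst z > 1)"
  have le: "AE z in \<mu>. fst z \<le> 1"
    using AE_measure_support[OF sets_mu] by eventually_elim (use n in auto)
  have "(\<integral>x. x \<partial>eta) \<le> 0"
  proof (subst eta_integral)
    have "AE z in \<mu>. fst z powr \<alpha> * ln (fst z) \<le> 0"
      using le A_pos by eventually_elim (auto simp: mult_le_0_iff)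
    then have "(\<integral>z. - (fst z powr \<alpha> * ln (fst z)) \<partial>\<mu>) \<ge> 0"
      by (intro integral_nonneg_AE) auto
    then show "(\<integral>z. fst z powr \<alpha> * ln (fst z) \<partial>\<mu>) \<le> 0" by simp
  qed simp
  then show False using W.mean_pos by (simp add: W.mean_def)
qed

text \<open>The witness is M = \<open>N3 \<mu>\<close>: finite because expanding maps exist, and
  nonnegative because on the support a > 1 forces b \<le> 0. Expanding maps satisfy the inequality
  by definition of the infimum, contracting ones through \<open>N2 \<mu> \<le> N3 \<mu>\<close>. For
  a = 1, where there is no fixed point to compare, it reduces to b \<le> 0, which the hypothesis on
  that line supplies.\<close>

lemma invariant_if_not_condition:
  assumes N: "N2 \<mu> \<le> N3 \<mu>" and z: "measure \<mu> {z. fst z > 1 \<and> snd z > 0} = 0"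
    and one: "measure \<mu> {z. fst z = 1 \<and> snd z > 0} = 0"
  obtains M where "M \<ge> 0" "AE z in \<mu>. fst z * M + snd z \<le> M"
proof -
  have op: "open {z :: real \<times> real. fst z > 1 \<and> snd z > 0}"
    by (intro open_Collect_conj open_Collect_less continuous_intros)
  then have z': "AE w in \<mu>. w \<notin> {z. fst z > 1 \<and> snd z > 0}"
    using z sets_mu by (subst (asm) prob_eq_0) auto
  have "closed {z :: real \<times> real. fst z = 1}" "open {z :: real \<times> real. snd z > 0}"
    by (intro closed_Collect_eq open_Collect_less continuous_intros)+
  then have "{z :: real \<times> real. fst z = 1} \<inter> {z. snd z > 0} \<in> sets \<mu>"
    unfolding sets_mu by (intro sets.Int borel_closed borel_open)
  then have "{z :: real \<times> real. fst z = 1 \<and> snd z > 0} \<in> sets \<mu>"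
    by (simp add: Collect_conj_eq)
  then have one': "AE w in \<mu>. w \<notin> {z. fst z = 1 \<and> snd z > 0}"
    using one by (subst (asm) prob_eq_0) auto
  have nonneg: "0 \<le> xfix a b" if "(a, b) \<in> measure_support \<mu>" "1 < a" for a b
  proof -
    have "b \<le> 0"
      using null_open_misses_support[OF that(1) op _ z'] that(2) by force
    then show ?thesis using that(2) by (auto simp: xfix_def zero_le_divide_iff)
  qed
  have N30: "0 \<le> N3 \<mu>"
    unfolding N3_def by (rule Inf_greatest) (use nonneg in \<open>auto simp flip: zero_ereal_def\<close>)
  obtain a b where ab: "(a, b) \<in> measure_support \<mu>" "a > 1" using A_greater_1_in_support by force
  have "N3 \<mu> \<le> ereal (xfix a b)" unfolding N3_def by (rule Inf_lower) (use ab in force)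
  with N30 obtain M where M: "N3 \<mu> = ereal M" "M \<ge> 0" by (cases "N3 \<mu>") auto
  have "AE z in \<mu>. fst z * M + snd z \<le> M"
    using AE_measure_support[OF sets_mu] one'
  proof eventually_elim
    case (elim z)
    obtain a b where z: "z = (a, b)" by (cases z)
    consider "a < 1" | "a = 1" | "a > 1" by linarith
    then show ?case
    proof cases
      case 1
      have "ereal (xfix a b) \<le> N2 \<mu>" unfolding N2_def by (rule Sup_upper) (use 1 elim z in force)
      then have "ereal (xfix a b) \<le> ereal M" using N M by (metis order_trans)
      then show ?thesis using 1 by (simp add: z xfix_def field_simps)
    next
      case 2
      then show ?thesis using elim(2) by (simp add: z)
    next
      case 3
      have "N3 \<mu> \<le> ereal (xfix a b)" unfolding N3_def by (rule Inf_lower) (use 3 elim z in force)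
      then show ?thesis using 3 M by (simp add: z xfix_def field_simps)
    qed
  qed
  with M(2) show ?thesis by (rule that)
qed

end

theorem theorem3p7:
  fixes \<mu> :: "(real \<times> real) measure" and \<nu> :: "real measure" and \<alpha> :: real
  assumes prob: "prob_space \<mu>" and sets_mu: "sets \<mu> = sets borel"
    and Apos: "AE z in \<mu>. fst z > 0"
    and neg_drift: "(\<integral>\<^sup>+ z. ennreal (max 0 (ln (fst z))) \<partial>\<mu>)
                    < (\<integral>\<^sup>+ z. ennreal (max 0 (- ln (fst z))) \<partial>\<mu>)"
    and alpha_pos: "\<alpha> > 0"
    and cramer: "(\<integral>\<^sup>+ z. ennreal (fst z powr \<alpha>) \<partial>\<mu>) = 1"
    and moment: "(\<integral>\<^sup>+ z. ennreal (\<bar>snd z\<bar> powr \<alpha> + fst z powr \<alpha> * max 0 (ln (fst z))) \<partial>\<mu>) < \<infinity>"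
    and nonar: "log_nonarithmetic \<mu>"
    and stat: "letac_stationary \<mu> \<nu>"
    and no_atom: "measure \<mu> {z. fst z = 1 \<and> snd z > 0} = 0"
  shows "\<exists>C\<ge>0. ((\<lambda>t. measure \<nu> {t<..} * t powr \<alpha>) \<longlongrightarrow> C) at_top \<and>
           (C > 0 \<longleftrightarrow> (N3 \<mu> < N2 \<mu> \<or> measure \<mu> {z. fst z > 1 \<and> snd z > 0} > 0))"
proof -
  have [measurable]: "fst \<in> borel_measurable \<mu>" "snd \<in> borel_measurable \<mu>"
    unfolding measurable_cong_sets[OF sets_mu refl]
    by (intro borel_measurable_continuous_onI continuous_intros)+
  have sum: "integrable \<mu> (\<lambda>z. \<bar>snd z\<bar> powr \<alpha> + fst z powr \<alpha> * max 0 (ln (fst z)))"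
    using moment by (intro integrableI_nonneg) auto
  have B: "integrable \<mu> (\<lambda>z. \<bar>snd z\<bar> powr \<alpha>)"
    by (rule Bochner_Integration.integrable_bound[OF sum]) auto
  have A: "integrable \<mu> (\<lambda>z. fst z powr \<alpha> * max 0 (ln (fst z)))"
    by (rule Bochner_Integration.integrable_bound[OF sum]) auto
  interpret letac_pair \<mu> \<alpha>
    by (intro letac_pair.intro letac_pair_axioms.intro cramer_pair.intro cramer_pair_axioms.intro)
      (fact prob sets_mu Apos alpha_pos cramer A nonar B)+
  interpret X: perturbed_recursion \<mu> \<alpha> \<nu> "\<lambda>z x. max (fst z * x + snd z) 0" "\<lambda>z. \<bar>snd z\<bar>"
    by (rule perturbed_letac[OF stat])
  obtain C where C: "((\<lambda>t. measure \<nu> {t<..} * t powr \<alpha>) \<longlongrightarrow> C) at_top"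
    using X.tail_limit by blast
  have C0: "C \<ge> 0"
    by (rule tendsto_lowerbound[OF C]) auto
  have "C > 0 \<longleftrightarrow> N3 \<mu> < N2 \<mu> \<or> measure \<mu> {z. fst z > 1 \<and> snd z > 0} > 0"
  proof
    assume cond: "N3 \<mu> < N2 \<mu> \<or> measure \<mu> {z. fst z > 1 \<and> snd z > 0} > 0"
    show "C > 0"
    proof (rule tail_constant_pos[OF stat _ C])
      fix L
      have "measure \<nu> {L<..} \<noteq> 0"
      proof
        assume "measure \<nu> {L<..} = 0"
        then obtain M where "M \<ge> 0" "AE z in \<mu>. fst z * M + snd z \<le> M"
          using invariant_if_bounded[OF stat] by blast
        from not_condition_if_invariant[OF this] cond show False by auto
      qed
      then show "measure \<nu> {L<..} > 0" by (simp add: zero_less_measure_iff)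
    qed
  next
    assume "C > 0"
    show "N3 \<mu> < N2 \<mu> \<or> measure \<mu> {z. fst z > 1 \<and> snd z > 0} > 0"
    \<comment> \<open>Failure of the condition yields an invariant bound M; the tail vanishes beyond
      it, so the limit must be 0.\<close>
    proof (rule ccontr)
      assume "\<not> (N3 \<mu> < N2 \<mu> \<or> measure \<mu> {z. fst z > 1 \<and> snd z > 0} > 0)"
      then have "N2 \<mu> \<le> N3 \<mu>" "measure \<mu> {z. fst z > 1 \<and> snd z > 0} = 0"
        by (auto simp: not_less zero_less_measure_iff)
      then obtain M where M: "M \<ge> 0" "AE z in \<mu>. fst z * M + snd z \<le> M"
        using invariant_if_not_condition no_atom by blast
      have "eventually (\<lambda>t. measure \<nu> {t<..} * t powr \<alpha> = 0) at_top"
        using eventually_ge_at_top[of M]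
      proof eventually_elim
        case (elim t)
        then have "measure \<nu> {t<..} \<le> 0"
          using bounded_if_invariant[OF stat M] tail_antimono[OF stat elim] by simp
        then show ?case by (simp add: measure_le_0_iff)
      qed
      then have "((\<lambda>t. measure \<nu> {t<..} * t powr \<alpha>) \<longlongrightarrow> 0) at_top" by (rule tendsto_eventually)
      then have "C = 0" using C tendsto_unique trivial_limit_at_top_linorder by blast
      then show False using \<open>C > 0\<close> by simp
    qed
  qed
  then show ?thesis using C C0 by blast
qed

end
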